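(* Let $b$ be a prime, $m\in\mathbb{N}$, $N=b^m$, $s\in\mathbb{N}$, $\alpha>1$, let $(\gamma_{\mathfrak{u}})$ be positive weights, indexed by finite sets $\mathfrak{u}\subset\mathbb{N}$, with $\gamma_\emptyset=1$, let $0\le w_1\le w_2\le\cdots$ be integers, and put $Y_j=x^{w_j}\in\mathbb{F}_b[x]$. Let $\boldsymbol{g}=(Y_1g_1,\ldots,Y_sg_s)$ be constructed by the reduced successive coordinate search (SCS) algorithm for polynomial lattice rules with modulus $x^m$ (defined in the context) from some starting vector $\boldsymbol{g}^0\in\{g\in\mathbb{F}_b[x]:\deg(g)<m\}^s$. Then for all $\delta\in(0,\frac{\alpha-1}{2}]$, $$e_{N,s}(\boldsymbol{g})\le C_{s,\alpha,\boldsymbol{\gamma},\delta}\,N^{-\alpha/2+\delta},$$ where $$C_{s,\alpha,\boldsymbol{\gamma},\delta}:=\left(2\sum_{d=1}^s\ \sum_{d\in\mathfrak{u}\subseteq[s]}\gamma_{\mathfrak{u}}^{\frac{1}{\alpha-2\delta}}\left(\mu_b\left(\tfrac{\alpha}{\alpha-2\delta}\right)\right)^{|\mathfrak{u}|}b^{w_d}\right)^{\alpha/2-\delta}.$$ For $\delta\in(0,\frac{\alpha-1}{2}]$ and $q\ge0$ define $$C_{\delta,q}:=\sup_{s\in\mathbb{N}}\left[\frac{2}{s^q}\sum_{d=1}^s\ \sum_{d\in\mathfrak{u}\subseteq[s]}\gamma_{\mathfrak{u}}^{\frac{1}{\alpha-2\delta}}\left(\mu_b\left(\tfrac{\alpha}{\alpha-2\delta}\right)\right)^{|\mathfrak{u}|}b^{w_d}\right].$$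 If $C_{\delta,q}<\infty$ for some $\delta\in(0,\frac{\alpha-1}{2}]$ and $q\ge0$, then $$e_{N,s}(\boldsymbol{g})\le(s^qC_{\delta,q})^{\alpha/2-\delta}N^{-\alpha/2+\delta}.$$ If $C_{\delta,0}<\infty$ for some $\delta\in(0,\frac{\alpha-1}{2}]$, then $$e_{N,s}(\boldsymbol{g})\le(C_{\delta,0})^{\alpha/2-\delta}N^{-\alpha/2+\delta}.$$
   Context: Notation: $[s]=\{1,\ldots,s\}$; for a vector $\boldsymbol{x}$ and $\mathfrak{u}\subseteq[s]$, $\boldsymbol{x}_{\mathfrak{u}}=(x_j)_{j\in\mathfrak{u}}$; $\mathbb{F}_b$ is the field with $b$ elements, identified with $\{0,\ldots,b-1\}$. For $h\in\mathbb{N}$, $\psi_b(h)=\lfloor\log_b h\rfloor$ and $r_\alpha(h)=b^{-\alpha\psi_b(h)}$; for vectors $r_\alpha(\boldsymbol{h})=\prod_j r_\alpha(h_j)$. For $\beta>1$, $\mu_b(\beta)=\sum_{h=1}^\infty r_\beta(h)=\frac{b^\beta(b-1)}{b^\beta-b}$. Walsh functions: for $h=h_0+h_1b+\cdots+h_ab^a$ (base-$b$ digits) and $x=\frac{x_1}{b}+\frac{x_2}{b^2}+\cdots\in[0,1)$ (with infinitely many digits $x_i\neq b-1$), $\mathrm{wal}_h(x)=\mathrm{e}^{2\pi\mathrm{i}(x_1h_0+\cdots+x_{a+1}h_a)/b}$; $\mathrm{wal}_{\boldsymbol{h}}(\boldsymbol{x})=\prod_j\mathrm{wal}_{h_j}(x_j)$.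 Weighted Walsh space: $\mathcal{H}(K^{\mathrm{wal}}_{s,\alpha,\boldsymbol{\gamma}})$ is the reproducing kernel Hilbert space with kernel $$K^{\mathrm{wal}}_{s,\alpha,\boldsymbol{\gamma}}(\boldsymbol{x},\boldsymbol{y})=1+\sum_{\emptyset\ne\mathfrak{u}\subseteq[s]}\gamma_{\mathfrak{u}}\sum_{\boldsymbol{h}_{\mathfrak{u}}\in\mathbb{N}^{|\mathfrak{u}|}}r_\alpha(\boldsymbol{h}_{\mathfrak{u}})\,\mathrm{wal}_{\boldsymbol{h}_{\mathfrak{u}}}(\boldsymbol{x}_{\mathfrak{u}})\,\overline{\mathrm{wal}_{\boldsymbol{h}_{\mathfrak{u}}}(\boldsymbol{y}_{\mathfrak{u}})}.$$ Polynomial lattice rule with modulus $x^m$: for $v\in\mathbb{F}_b[x]$ with $v\equiv a_0+a_1x+\cdots+a_{m-1}x^{m-1}\pmod{x^m}$ put $\nu(v/x^m)=\frac{a_{m-1}}{b}+\cdots+\frac{a_1}{b^{m-1}}+\frac{a_0}{b^m}\in[0,1)$. For $\boldsymbol{g}=(g_1,\ldots,g_s)\in(\mathbb{F}_b[x])^s$ the node set consists of the $b^m$ points $\boldsymbol{x}_n=(\nu(ng_1/x^m),\ldots,\nu(ng_s/x^m))$, $n\in\mathbb{F}_b[x]$, $\deg(n)<m$. Worst-case error: $e_{N,s}(\boldsymbol{g})$ is the supremum of the absolute integration error $\left|\int_{[0,1]^s}f-\frac1{b^m}\sum_nf(\boldsymbol{x}_n)\right|$ over the unit ball of $\mathcal{H}(K^{\mathrm{wal}}_{s,\alpha,\boldsymbol{\gamma}})$.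 It is known that $$e_{N,s}^2(\boldsymbol{g})=\sum_{\emptyset\ne\mathfrak{u}\subseteq[s]}\gamma_{\mathfrak{u}}\sum_{\boldsymbol{h}_{\mathfrak{u}}\in\mathcal{D}_{\mathfrak{u}}}\prod_{j\in\mathfrak{u}}b^{-\alpha\psi_b(h_j)},\qquad \mathcal{D}_{\mathfrak{u}}=\Big\{\boldsymbol{h}_{\mathfrak{u}}\in\mathbb{N}^{|\mathfrak{u}|}:\sum_{j\in\mathfrak{u}}\mathrm{tr}_m(h_j)g_j\equiv0\ (\mathrm{mod}\ x^m)\Big\},$$ where $\mathrm{tr}_m(h)=h_0+h_1x+\cdots+h_{m-1}x^{m-1}\in\mathbb{F}_b[x]$ for $h=\sum_ih_ib^i$. Search spaces: $\mathcal{G}_{N,w_j}=\{g\in\mathbb{F}_b[x]:0\le\deg(g)<m-w_j,\ \gcd(g,x^m)=1\}$ if $w_j<m$, and $\mathcal{G}_{N,w_j}=\{1\}$ if $w_j\ge m$. Reduced SCS algorithm: given $\boldsymbol{g}^0=(g_1^0,\ldots,g_s^0)$, for $d=1,\ldots,s$ successively, with $g_1,\ldots,g_{d-1}$ already selected, choose $g_d\in\mathcal{G}_{N,w_d}$ such that $e_{N,s}^2((Y_1g_1,\ldots,Y_{d-1}g_{d-1},Y_dg_d,g_{d+1}^0,\ldots,g_s^0))$ is minimized as a function of $g_d$ over $\mathcal{G}_{N,w_d}$. The output is $\boldsymbol{g}=(Y_1g_1,\ldots,Y_sg_s)$. *)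

theory Defs
  imports "HOL-Analysis.Analysis" "Berlekamp_Zassenhaus.Finite_Field"
begin

(* Functions on D are represented by their extension by zero to the whole type, so that
   pointwise operations and extensional equality agree with those of functions on D.
   The inner product is linear in its first argument. *)
definition kernel_section :: "'x set \<Rightarrow> ('x \<Rightarrow> 'x \<Rightarrow> complex) \<Rightarrow> 'x \<Rightarrow> 'x \<Rightarrow> complex" where
  "kernel_section D K y = (\<lambda>x. if x \<in> D then K x y else 0)"

definition ip_norm :: "('v \<Rightarrow> 'v \<Rightarrow> complex) \<Rightarrow> 'v \<Rightarrow> real" where
  "ip_norm ip f = sqrt (Re (ip f f))"

locale rkhs =
  fixes D :: "'x set"
    and K :: "'x \<Rightarrow> 'x \<Rightarrow> complex"
    and H :: "('x \<Rightarrow> complex) set"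
    and ip :: "('x \<Rightarrow> complex) \<Rightarrow> ('x \<Rightarrow> complex) \<Rightarrow> complex"
  assumes vanishes_outside: "\<And>f x. f \<in> H \<Longrightarrow> x \<notin> D \<Longrightarrow> f x = 0"
    and zero_mem: "(\<lambda>x. 0) \<in> H"
    and add_mem: "\<And>f g. f \<in> H \<Longrightarrow> g \<in> H \<Longrightarrow> (\<lambda>x. f x + g x) \<in> H"
    and scale_mem: "\<And>c f. f \<in> H \<Longrightarrow> (\<lambda>x. c * f x) \<in> H"
    and ip_add: "\<And>f g h. f \<in> H \<Longrightarrow> g \<in> H \<Longrightarrow> h \<in> H \<Longrightarrow>
          ip (\<lambda>x. f x + g x) h = ip f h + ip g h"
    and ip_scale: "\<And>c f h. f \<in> H \<Longrightarrow> h \<in> H \<Longrightarrow> ip (\<lambda>x. c * f x) h = c * ip f h"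
    and ip_cnj: "\<And>f g. f \<in> H \<Longrightarrow> g \<in> H \<Longrightarrow> ip g f = cnj (ip f g)"
    and ip_pos: "\<And>f. f \<in> H \<Longrightarrow> f \<noteq> (\<lambda>x. 0) \<Longrightarrow> 0 < Re (ip f f)"
    and complete: "\<And>F. (\<And>n::nat. F n \<in> H) \<Longrightarrow>
          (\<And>\<epsilon>. 0 < \<epsilon> \<Longrightarrow> \<exists>M. \<forall>i\<ge>M. \<forall>k\<ge>M. ip_norm ip (\<lambda>x. F i x - F k x) < \<epsilon>) \<Longrightarrow>
          \<exists>f\<in>H. (\<lambda>n. ip_norm ip (\<lambda>x. F n x - f x)) \<longlonglongrightarrow> 0"
    and section_mem: "\<And>y. y \<in> D \<Longrightarrow> kernel_section D K y \<in> H"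
    and reproducing: "\<And>f y. f \<in> H \<Longrightarrow> y \<in> D \<Longrightarrow> ip f (kernel_section D K y) = f y"

definition psi :: "nat \<Rightarrow> nat \<Rightarrow> nat" where
  "psi b h = nat \<lfloor>log (real b) (real h)\<rfloor>"

definition r_decay :: "nat \<Rightarrow> real \<Rightarrow> nat \<Rightarrow> real" where
  "r_decay b \<alpha> h = real b powr (- \<alpha> * real (psi b h))"

definition mu :: "nat \<Rightarrow> real \<Rightarrow> real" where
  "mu b \<beta> = (\<Sum>\<^sub>\<infinity>h\<in>{1..}. r_decay b \<beta> h)"

definition nat_digit :: "nat \<Rightarrow> nat \<Rightarrow> nat \<Rightarrow> nat" where
  "nat_digit b h i = h div b ^ i mod b"

(* For i \<ge> 1 and 0 \<le> x < 1 this is the i-th digit after the point in the base-b expansion of x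
   having infinitely many digits different from b - 1. *)
definition real_digit :: "nat \<Rightarrow> real \<Rightarrow> nat \<Rightarrow> int" where
  "real_digit b x i = \<lfloor>x * real b ^ i\<rfloor> mod int b"

definition wal :: "nat \<Rightarrow> nat \<Rightarrow> real \<Rightarrow> complex" where
  "wal b h x = exp (2 * of_real pi * \<i> *
     of_int (\<Sum>i\<le>psi b h. real_digit b x (Suc i) * int (nat_digit b h i)) / of_nat b)"

definition unit_cube :: "nat \<Rightarrow> (nat \<Rightarrow> real) set" where
  "unit_cube s = {1..s} \<rightarrow>\<^sub>E {0..<1}"

definition walsh_kernel ::
  "nat \<Rightarrow> nat \<Rightarrow> real \<Rightarrow> (nat set \<Rightarrow> real) \<Rightarrow> (nat \<Rightarrow> real) \<Rightarrow> (nat \<Rightarrow> real) \<Rightarrow> complex" where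
  "walsh_kernel b s \<alpha> \<gamma> x y =
     1 + (\<Sum>u | u \<noteq> {} \<and> u \<subseteq> {1..s}. of_real (\<gamma> u) *
            (\<Sum>\<^sub>\<infinity>h\<in>(u \<rightarrow>\<^sub>E {1..}).
               of_real (\<Prod>j\<in>u. r_decay b \<alpha> (h j)) *
               (\<Prod>j\<in>u. wal b (h j) (x j)) * cnj (\<Prod>j\<in>u. wal b (h j) (y j))))"

definition nu :: "nat \<Rightarrow> 'p::prime_card mod_ring poly \<Rightarrow> real" where
  "nu m v = (\<Sum>i<m. of_int (to_int_mod_ring (Polynomial.coeff v i)) / real CARD('p) ^ (m - i))"

definition node :: "nat \<Rightarrow> nat \<Rightarrow> (nat \<Rightarrow> 'p::prime_card mod_ring poly) \<Rightarrow>
    'p mod_ring poly \<Rightarrow> nat \<Rightarrow> real" where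
  "node m s g n = (\<lambda>j\<in>{1..s}. nu m (n * g j))"

definition integration_error ::
  "nat \<Rightarrow> nat \<Rightarrow> (nat \<Rightarrow> 'p::prime_card mod_ring poly) \<Rightarrow> ((nat \<Rightarrow> real) \<Rightarrow> complex) \<Rightarrow> real" where
  "integration_error m s g f =
     cmod ((LINT x:unit_cube s|PiM {1..s} (\<lambda>_. lborel). f x)
           - (\<Sum>n | Polynomial.degree n < m. f (node m s g n)) / of_nat (CARD('p) ^ m))"

definition worst_case_error ::
  "((nat \<Rightarrow> real) \<Rightarrow> complex) set \<Rightarrow>
   (((nat \<Rightarrow> real) \<Rightarrow> complex) \<Rightarrow> ((nat \<Rightarrow> real) \<Rightarrow> complex) \<Rightarrow> complex) \<Rightarrow>
   nat \<Rightarrow> nat \<Rightarrow> (nat \<Rightarrow> 'p::prime_card mod_ring poly) \<Rightarrow> real" where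
  "worst_case_error H ip m s g = (SUP f\<in>{f \<in> H. ip_norm ip f \<le> 1}. integration_error m s g f)"

definition search_space :: "nat \<Rightarrow> nat \<Rightarrow> 'p::prime_card mod_ring poly set" where
  "search_space m w =
     (if w < m then {g. g \<noteq> 0 \<and> Polynomial.degree g < m - w \<and> gcd g (Polynomial.monom 1 m) = 1} else {1})"

definition reduced_vector ::
  "(nat \<Rightarrow> nat) \<Rightarrow> (nat \<Rightarrow> 'p::prime_card mod_ring poly) \<Rightarrow> nat \<Rightarrow> 'p mod_ring poly" where
  "reduced_vector w g = (\<lambda>j. Polynomial.monom 1 (w j) * g j)"

definition scs_vector ::
  "(nat \<Rightarrow> nat) \<Rightarrow> (nat \<Rightarrow> 'p::prime_card mod_ring poly) \<Rightarrow> (nat \<Rightarrow> 'p mod_ring poly) \<Rightarrow>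
   nat \<Rightarrow> 'p mod_ring poly \<Rightarrow> nat \<Rightarrow> 'p mod_ring poly" where
  "scs_vector w g0 g d h =
     (\<lambda>j. if j < d then Polynomial.monom 1 (w j) * g j
          else if j = d then Polynomial.monom 1 (w d) * h
          else g0 j)"

(* A relation rather than a function: ties in the minimisation may be broken arbitrarily.
   Only the components 1..s of g0 and g are relevant. *)
definition reduced_scs ::
  "((nat \<Rightarrow> 'p::prime_card mod_ring poly) \<Rightarrow> real) \<Rightarrow> nat \<Rightarrow> nat \<Rightarrow> (nat \<Rightarrow> nat) \<Rightarrow>
   (nat \<Rightarrow> 'p mod_ring poly) \<Rightarrow> (nat \<Rightarrow> 'p mod_ring poly) \<Rightarrow> bool" where
  "reduced_scs e m s w g0 g \<longleftrightarrow>
     (\<forall>d\<in>{1..s}. g d \<in> search_space m (w d) \<and>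
        (\<forall>h\<in>search_space m (w d).
           (e (scs_vector w g0 g d (g d)))\<^sup>2 \<le> (e (scs_vector w g0 g d h))\<^sup>2))"

definition weight_sum ::
  "nat \<Rightarrow> real \<Rightarrow> (nat set \<Rightarrow> real) \<Rightarrow> (nat \<Rightarrow> nat) \<Rightarrow> real \<Rightarrow> nat \<Rightarrow> real" where
  "weight_sum b \<alpha> \<gamma> w \<delta> s =
     (\<Sum>d=1..s. \<Sum>u | d \<in> u \<and> u \<subseteq> {1..s}.
        \<gamma> u powr (1 / (\<alpha> - 2 * \<delta>)) * mu b (\<alpha> / (\<alpha> - 2 * \<delta>)) ^ card u * real b ^ w d)"

definition C_const ::
  "nat \<Rightarrow> real \<Rightarrow> (nat set \<Rightarrow> real) \<Rightarrow> (nat \<Rightarrow> nat) \<Rightarrow> real \<Rightarrow> nat \<Rightarrow> real" where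
  "C_const b \<alpha> \<gamma> w \<delta> s = (2 * weight_sum b \<alpha> \<gamma> w \<delta> s) powr (\<alpha> / 2 - \<delta>)"

definition C_sup ::
  "nat \<Rightarrow> real \<Rightarrow> (nat set \<Rightarrow> real) \<Rightarrow> (nat \<Rightarrow> nat) \<Rightarrow> real \<Rightarrow> real \<Rightarrow> ereal" where
  "C_sup b \<alpha> \<gamma> w \<delta> q =
     (SUP s\<in>{1..}. ereal (2 / real s powr q * weight_sum b \<alpha> \<gamma> w \<delta> s))"

end

theory Submission
  imports Defs
begin

text \<open>
  The kernel is a sum of $\rho_l\,W_l(x)\overline{W_l(y)}$ over all pairs $l = (u, h)$, so the average of the
  kernel over a point set depends only on the averages of the Walsh products $W_l$, which are
  character sums: $0$ or $1$ over the full grid and over a polynomial lattice. The grid averages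
  of kernel sections form a Cauchy sequence whose limit, the constant function $1$, represents the
  integral. Hence $e^2$ is the sum of $\rho_l$ over the dual lattice.

  Let $T_d$ be the part of this sum with $d \in u$ after step $d$ of the search. The part with $d \notin u$
  does not depend on $g_d$, so the chosen $g_d$ minimises $T_d$; with $\kappa = 1/(\alpha - 2\delta) \le 1$, Jensen's
  inequality bounds $T_d^\kappa$ by the average over the search space of the sums with $\rho_l^\kappa$.
  The final error satisfies $e^2 \le \sum_d T_d$, because for $\max u = d$ membership in the dual
  lattice is already decided after step $d$.
\<close>

section \<open>Quadrature in reproducing kernel Hilbert spaces\<close>

text \<open>The space \<open>H\<close> is known only through its axioms, which give neither
  measurability of its elements nor boundedness of the integral. Both are extracted from the grid:
  the kernel controls how far \<open>f\<close> varies inside a small cell, so \<open>f\<close> is a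
  uniform limit of step functions on the cube. The exponent \<kappa> = 1/(\<alpha> - 2\<delta>) is
  dictated by the target rate, since 1/(2\<kappa>) = \<alpha>/2 - \<delta>. The condition \<delta> >
  0 says \<alpha>\<kappa> > 1, which keeps the coefficients summable after raising them to the power
  \<kappa>; the condition \<delta> \<le> (\<alpha> - 1)/2 says \<kappa> \<le> 1, as Jensen's
  inequality demands. The factor 2 b^(w_d) of the constant measures the loss from a small search
  space: for w_d < m it has at least b^(m - w_d)/2 elements. The resulting bound is uniform in
  \<open>B\<close>, so it holds whatever the earlier choices and the starting vector are.\<close>

context rkhs begin

lemma diff_mem: "f \<in> H \<Longrightarrow> g \<in> H \<Longrightarrow> (\<lambda>x. f x - g x) \<in> H"
  using add_mem[of f "\<lambda>x. (-1) * g x"] scale_mem[of g "-1"] by simp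

lemma sum_mem:
  assumes "\<And>i. i \<in> A \<Longrightarrow> F i \<in> H"
  shows "(\<lambda>x. \<Sum>i\<in>A. F i x) \<in> H"
  using assms
proof (induction A rule: infinite_finite_induct)
  case (insert a A)
  then show ?case using add_mem[of "F a" "\<lambda>x. \<Sum>i\<in>A. F i x"] by simp
qed (use zero_mem in auto)

lemma ip_zero_left: "h \<in> H \<Longrightarrow> ip (\<lambda>x. 0) h = 0"
  using ip_scale[of h h 0] by simp

lemma ip_diff_left:
  assumes "f \<in> H" "g \<in> H" "h \<in> H"
  shows "ip (\<lambda>x. f x - g x) h = ip f h - ip g h"
  using ip_add[of f "\<lambda>x. (-1) * g x" h] scale_mem[of g "-1"] ip_scale[of g h "-1"] assms by simp

lemma ip_sum_left:
  assumes "\<And>i. i \<in> A \<Longrightarrow> F i \<in> H" "h \<in> H"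
  shows "ip (\<lambda>x. \<Sum>i\<in>A. F i x) h = (\<Sum>i\<in>A. ip (F i) h)"
  using assms
proof (induction A rule: infinite_finite_induct)
  case (insert a A)
  then show ?case
    using ip_add[of "F a" "\<lambda>x. \<Sum>i\<in>A. F i x" h] sum_mem[of A F] by simp
qed (use ip_zero_left in auto)

lemma ip_scale_right: "f \<in> H \<Longrightarrow> h \<in> H \<Longrightarrow> ip h (\<lambda>x. c * f x) = cnj c * ip h f"
  using ip_cnj[of "\<lambda>x. c * f x" h] ip_cnj[of f h] ip_scale[of f h c] scale_mem[of f c] by simp

lemma ip_diff_right:
  "f \<in> H \<Longrightarrow> g \<in> H \<Longrightarrow> h \<in> H \<Longrightarrow> ip h (\<lambda>x. f x - g x) = ip h f - ip h g"
  using ip_cnj[of "\<lambda>x. f x - g x" h] ip_cnj[of f h] ip_cnj[of g h] ip_diff_left[of f g h]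
    diff_mem[of f g] by simp

lemma ip_sum_right:
  assumes "\<And>i. i \<in> A \<Longrightarrow> F i \<in> H" "h \<in> H"
  shows "ip h (\<lambda>x. \<Sum>i\<in>A. F i x) = (\<Sum>i\<in>A. ip h (F i))"
proof -
  have "ip h (\<lambda>x. \<Sum>i\<in>A. F i x) = cnj (ip (\<lambda>x. \<Sum>i\<in>A. F i x) h)"
    using assms by (intro ip_cnj sum_mem) auto
  also have "\<dots> = (\<Sum>i\<in>A. cnj (ip (F i) h))"
    using assms by (simp add: ip_sum_left)
  also have "\<dots> = (\<Sum>i\<in>A. ip h (F i))"
    using assms by (intro sum.cong refl ip_cnj[symmetric]) auto
  finally show ?thesis .
qed

lemma Re_ip_self_nonneg: "f \<in> H \<Longrightarrow> 0 \<le> Re (ip f f)"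
  using ip_pos[of f] ip_zero_left[of f] by fastforce

lemma ip_norm_nonneg: "f \<in> H \<Longrightarrow> 0 \<le> ip_norm ip f"
  by (simp add: ip_norm_def Re_ip_self_nonneg)

lemma ip_self: "f \<in> H \<Longrightarrow> ip f f = of_real ((ip_norm ip f)\<^sup>2)"
  using ip_cnj[of f f] Re_ip_self_nonneg[of f]
  by (auto simp: ip_norm_def complex_eq_iff)

lemma ip_norm_eq_0: "f \<in> H \<Longrightarrow> ip_norm ip f = 0 \<Longrightarrow> f = (\<lambda>x. 0)"
  using ip_pos[of f] by (auto simp: ip_norm_def)

lemma ip_norm_scale: "f \<in> H \<Longrightarrow> ip_norm ip (\<lambda>x. c * f x) = cmod c * ip_norm ip f"
proof -
  assume f: "f \<in> H"
  have "ip (\<lambda>x. c * f x) (\<lambda>x. c * f x) = c * cnj c * ip f f"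
    using f by (simp add: ip_scale ip_scale_right scale_mem)
  also have "\<dots> = of_real ((cmod c)\<^sup>2 * (ip_norm ip f)\<^sup>2)"
    using f by (simp only: ip_self complex_norm_square[symmetric] of_real_mult)
  finally have "(ip_norm ip (\<lambda>x. c * f x))\<^sup>2 = (cmod c * ip_norm ip f)\<^sup>2"
    using f by (simp add: ip_norm_def scale_mem Re_ip_self_nonneg power_mult_distrib)
  then show ?thesis
    using f by (simp add: ip_norm_nonneg scale_mem)
qed

lemma Cauchy_Schwarz:
  assumes f: "f \<in> H" and g: "g \<in> H"
  shows "cmod (ip f g) \<le> ip_norm ip f * ip_norm ip g"
proof (cases "ip_norm ip g = 0")
  case True
  then have "g = (\<lambda>x. 0)" using ip_norm_eq_0 g by blast
  then have "ip f g = 0" using ip_cnj[of g f] ip_zero_left[of f] f g by simp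
  then show ?thesis using True by simp
next
  case False
  define G where "G = (ip_norm ip g)\<^sup>2"
  have G: "G > 0" using False by (simp add: G_def)
  define c where "c = ip f g / of_real G"
  have cg: "(\<lambda>x. c * g x) \<in> H" using g scale_mem by blast
  define k where "k = (\<lambda>x. f x - c * g x)"
  have k: "k \<in> H" using diff_mem[OF f cg] by (simp add: k_def)
  have "ip k k = ip f k - c * ip g k"
    using ip_diff_left[OF f cg k] ip_scale[OF g k] by (simp add: k_def)
  also have "ip f k = ip f f - cnj c * ip f g"
    unfolding k_def using ip_diff_right[OF f cg f] ip_scale_right[OF g f] by simp
  also have "ip g k = ip g f - cnj c * ip g g"
    unfolding k_def using ip_diff_right[OF f cg g] ip_scale_right[OF g g] by simp
  also have "ip g f = cnj (ip f g)" by (rule ip_cnj[OF f g])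
  also have "ip g g = of_real G" using ip_self[OF g] by (simp add: G_def)
  finally have "ip k k = ip f f - ip f g * cnj (ip f g) / of_real G"
    using G by (simp add: c_def field_simps)
  also have "ip f f = of_real ((ip_norm ip f)\<^sup>2)" by (rule ip_self[OF f])
  also have "ip f g * cnj (ip f g) = of_real ((cmod (ip f g))\<^sup>2)"
    by (rule complex_norm_square[symmetric])
  finally have "Re (ip k k) = (ip_norm ip f)\<^sup>2 - (cmod (ip f g))\<^sup>2 / G"
    by (simp only: of_real_divide[symmetric] of_real_diff[symmetric] Re_complex_of_real)
  then have "(cmod (ip f g))\<^sup>2 / G \<le> (ip_norm ip f)\<^sup>2"
    using Re_ip_self_nonneg[OF k] by linarith
  then have "(cmod (ip f g))\<^sup>2 \<le> (ip_norm ip f * ip_norm ip g)\<^sup>2"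
    using G by (simp add: field_simps G_def power_mult_distrib)
  then show ?thesis
    using f g by (intro power2_le_imp_le[of "cmod (ip f g)"] mult_nonneg_nonneg ip_norm_nonneg)
qed

lemma ip_section:
  "x \<in> D \<Longrightarrow> y \<in> D \<Longrightarrow> ip (kernel_section D K x) (kernel_section D K y) = K y x"
  by (simp add: reproducing section_mem) (simp add: kernel_section_def)

text \<open>Continuity of \<open>f\<close> in the distance that the kernel induces on points: a
  difference of two values is an inner product with a difference of two kernel sections.\<close>

lemma norm_diff_sections:
  assumes "f \<in> H" "x \<in> D" "y \<in> D"
  shows "cmod (f x - f y) \<le> ip_norm ip f * sqrt (Re (K x x - K x y - K y x + K y y))"
proof -
  let ?k = "\<lambda>z. kernel_section D K x z - kernel_section D K y z"
  have k: "?k \<in> H" using assms by (intro diff_mem section_mem)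
  have "ip ?k ?k = K x x - K x y - K y x + K y y"
    using assms k
    by (simp add: ip_diff_left ip_diff_right section_mem ip_section)
  then have n: "ip_norm ip ?k = sqrt (Re (K x x - K x y - K y x + K y y))"
    by (simp add: ip_norm_def)
  have "f x - f y = ip f ?k"
    using assms by (simp add: ip_diff_right section_mem reproducing)
  then show ?thesis
    using Cauchy_Schwarz[OF assms(1) k] n by simp
qed

lemma norm_point_eval:
  assumes "f \<in> H" "x \<in> D"
  shows "cmod (f x) \<le> ip_norm ip f * sqrt (Re (K x x))"
  using Cauchy_Schwarz[OF assms(1) section_mem[OF assms(2)]] assms
  by (simp add: reproducing ip_norm_def ip_section)

text \<open>The Riesz representer of the equal-weight quadrature functional at the points
  \<open>p i\<close>; see \<open>ip_avg_section\<close>.\<close>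

definition avg_section :: "'i set \<Rightarrow> ('i \<Rightarrow> 'x) \<Rightarrow> 'x \<Rightarrow> complex" where
  "avg_section S p = (\<lambda>x. inverse (of_nat (card S)) * (\<Sum>i\<in>S. kernel_section D K (p i) x))"

lemma avg_section_mem: "(\<And>i. i \<in> S \<Longrightarrow> p i \<in> D) \<Longrightarrow> avg_section S p \<in> H"
  unfolding avg_section_def by (intro scale_mem sum_mem section_mem)

lemma ip_avg_section:
  assumes "\<And>i. i \<in> S \<Longrightarrow> p i \<in> D" "f \<in> H"
  shows "ip f (avg_section S p) = (\<Sum>i\<in>S. f (p i)) / of_nat (card S)"
proof -
  have "ip f (avg_section S p)
      = cnj (inverse (of_nat (card S))) * ip f (\<lambda>x. \<Sum>i\<in>S. kernel_section D K (p i) x)"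
    unfolding avg_section_def using assms by (intro ip_scale_right sum_mem section_mem) auto
  also have "ip f (\<lambda>x. \<Sum>i\<in>S. kernel_section D K (p i) x) = (\<Sum>i\<in>S. ip f (kernel_section D K (p i)))"
    using assms by (intro ip_sum_right section_mem) auto
  also have "\<dots> = (\<Sum>i\<in>S. f (p i))"
    using assms by (intro sum.cong refl reproducing) auto
  finally show ?thesis by (simp add: field_simps)
qed

lemma avg_section_apply:
  "x \<in> D \<Longrightarrow> avg_section S p x = (\<Sum>i\<in>S. K x (p i)) / of_nat (card S)"
  by (simp add: avg_section_def kernel_section_def field_simps)

lemma avg_close:
  assumes "finite S" "S \<noteq> {}" "\<And>i. i \<in> S \<Longrightarrow> cmod (F i - 1) \<le> \<epsilon>"
  shows "cmod ((\<Sum>i\<in>S. F i) / of_nat (card S) - 1) \<le> \<epsilon>"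
proof -
  have c: "card S > 0" using assms by (simp add: card_gt_0_iff)
  have "(\<Sum>i\<in>S. F i) / of_nat (card S) - 1 = (\<Sum>i\<in>S. F i - 1) / of_nat (card S)"
    using c by (simp add: sum_subtractf field_simps)
  also have "cmod \<dots> \<le> (\<Sum>i\<in>S. cmod (F i - 1)) / real (card S)"
    by (simp add: norm_divide divide_right_mono norm_sum)
  also have "\<dots> \<le> (\<Sum>i\<in>S. \<epsilon>) / real (card S)"
    using assms(3) by (intro divide_right_mono sum_mono) auto
  also have "\<dots> = \<epsilon>" using c by simp
  finally show ?thesis .
qed

text \<open>The squared distance of two averaged sections is an alternating sum of four inner
  products, each close to 1. The ones cancel, so the sequence is Cauchy; its limit evaluates to 1 on
  \<open>D\<close>, and pairing with it is the limit of the averages, that is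
  \<open>I\<close>.\<close>

lemma constant_one_representer:
  fixes S :: "nat \<Rightarrow> 'i set" and p :: "nat \<Rightarrow> 'i \<Rightarrow> 'x"
  assumes fin: "\<And>n. finite (S n)" and ne: "\<And>n. S n \<noteq> {}"
    and p: "\<And>n i. i \<in> S n \<Longrightarrow> p n i \<in> D"
    and close: "\<And>n x. x \<in> D \<Longrightarrow> cmod ((\<Sum>i\<in>S n. K x (p n i)) / of_nat (card (S n)) - 1) \<le> \<epsilon> n"
    and \<epsilon>: "\<epsilon> \<longlonglongrightarrow> 0"
    and I: "\<And>f. f \<in> H \<Longrightarrow> (\<lambda>n. (\<Sum>i\<in>S n. f (p n i)) / of_nat (card (S n))) \<longlonglongrightarrow> I f"
  obtains c where "c \<in> H" "\<And>x. x \<in> D \<Longrightarrow> c x = 1" "\<And>f. f \<in> H \<Longrightarrow> ip f c = I f"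
proof -
  define a where "a n = avg_section (S n) (p n)" for n
  have a: "a n \<in> H" for n unfolding a_def using p by (intro avg_section_mem)
  have ipa: "ip f (a n) = (\<Sum>i\<in>S n. f (p n i)) / of_nat (card (S n))" if "f \<in> H" for f n
    unfolding a_def using p that by (intro ip_avg_section)
  have ax: "cmod (a n x - 1) \<le> \<epsilon> n" if "x \<in> D" for n x
    using close[OF that, of n] that by (simp add: a_def avg_section_apply)
  \<comment> \<open>This inner product is the average of \<open>a n\<close> over the points of
    \<open>S k\<close>, where \<open>a n\<close> is uniformly close to 1. Hence the bound is
    independent of \<open>k\<close>.\<close>
  have ipaa: "cmod (ip (a n) (a k) - 1) \<le> \<epsilon> n" for n k
    unfolding ipa[OF a] using fin ne p ax by (intro avg_close) auto
  have dist: "(ip_norm ip (\<lambda>x. a i x - a k x))\<^sup>2 \<le> 2 * \<epsilon> i + 2 * \<epsilon> k" for i k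
  proof -
    have "ip (\<lambda>x. a i x - a k x) (\<lambda>x. a i x - a k x)
        = (ip (a i) (a i) - 1) - (ip (a i) (a k) - 1) - (ip (a k) (a i) - 1) + (ip (a k) (a k) - 1)"
      using a by (simp add: ip_diff_left ip_diff_right diff_mem)
    moreover have "\<bar>Re (ip (a i) (a k) - 1)\<bar> \<le> \<epsilon> i" for i k
      using ipaa[of i k] abs_Re_le_cmod order_trans by blast
    from this[of i i] this[of i k] this[of k i] this[of k k] calculation
    have "Re (ip (\<lambda>x. a i x - a k x) (\<lambda>x. a i x - a k x)) \<le> 2 * \<epsilon> i + 2 * \<epsilon> k"
      by simp
    then show ?thesis
      using Re_ip_self_nonneg[OF diff_mem[OF a a]] by (simp add: ip_norm_def)
  qed
  have "\<exists>M. \<forall>i\<ge>M. \<forall>k\<ge>M. ip_norm ip (\<lambda>x. a i x - a k x) < e" if e: "e > 0" for e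
  proof -
    have "\<forall>\<^sub>F n in sequentially. \<epsilon> n < e\<^sup>2 / 4"
      using \<epsilon> e by (intro order_tendstoD) auto
    then obtain M where M: "\<And>n. n \<ge> M \<Longrightarrow> \<epsilon> n < e\<^sup>2 / 4"
      by (auto simp: eventually_sequentially)
    have "ip_norm ip (\<lambda>x. a i x - a k x) < e" if "i \<ge> M" "k \<ge> M" for i k
    proof -
      have "(ip_norm ip (\<lambda>x. a i x - a k x))\<^sup>2 < e\<^sup>2"
        using dist[of i k] M[OF that(1)] M[OF that(2)] by linarith
      then show ?thesis using e by (intro power2_less_imp_less[of _ e]) auto
    qed
    then show ?thesis by blast
  qed
  then obtain c where c: "c \<in> H" and lim: "(\<lambda>n. ip_norm ip (\<lambda>x. a n x - c x)) \<longlonglongrightarrow> 0"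
    using complete[of a] a by blast
  have conv: "(\<lambda>n. ip f (a n)) \<longlonglongrightarrow> ip f c" if f: "f \<in> H" for f
  proof -
    have T: "(\<lambda>n. ip_norm ip f * ip_norm ip (\<lambda>x. a n x - c x)) \<longlonglongrightarrow> 0"
      using lim by (rule tendsto_mult_right_zero)
    have "\<forall>n. norm (ip f (a n) - ip f c) \<le> ip_norm ip f * ip_norm ip (\<lambda>x. a n x - c x)"
      using Cauchy_Schwarz[OF f diff_mem[OF a c]] by (simp only: ip_diff_right[OF a c f]) simp
    then have "(\<lambda>n. ip f (a n) - ip f c) \<longlonglongrightarrow> 0"
      by (rule Lim_null_comparison[OF always_eventually T])
    then show ?thesis by (simp add: LIM_zero_iff)
  qed
  have "c x = 1" if x: "x \<in> D" for x
  proof -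
    let ?k = "kernel_section D K x"
    \<comment> \<open>\<open>reproducing\<close> has the section in the second slot, but
      \<open>conv\<close> takes its limit there; conjugation exchanges the slots.\<close>
    have "(\<lambda>n. cnj (ip ?k (a n))) \<longlonglongrightarrow> cnj (ip ?k c)"
      using conv[OF section_mem[OF x]] by (intro tendsto_intros)
    moreover have "cnj (ip ?k f) = f x" if "f \<in> H" for f
      using ip_cnj[OF section_mem[OF x] that] reproducing[OF that x] by simp
    ultimately have "(\<lambda>n. a n x) \<longlonglongrightarrow> c x" using a c by simp
    moreover have "(\<lambda>n. a n x - 1) \<longlonglongrightarrow> 0"
      using ax[OF x] by (intro Lim_null_comparison[OF always_eventually \<epsilon>] allI)
    then have "(\<lambda>n. a n x) \<longlonglongrightarrow> 1" by (rule LIM_zero_cancel)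
    ultimately show ?thesis by (rule LIMSEQ_unique)
  qed
  moreover have "ip f c = I f" if "f \<in> H" for f
    using conv[OF that] I[OF that] unfolding ipa[OF that] by (rule LIMSEQ_unique)
  ultimately show ?thesis using that c by blast
qed

text \<open>The error functional has the representer \<open>c - q\<close>, so its supremum over the
  unit ball is the norm of \<open>c - q\<close>, attained at the normalised representer. The squared
  norm is 1 - 1 - 1 + (1 + E).\<close>

lemma worst_case_quadrature:
  assumes S: "finite S" "S \<noteq> {}" and p: "\<And>i. i \<in> S \<Longrightarrow> p i \<in> D"
    and c: "c \<in> H" "\<And>x. x \<in> D \<Longrightarrow> c x = 1" "\<And>f. f \<in> H \<Longrightarrow> ip f c = I f" "I c = 1"
    and E: "(\<Sum>i\<in>S. \<Sum>k\<in>S. K (p i) (p k)) / of_nat (card S)^2 = 1 + of_real E"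
  shows "E \<ge> 0"
    and "(SUP f\<in>{f\<in>H. ip_norm ip f \<le> 1}. cmod (I f - (\<Sum>i\<in>S. f (p i)) / of_nat (card S))) = sqrt E"
    (is "(SUP f\<in>?B. ?err f) = _")
proof -
  let ?N = "of_nat (card S) :: complex"
  define q where "q = avg_section S p"
  have q: "q \<in> H" unfolding q_def using p by (rule avg_section_mem)
  have ipq: "ip f q = (\<Sum>i\<in>S. f (p i)) / ?N" if "f \<in> H" for f
    unfolding q_def using p that by (intro ip_avg_section)
  have N: "card S > 0" using S by (simp add: card_gt_0_iff)
  have cq: "ip c q = 1" using p c(2) N by (simp add: ipq[OF c(1)])
  then have qc: "ip q c = 1" using ip_cnj[OF c(1) q] by simp
  have qq: "ip q q = 1 + of_real E"
    using p E by (simp add: ipq[OF q]) 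
      (simp add: q_def avg_section_apply sum_divide_distrib[symmetric] power2_eq_square)
  have cc: "ip c c = 1" using c by simp
  define r where "r = (\<lambda>x. c x - q x)"
  have r: "r \<in> H" using diff_mem[OF c(1) q] by (simp add: r_def)
  have "ip r r = of_real E"
    using c q r unfolding r_def
    by (simp add: ip_diff_left[OF c(1) q] ip_diff_right[OF c(1) q] cq qc qq cc)
  then have E0: "E \<ge> 0" and nr: "ip_norm ip r = sqrt E"
    using Re_ip_self_nonneg[OF r] by (auto simp: ip_norm_def)
  then show "E \<ge> 0" by blast
  have err: "?err f = cmod (ip f r)" if "f \<in> H" for f
    using that c q unfolding r_def by (simp add: ip_diff_right ipq)
  show "(SUP f\<in>?B. ?err f) = sqrt E"
  proof (rule cSup_eq_maximum)
    \<comment> \<open>For \<open>E = 0\<close> the inverse is 0 by convention; then \<open>f\<close>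
      is the zero function, which still attains the supremum 0.\<close>
    define f where "f = (\<lambda>x. of_real (inverse (sqrt E)) * r x)"
    have f: "f \<in> H" unfolding f_def by (rule scale_mem[OF r])
    have "ip_norm ip f \<le> 1"
      unfolding f_def ip_norm_scale[OF r] nr using E0 by (cases "E = 0") (auto simp: norm_inverse)
    moreover have "?err f = sqrt E"
    proof -
      have "ip f r = of_real (inverse (sqrt E)) * of_real E"
        unfolding f_def using ip_scale[OF r r] \<open>ip r r = of_real E\<close> by (simp only:)
      also have "\<dots> = of_real (sqrt E)"
        using real_div_sqrt[OF E0] by (simp only: of_real_mult[symmetric] divide_inverse mult.commute)
      finally show ?thesis unfolding err[OF f] using E0 by simp
    qed
    ultimately show "sqrt E \<in> ?err ` ?B" using f by force
    show "y \<le> sqrt E" if y: "y \<in> ?err ` ?B" for y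
    proof -
      obtain f where f: "f \<in> H" "ip_norm ip f \<le> 1" "y = ?err f" using y by auto
      have "y \<le> ip_norm ip f * sqrt E"
        using Cauchy_Schwarz[OF f(1) r] by (simp only: f(3) err[OF f(1)] nr)
      also have "\<dots> \<le> 1 * sqrt E" using f(2) E0 by (intro mult_right_mono) auto
      finally show ?thesis by simp
    qed
  qed
qed
end

section \<open>Walsh functions and characters of polynomials\<close>

definition add_char :: "'p::prime_card mod_ring \<Rightarrow> complex" where
  "add_char a = cis (2 * pi * of_int (to_int_mod_ring a) / real CARD('p))"

definition tr_poly :: "nat \<Rightarrow> nat \<Rightarrow> 'p::prime_card mod_ring poly" where
  "tr_poly m h = (\<Sum>i<m. Polynomial.monom (of_nat (nat_digit CARD('p) h i)) i)"

text \<open>The integer b^m times \<open>nu m v\<close> (see \<open>nu_eq_digit_sum\<close>). It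
  turns the digits of a node into integer \<open>div\<close> and \<open>mod\<close>.\<close>

definition digit_sum :: "nat \<Rightarrow> 'p::prime_card mod_ring poly \<Rightarrow> int" where
  "digit_sum m v = (\<Sum>i<m. to_int_mod_ring (Polynomial.coeff v i) * int CARD('p) ^ i)"

lemma card_gt_1: "CARD('p::prime_card) > 1"
  using prime_card[where 'a='p] prime_gt_1_nat by blast

lemma to_int_of_int: "to_int_mod_ring (of_int z :: 'p::prime_card mod_ring) = z mod int CARD('p)"
  unfolding of_int_of_int_mod_ring by transfer simp

lemma to_int_range: "to_int_mod_ring (a :: 'p::prime_card mod_ring) \<in> {0..<int CARD('p)}"
  using range_to_int_mod_ring[where 'a='p] by blast

lemma of_int_to_int: "of_int (to_int_mod_ring a) = (a :: 'p::prime_card mod_ring)"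
  unfolding of_int_of_int_mod_ring by simp

text \<open>The exponential has period b in the integer, so any representative of the residue may be
  used. Additivity then needs no case distinction on carries.\<close>

lemma add_char_of_int:
  "add_char (of_int z :: 'p::prime_card mod_ring) = cis (2 * pi * of_int z / real CARD('p))"
proof -
  let ?b = "int CARD('p)"
  have b: "real CARD('p) > 0" using card_gt_1[where 'p='p] by linarith
  have "of_int z = (of_int (z mod ?b) + of_int ?b * of_int (z div ?b) :: real)"
    unfolding of_int_mult[symmetric] of_int_add[symmetric] by simp
  then have "2 * pi * of_int z / real CARD('p)
      = 2 * pi * of_int (z mod ?b) / real CARD('p) + 2 * pi * of_int (z div ?b)"
    using b by (simp add: field_simps)
  moreover have "cis (2 * pi * of_int (z div ?b)) = 1" by (rule cis_multiple_2pi) simp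
  ultimately show ?thesis
    by (simp add: add_char_def to_int_of_int cis_mult[symmetric])
qed

lemma add_char_add: "add_char (a + c) = add_char a * add_char (c :: 'p::prime_card mod_ring)"
proof -
  have "a + c = of_int (to_int_mod_ring a + to_int_mod_ring c)"
    by (simp add: of_int_to_int)
  then have "add_char (a + c) = cis (2 * pi * of_int (to_int_mod_ring a + to_int_mod_ring c) / real CARD('p))"
    by (simp only: add_char_of_int)
  also have "\<dots> = add_char a * add_char c"
    by (simp add: add_char_def cis_mult add_divide_distrib[symmetric] algebra_simps)
  finally show ?thesis .
qed

lemma add_char_0: "add_char (0 :: 'p::prime_card mod_ring) = 1"
  using add_char_of_int[of 0, where 'p='p] by simp

lemma add_char_sum: "add_char (sum f A) = (\<Prod>i\<in>A. add_char (f i :: 'p::prime_card mod_ring))"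
  by (induction A rule: infinite_finite_induct) (auto simp: add_char_0 add_char_add)

text \<open>Nontriviality of the character, from which orthogonality follows: a value 1 here would
  make 1/b an integer.\<close>

lemma add_char_1: "add_char (1 :: 'p::prime_card mod_ring) \<noteq> 1"
proof
  let ?b = "real CARD('p)"
  have b: "?b > 1" using card_gt_1[where 'p='p] by linarith
  assume "add_char (1 :: 'p mod_ring) = 1"
  then have "cis (2 * pi / ?b) = 1" using add_char_of_int[of 1, where 'p='p] by simp
  then have "cos (2 * pi / ?b) = 1" by (metis cis.sel(1) one_complex.sel(1))
  then obtain n :: int where "2 * pi / ?b = of_int n * 2 * pi"
    using cos_one_2pi_int by blast
  then have "real_of_int n = 1 / ?b" using b by (simp add: field_simps)
  moreover have "0 < 1 / ?b" "1 / ?b < 1" using b by auto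
  ultimately show False by (metis of_int_0_less_iff of_int_less_1_iff zless_imp_add1_zle linorder_not_less add_0)
qed

section \<open>Digits of integers and divisibility by powers of the base\<close>

lemma coeff_tr_poly:
  "Polynomial.coeff (tr_poly m h :: 'p::prime_card mod_ring poly) i
     = (if i < m then of_nat (nat_digit CARD('p) h i) else 0)"
  by (simp add: tr_poly_def coeff_sum)

lemma psi_eq_iff: "b \<ge> 2 \<Longrightarrow> h \<ge> 1 \<Longrightarrow> psi b h = n \<longleftrightarrow> b ^ n \<le> h \<and> h < b ^ (n + 1)"
proof -
  assume b: "b \<ge> 2" and h: "h \<ge> 1"
  have "log (real b) (real h) \<ge> 0" using b h by simp
  then have "psi b h = n \<longleftrightarrow> \<lfloor>log (real b) (real h)\<rfloor> = int n"
    by (auto simp: psi_def)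
  then show ?thesis using floor_log_nat_eq_powr_iff[of b h n] b h by simp
qed

lemma psi_bounds: "b \<ge> 2 \<Longrightarrow> h \<ge> 1 \<Longrightarrow> b ^ psi b h \<le> h \<and> h < b ^ (psi b h + 1)"
  using psi_eq_iff by blast

lemma psi_power_mult: "b \<ge> 2 \<Longrightarrow> h \<ge> 1 \<Longrightarrow> psi b (b ^ k * h) = k + psi b h"
  using psi_bounds[of b h] psi_eq_iff[of b "b ^ k * h"] by (simp add: power_add Suc_le_eq)

lemma psi_ge: "b \<ge> 2 \<Longrightarrow> h \<ge> 1 \<Longrightarrow> b ^ n \<le> h \<Longrightarrow> n \<le> psi b h"
  using psi_bounds[of b h] power_less_imp_less_exp[of b n "psi b h + 1"] by linarith

lemma nat_digit_eq_0: "b \<ge> 2 \<Longrightarrow> h \<ge> 1 \<Longrightarrow> psi b h < i \<Longrightarrow> nat_digit b h i = 0"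
proof -
  assume b: "b \<ge> 2" "h \<ge> 1" "psi b h < i"
  have "h < b ^ (psi b h + 1)" using psi_bounds b by blast
  also have "\<dots> \<le> b ^ i" using b by (intro power_increasing) auto
  finally show ?thesis by (simp add: nat_digit_def)
qed

lemma nat_digits_0_iff: "b \<ge> 1 \<Longrightarrow> (\<forall>i<n. nat_digit b h i = 0) \<longleftrightarrow> b ^ n dvd h"
proof (induction n)
  case (Suc n)
  have "(\<forall>i<Suc n. nat_digit b h i = 0) \<longleftrightarrow> b ^ n dvd h \<and> nat_digit b h n = 0"
    using Suc by (auto simp: less_Suc_eq)
  also have "\<dots> \<longleftrightarrow> b ^ Suc n dvd h"
  proof (cases "b ^ n dvd h")
    case True
    then obtain k where "h = b ^ n * k" by blast
    then show ?thesis using Suc.prems by (auto simp: nat_digit_def mod_eq_0_iff_dvd)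
  next
    case False
    then show ?thesis using dvd_trans[of "b ^ n" "b ^ Suc n" h] by auto
  qed
  finally show ?case .
qed auto

lemma monom_dvd_iff_coeff:
  "Polynomial.monom 1 n dvd (p :: 'p::prime_card mod_ring poly) \<longleftrightarrow> (\<forall>k<n. Polynomial.coeff p k = 0)"
  by (simp add: monom_1_dvd_iff')

lemma of_nat_digit_eq_0:
  "(of_nat (nat_digit CARD('p) h i) :: 'p::prime_card mod_ring) = 0 \<longleftrightarrow> nat_digit CARD('p) h i = 0"
proof
  assume "(of_nat (nat_digit CARD('p) h i) :: 'p::prime_card mod_ring) = 0"
  then have "CARD('p) dvd nat_digit CARD('p) h i" by (rule of_nat_0_mod_ring_dvd)
  moreover have "nat_digit CARD('p) h i < CARD('p)"
    by (simp add: nat_digit_def)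
  ultimately show "nat_digit CARD('p) h i = 0" by (meson dvd_imp_le linorder_not_less not_gr_zero)
qed auto

text \<open>Divisibility by x^j and by b^j both say that the lowest j digits of \<open>h\<close>
  vanish. The restriction to j \<le> m reflects that \<open>tr_poly m h\<close> forgets the digits
  from position m on.\<close>

lemma monom_dvd_tr_poly:
  assumes "j \<le> m"
  shows "Polynomial.monom 1 j dvd (tr_poly m h :: 'p::prime_card mod_ring poly) \<longleftrightarrow> CARD('p) ^ j dvd h"
proof -
  have "Polynomial.monom 1 j dvd (tr_poly m h :: 'p mod_ring poly)
      \<longleftrightarrow> (\<forall>i<j. nat_digit CARD('p) h i = 0)"
    using assms by (auto simp: monom_dvd_iff_coeff coeff_tr_poly of_nat_digit_eq_0)
  then show ?thesis using nat_digits_0_iff[of "CARD('p)" j h] card_gt_1[where 'p='p] by simp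
qed

lemma digit_expansion_bounds:
  fixes c :: "nat \<Rightarrow> int"
  assumes "\<And>i. c i \<in> {0..<b}"
  shows "(\<Sum>i<n. c i * b ^ i) \<in> {0..<b ^ n}"
proof (induction n)
  case (Suc n)
  have b: "b > 0" using assms[of 0] by auto
  have "c n * b ^ n \<le> (b - 1) * b ^ n" using assms[of n] b by (intro mult_right_mono) auto
  moreover have "0 \<le> c n * b ^ n" using assms[of n] b by auto
  ultimately show ?case using Suc by (simp add: algebra_simps)
qed auto

text \<open>The terms below j add up to less than b^j and disappear under \<open>div\<close>; the
  terms above j keep a factor b after the division and disappear under \<open>mod\<close>.\<close>

lemma digit_expansion_digit:
  fixes c :: "nat \<Rightarrow> int"
  assumes c: "\<And>i. c i \<in> {0..<b}" and j: "j < n"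
  shows "(\<Sum>i<n. c i * b ^ i) div b ^ j mod b = c j"
proof -
  have b: "b > 0" using c[of 0] by auto
  obtain k where n: "n = Suc j + k" using less_imp_Suc_add[OF j] by auto
  have "(\<Sum>i<n. c i * b ^ i) = (\<Sum>i<Suc j. c i * b ^ i) + (\<Sum>i\<in>{Suc j..<Suc j + k}. c i * b ^ i)"
    unfolding n lessThan_atLeast0 by (rule sum.atLeastLessThan_concat[symmetric]) auto
  also have "(\<Sum>i\<in>{Suc j..<Suc j + k}. c i * b ^ i) = (\<Sum>i<k. c (i + Suc j) * b ^ (i + Suc j))"
    using sum.shift_bounds_nat_ivl[of "\<lambda>i. c i * b ^ i" 0 "Suc j" k]
    by (simp only: lessThan_atLeast0 add_0_left add.commute[of k])
  also have "\<dots> = b ^ j * (b * (\<Sum>i<k. c (i + Suc j) * b ^ i))"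
    by (simp add: sum_distrib_left power_add mult_ac)
  finally have "(\<Sum>i<n. c i * b ^ i)
      = (\<Sum>i<j. c i * b ^ i) + b ^ j * (c j + b * (\<Sum>i<k. c (i + Suc j) * b ^ i))"
    by (simp add: algebra_simps)
  moreover have "(\<Sum>i<j. c i * b ^ i) \<in> {0..<b ^ j}" using c by (rule digit_expansion_bounds)
  ultimately have "(\<Sum>i<n. c i * b ^ i) div b ^ j = c j + b * (\<Sum>i<k. c (i + Suc j) * b ^ i)"
    using b by simp
  then show ?thesis using c[of j] by simp
qed

lemma digit_sum_range: "digit_sum m (v :: 'p::prime_card mod_ring poly) \<in> {0..<int CARD('p) ^ m}"
  unfolding digit_sum_def by (rule digit_expansion_bounds) (rule to_int_range)

lemma digit_sum_digit:
  "j < m \<Longrightarrow> digit_sum m v div int CARD('p) ^ j mod int CARD('p)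
     = to_int_mod_ring (Polynomial.coeff (v :: 'p::prime_card mod_ring poly) j)"
  unfolding digit_sum_def by (rule digit_expansion_digit) (rule to_int_range)

lemma nu_eq_digit_sum:
  "nu m (v :: 'p::prime_card mod_ring poly) = of_int (digit_sum m v) / real CARD('p) ^ m"
proof -
  have "to_int_mod_ring (Polynomial.coeff v i) / real CARD('p) ^ (m - i)
      = of_int (to_int_mod_ring (Polynomial.coeff v i) * int CARD('p) ^ i) / real CARD('p) ^ m" if "i < m" for i
  proof -
    have "real CARD('p) ^ m = real CARD('p) ^ (m - i) * real CARD('p) ^ i"
      using that by (simp add: power_add[symmetric])
    then show ?thesis by simp
  qed
  then show ?thesis
    unfolding nu_def digit_sum_def of_int_sum sum_divide_distrib by (intro sum.cong) auto
qed

lemma nu_range: "nu m (v :: 'p::prime_card mod_ring poly) \<in> {0..<1}"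
proof -
  have d: "0 \<le> digit_sum m v" "digit_sum m v < int CARD('p) ^ m"
    using digit_sum_range[of m v] by auto
  then have "real_of_int (digit_sum m v) < real_of_int (int CARD('p) ^ m)" by (simp only: of_int_less_iff)
  then show ?thesis using d by (simp add: nu_eq_digit_sum divide_less_eq)
qed

text \<open>The first n digits of \<open>x\<close> are all encoded in the single integer
  \<open>\<lfloor>x * real b ^ n\<rfloor>\<close>, which is exactly what a grid cell of level n
  prescribes.\<close>

lemma real_digit_eq:
  assumes "i \<le> n" "b \<ge> 1"
  shows "real_digit b x i = \<lfloor>x * real b ^ n\<rfloor> div int b ^ (n - i) mod int b"
proof -
  have "x * real b ^ i = x * real b ^ n / real_of_int (int b ^ (n - i))"
    using assms by (simp add: field_simps power_add[symmetric])
  then have "\<lfloor>x * real b ^ i\<rfloor> = \<lfloor>x * real b ^ n\<rfloor> div int b ^ (n - i)"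
    using floor_divide_real_eq_div[of "int b ^ (n - i)" "x * real b ^ n"] by simp
  then show ?thesis by (simp add: real_digit_def)
qed

lemma floor_nu: "\<lfloor>nu m (v :: 'p::prime_card mod_ring poly) * real CARD('p) ^ m\<rfloor> = digit_sum m v"
  by (simp add: nu_eq_digit_sum)

text \<open>\<open>nu\<close> makes the coefficient of x^(m-1) the leading digit, hence the reversed
  index. Beyond position m the scaled number is an integer multiple of b.\<close>

lemma real_digit_nu:
  "real_digit CARD('p) (nu m (v :: 'p::prime_card mod_ring poly)) (Suc i)
     = (if i < m then to_int_mod_ring (Polynomial.coeff v (m - 1 - i)) else 0)"
proof (cases "i < m")
  case True
  then show ?thesis
    using real_digit_eq[of "Suc i" m "CARD('p)" "nu m v"] digit_sum_digit[of "m - Suc i" m v]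
    by (simp add: floor_nu)
next
  case False
  then have "nu m v * real CARD('p) ^ Suc i = of_int (digit_sum m v * int CARD('p) ^ (i - m) * int CARD('p))"
    by (simp add: nu_eq_digit_sum field_simps power_add[symmetric])
  then have "\<lfloor>nu m v * real CARD('p) ^ Suc i\<rfloor> = digit_sum m v * int CARD('p) ^ (i - m) * int CARD('p)"
    by (simp only: floor_of_int)
  then show ?thesis using False by (simp add: real_digit_def)
qed

lemma wal_eq_cis: "wal b h x = cis (2 * pi * of_int (\<Sum>i\<le>psi b h. real_digit b x (Suc i) * int (nat_digit b h i)) / real b)"
  unfolding wal_def cis_conv_exp by (simp add: algebra_simps)

lemma cmod_wal: "cmod (wal b h x) = 1"
  by (simp add: wal_eq_cis)

text \<open>The reversed order of digits in \<open>nu\<close> turns the digit pairing of the Walsh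
  function into a convolution: the sum of v_(m-1-i) h_i is the coefficient of x^(m-1) in a product
  of polynomials.\<close>

lemma wal_nu:
  fixes v :: "'p::prime_card mod_ring poly"
  assumes "h \<ge> 1" "m \<ge> 1"
  shows "wal CARD('p) h (nu m v) = add_char (Polynomial.coeff (v * tr_poly m h) (m - 1))"
proof -
  let ?b = "CARD('p)"
  have b: "?b \<ge> 2" using card_gt_1[where 'p='p] by simp
  let ?t = "\<lambda>i. real_digit ?b (nu m v) (Suc i) * int (nat_digit ?b h i)"
  \<comment> \<open>A common upper limit: the digits of \<open>h\<close> vanish above
    \<open>psi\<close>, and those of the node vanish from index m on, so both ranges can be padded
    to \<open>M\<close> without changing the sum.\<close>
  define M where "M = max (Suc (psi ?b h)) m"
  have "(\<Sum>i\<le>psi ?b h. ?t i) = (\<Sum>i<M. ?t i)"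
    unfolding M_def using b assms by (intro sum.mono_neutral_left) (auto simp: nat_digit_eq_0)
  also have "\<dots> = (\<Sum>i<m. ?t i)"
    unfolding M_def by (intro sum.mono_neutral_right) (auto simp: real_digit_nu)
  also have "of_int \<dots> = (\<Sum>i<m. Polynomial.coeff v (m - 1 - i) * of_nat (nat_digit ?b h i))"
    by (simp add: real_digit_nu of_int_to_int)
  also have "\<dots> = (\<Sum>i\<le>m - 1. Polynomial.coeff v (m - 1 - i) * Polynomial.coeff (tr_poly m h) i)"
    using assms by (intro sum.cong) (auto simp: coeff_tr_poly)
  also have "\<dots> = Polynomial.coeff (v * tr_poly m h) (m - 1)"
    by (simp only: mult.commute[of v "tr_poly m h"] coeff_mult) (simp only: mult.commute)
  finally show ?thesis
    unfolding wal_eq_cis add_char_of_int[symmetric, where 'p='p] by simp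
qed

section \<open>Polynomials of bounded degree and orthogonality of characters\<close>

lemma degree_less_iff: "m \<ge> 1 \<Longrightarrow> Polynomial.degree p < m \<longleftrightarrow> (\<forall>i\<ge>m. Polynomial.coeff p i = 0)"
  by (metis coeff_eq_0 degree_lessI le_trans less_le_trans not_one_le_zero  linorder_not_less leading_coeff_0_iff degree_0)

lemma bij_betw_coeffs:
  assumes "m \<ge> 1"
  shows "bij_betw (\<lambda>v. restrict (Polynomial.coeff v) {..<m}) {v :: 'a::comm_monoid_add poly. Polynomial.degree v < m}
           ({..<m} \<rightarrow>\<^sub>E UNIV)"
proof (rule bij_betw_byWitness[where f'="\<lambda>f. \<Sum>i<m. Polynomial.monom (f i) i"])
  show "\<forall>v\<in>{v. Polynomial.degree v < m}.
      (\<Sum>i<m. Polynomial.monom (restrict (Polynomial.coeff v) {..<m} i) i) = v"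
    using assms by (auto simp: poly_eq_iff coeff_sum degree_less_iff)
  show "\<forall>f\<in>{..<m} \<rightarrow>\<^sub>E (UNIV :: 'a set). restrict (Polynomial.coeff (\<Sum>i<m. Polynomial.monom (f i) i)) {..<m} = f"
  proof (intro ballI ext)
    fix f :: "nat \<Rightarrow> 'a" and i assume f: "f \<in> {..<m} \<rightarrow>\<^sub>E UNIV"
    show "restrict (Polynomial.coeff (\<Sum>i<m. Polynomial.monom (f i) i)) {..<m} i = f i"
      using PiE_arb[OF f, of i] by (cases "i < m") (auto simp: coeff_sum)
  qed
  show "(\<lambda>f. \<Sum>i<m. Polynomial.monom (f i) i) ` ({..<m} \<rightarrow>\<^sub>E (UNIV :: 'a set)) \<subseteq> {v. Polynomial.degree v < m}"
    unfolding image_subset_iff using assms by (simp add: degree_less_iff coeff_sum)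
  show "(\<lambda>v. restrict (Polynomial.coeff v) {..<m}) ` {v. Polynomial.degree v < m}
      \<subseteq> {..<m} \<rightarrow>\<^sub>E (UNIV :: 'a set)"
    by (simp add: image_subset_iff restrict_PiE_iff)
qed

lemma finite_degree_less: "finite {v :: 'p::prime_card mod_ring poly. Polynomial.degree v < m}"
proof (cases "m \<ge> 1")
  case True
  then show ?thesis
    using bij_betw_finite[OF bij_betw_coeffs[OF True, where 'a="'p mod_ring"]] by (simp add: finite_PiE)
qed simp

lemma card_degree_less:
  "m \<ge> 1 \<Longrightarrow> card {v :: 'p::prime_card mod_ring poly. Polynomial.degree v < m} = CARD('p) ^ m"
  using bij_betw_same_card[OF bij_betw_coeffs[where 'a="'p mod_ring" and m=m]] by (simp add: card_PiE)

text \<open>If x^m does not divide \<open>p\<close>, translating the summation variable by a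
  suitable \<open>v0\<close> multiplies the sum by a character value different from 1, so the sum is
  0.\<close>

lemma sum_add_char_coeff:
  fixes p :: "'p::prime_card mod_ring poly"
  assumes m: "m \<ge> 1"
  shows "(\<Sum>v | Polynomial.degree v < m. add_char (Polynomial.coeff (v * p) (m - 1)))
           = (if Polynomial.monom 1 m dvd p then of_nat (CARD('p) ^ m) else 0)"
proof (cases "Polynomial.monom 1 m dvd p")
  case True
  then have "Polynomial.coeff (v * p) (m - 1) = 0" for v
    using m dvd_mult[OF True, of v] unfolding monom_dvd_iff_coeff by simp
  then show ?thesis using True m by (simp add: add_char_0 card_degree_less)
next
  case False
  let ?S = "{v :: 'p mod_ring poly. Polynomial.degree v < m}"
  define k where "k = (LEAST k. Polynomial.coeff p k \<noteq> 0)"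
  obtain k0 where k0: "k0 < m" "Polynomial.coeff p k0 \<noteq> 0" using False by (auto simp: monom_dvd_iff_coeff)
  have k: "Polynomial.coeff p k \<noteq> 0" unfolding k_def by (rule LeastI[of _ k0]) (use k0 in auto)
  have "k \<le> k0" unfolding k_def using k0 by (intro Least_le)
  then have km: "k < m" using k0 by simp
  \<comment> \<open>Multiplication by this monomial moves coefficient k of \<open>p\<close> to
    position m - 1 and normalises it to 1.\<close>
  define v0 where "v0 = Polynomial.monom (inverse (Polynomial.coeff p k)) (m - 1 - k)"
  have c: "Polynomial.coeff (v0 * p) (m - 1) = 1"
    using k km by (simp add: v0_def coeff_monom_mult)
  have v0: "Polynomial.degree v0 < m"
    unfolding v0_def using m by (intro le_less_trans[OF degree_monom_le]) auto
  let ?f = "\<lambda>v. add_char (Polynomial.coeff (v * p) (m - 1))"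
  have "sum ?f ?S = (\<Sum>v\<in>?S. ?f (v + v0))"
    by (rule sum.reindex_bij_witness[of _ "\<lambda>v. v + v0" "\<lambda>v. v - v0"])
       (use v0 in \<open>auto intro: degree_add_less degree_diff_less\<close>)
  also have "\<dots> = sum ?f ?S * add_char (1 :: 'p mod_ring)"
    by (simp add: distrib_right add_char_add c[unfolded One_nat_def] sum_distrib_right)
  finally have "sum ?f ?S = 0 \<or> add_char (1 :: 'p mod_ring) = 1"
    by (rule iffD1[OF mult_cancel_left1])
  then have "sum ?f ?S = 0" using add_char_1[where 'p='p] by blast
  then show ?thesis using False by simp
qed

lemma sum_wal_nu:
  assumes "h \<ge> 1" "n \<ge> 1"
  shows "(\<Sum>v | Polynomial.degree (v :: 'p::prime_card mod_ring poly) < n. wal CARD('p) h (nu n v))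
           = (if CARD('p) ^ n dvd h then of_nat (CARD('p) ^ n) else 0)"
  by (simp only: wal_nu[OF assms] sum_add_char_coeff[OF assms(2)] monom_dvd_tr_poly[OF order_refl])

lemma bij_betw_digit_sum:
  assumes "n \<ge> 1"
  shows "bij_betw (digit_sum n) {v :: 'p::prime_card mod_ring poly. Polynomial.degree v < n} {0..<int CARD('p) ^ n}"
proof -
  let ?S = "{v :: 'p mod_ring poly. Polynomial.degree v < n}"
  have inj: "inj_on (digit_sum n) ?S"
  proof (rule inj_onI)
    fix u v :: "'p mod_ring poly"
    assume uv: "u \<in> ?S" "v \<in> ?S" "digit_sum n u = digit_sum n v"
    have "Polynomial.coeff u j = Polynomial.coeff v j" for j
    proof (cases "j < n")
      case True
      then have "to_int_mod_ring (Polynomial.coeff u j) = to_int_mod_ring (Polynomial.coeff v j)"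
        using digit_sum_digit[OF True] uv(3) by metis
      then show ?thesis by (metis of_int_to_int)
    next
      case False
      then show ?thesis using uv assms by (simp add: degree_less_iff)
    qed
    then show "u = v" by (simp add: poly_eq_iff)
  qed
  have "digit_sum n ` ?S = {0..<int CARD('p) ^ n}"
  proof (rule card_subset_eq)
    show "digit_sum n ` ?S \<subseteq> {0..<int CARD('p) ^ n}" using digit_sum_range by blast
    show "card (digit_sum n ` ?S) = card {0..<int CARD('p) ^ n}"
      using inj assms by (simp add: card_image card_degree_less nat_power_eq)
  qed auto
  then show ?thesis using inj by (simp add: bij_betw_def)
qed

text \<open>The Walsh function reads only the first \<open>psi + 1\<close> digits of its argument,
  so it is constant on every cell of level n > \<open>psi\<close>.\<close>

lemma wal_eq_wal_nu:
  fixes v :: "'p::prime_card mod_ring poly"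
  assumes "\<lfloor>x * real CARD('p) ^ n\<rfloor> = digit_sum n v" "psi CARD('p) h < n"
  shows "wal CARD('p) h (nu n v) = wal CARD('p) h x"
proof -
  have "real_digit CARD('p) (nu n v) (Suc i) = real_digit CARD('p) x (Suc i)" if "i \<le> psi CARD('p) h" for i
    using real_digit_eq[of "Suc i" n "CARD('p)"] that assms by (simp add: floor_nu)
  then show ?thesis unfolding wal_eq_cis by simp
qed

section \<open>Expansion of the Walsh kernel\<close>

lemma has_sum_finite_sum:
  fixes f :: "'i \<Rightarrow> 'a \<Rightarrow> 'b::topological_comm_monoid_add"
  assumes "\<And>i. i \<in> S \<Longrightarrow> (f i has_sum g i) A"
  shows "((\<lambda>x. \<Sum>i\<in>S. f i x) has_sum (\<Sum>i\<in>S. g i)) A"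
  using assms by (induction S rule: infinite_finite_induct) (auto intro: has_sum_add)

text \<open>A finite set carries all but e/2 of the mass, and eventually the selected indices avoid
  it.\<close>

lemma infsum_filter_tendsto_0:
  fixes f :: "'a \<Rightarrow> real"
  assumes f: "f summable_on A" "\<And>x. x \<in> A \<Longrightarrow> f x \<ge> 0"
    and P: "\<And>x. x \<in> A \<Longrightarrow> \<forall>\<^sub>F n in F. \<not> P n x"
  shows "((\<lambda>n. infsum f {x\<in>A. P n x}) \<longlongrightarrow> 0) F"
proof (rule tendstoI)
  fix e :: real assume e: "e > 0"
  obtain B where B: "finite B" "B \<subseteq> A" "dist (sum f B) (infsum f A) \<le> e / 2"
    using infsum_finite_approximation[OF f(1), of "e / 2"] e by auto
  have "\<forall>\<^sub>F n in F. \<forall>x\<in>B. \<not> P n x"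
    using B P by (intro eventually_ball_finite) auto
  then show "\<forall>\<^sub>F n in F. dist (infsum f {x\<in>A. P n x}) 0 < e"
  proof eventually_elim
    case (elim n)
    let ?Q = "{x\<in>A. P n x}"
    have sQ: "f summable_on ?Q" by (rule summable_on_subset_banach[OF f(1)]) auto
    have sB: "f summable_on B" using B by simp
    have "infsum f ?Q + infsum f B = infsum f (?Q \<union> B)"
      using elim by (intro infsum_Un_disjoint[symmetric] sQ sB) auto
    also have "\<dots> \<le> infsum f A"
      using B f by (intro infsum_mono2 f(1) summable_on_subset_banach[OF f(1)]) auto
    finally have "infsum f ?Q + sum f B \<le> infsum f A" using B by simp
    then have "infsum f ?Q \<le> e / 2" using B(3) unfolding dist_real_def by linarith
    moreover have "infsum f ?Q \<ge> 0" using f(2) by (intro infsum_nonneg) auto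
    ultimately show ?case using e by simp
  qed
qed

lemma infsum_of_bool_mult:
  fixes f :: "'a \<Rightarrow> real"
  shows "infsum (\<lambda>x. f x * of_bool (P x)) A = infsum f {x\<in>A. P x}"
  by (rule infsum_cong_neutral) auto

lemma summable_on_of_bool_mult:
  fixes f :: "'a \<Rightarrow> real"
  assumes "f summable_on A"
  shows "(\<lambda>x. f x * of_bool (P x)) summable_on A"
proof -
  have "f summable_on {x\<in>A. P x}" by (rule summable_on_subset_banach[OF assms]) auto
  also have "?this \<longleftrightarrow> ?thesis" by (rule summable_on_cong_neutral) auto
  finally show ?thesis .
qed

section \<open>Kernels with a summable expansion\<close>

locale expanded_kernel =
  fixes D :: "'x set" and K :: "'x \<Rightarrow> 'x \<Rightarrow> complex"
    and \<Lambda> :: "'l set" and \<rho> :: "'l \<Rightarrow> real" and W :: "'l \<Rightarrow> 'x \<Rightarrow> complex"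
  assumes \<rho>_nonneg: "\<And>l. l \<in> \<Lambda> \<Longrightarrow> \<rho> l \<ge> 0"
    and \<rho>_summable: "\<rho> summable_on \<Lambda>"
    and W_le_1: "\<And>l x. cmod (W l x) \<le> 1"
    and K_expansion: "\<And>x y. K x y = 1 + (\<Sum>\<^sub>\<infinity>l\<in>\<Lambda>. of_real (\<rho> l) * W l x * cnj (W l y))"
begin

lemma weighted_summable:
  assumes "\<And>l. l \<in> \<Lambda> \<Longrightarrow> cmod (z l) \<le> B"
  shows "(\<lambda>l. of_real (\<rho> l) * z l) summable_on \<Lambda>"
proof -
  have "(\<lambda>l. \<rho> l * B) summable_on \<Lambda>" by (rule summable_on_cmult_left[OF \<rho>_summable])
  then have "(\<lambda>l. norm (of_real (\<rho> l) * z l)) summable_on \<Lambda>"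
    by (rule Infinite_Sum.abs_summable_on_comparison_test')
       (use assms \<rho>_nonneg in \<open>auto simp: norm_mult intro: mult_left_mono\<close>)
  then show ?thesis by (rule abs_summable_summable)
qed

lemma kernel_has_sum: "((\<lambda>l. of_real (\<rho> l) * (W l x * cnj (W l y))) has_sum (K x y - 1)) \<Lambda>"
proof -
  have "(\<lambda>l. of_real (\<rho> l) * (W l x * cnj (W l y))) summable_on \<Lambda>"
    by (rule weighted_summable[where B=1]) (auto simp: norm_mult intro!: mult_le_one W_le_1)
  then show ?thesis
    using has_sum_infsum by (fastforce simp: K_expansion mult.assoc)
qed

definition avgW :: "'i set \<Rightarrow> ('i \<Rightarrow> 'x) \<Rightarrow> 'l \<Rightarrow> complex" where
  "avgW S p l = (\<Sum>i\<in>S. W l (p i)) / of_nat (card S)"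

lemma avg_kernel_has_sum:
  assumes "finite S" "S \<noteq> {}"
  shows "((\<lambda>l. of_real (\<rho> l) * (W l x * cnj (avgW S p l))) has_sum
            ((\<Sum>i\<in>S. K x (p i)) / of_nat (card S) - 1)) \<Lambda>"
proof -
  have "((\<lambda>l. (\<Sum>i\<in>S. of_real (\<rho> l) * (W l x * cnj (W l (p i)))) * inverse (of_nat (card S))) has_sum
          ((\<Sum>i\<in>S. K x (p i) - 1) * inverse (of_nat (card S)))) \<Lambda>"
    by (intro has_sum_cmult_left has_sum_finite_sum kernel_has_sum)
  moreover have "(\<Sum>i\<in>S. of_real (\<rho> l) * (W l x * cnj (W l (p i)))) * inverse (of_nat (card S))
      = of_real (\<rho> l) * (W l x * cnj (avgW S p l))" for l
    by (simp add: avgW_def sum_distrib_left divide_inverse mult.assoc)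
  moreover have "(\<Sum>i\<in>S. K x (p i) - 1) * inverse (of_nat (card S))
      = (\<Sum>i\<in>S. K x (p i)) / of_nat (card S) - 1"
    using assms by (simp add: sum_subtractf field_simps)
  ultimately show ?thesis by simp
qed

lemma avg_avg_kernel_has_sum:
  assumes "finite S" "S \<noteq> {}"
  shows "((\<lambda>l. of_real (\<rho> l) * (avgW S p l * cnj (avgW S p l))) has_sum
            ((\<Sum>i\<in>S. \<Sum>k\<in>S. K (p i) (p k)) / (of_nat (card S))\<^sup>2 - 1)) \<Lambda>"
proof -
  let ?N = "of_nat (card S) :: complex"
  have N: "?N \<noteq> 0" using assms by simp
  have "((\<lambda>l. (\<Sum>i\<in>S. of_real (\<rho> l) * (W l (p i) * cnj (avgW S p l))) * inverse ?N) has_sum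
          ((\<Sum>i\<in>S. (\<Sum>k\<in>S. K (p i) (p k)) / ?N - 1) * inverse ?N)) \<Lambda>"
    by (intro has_sum_cmult_left has_sum_finite_sum avg_kernel_has_sum assms)
  moreover have "(\<Sum>i\<in>S. of_real (\<rho> l) * (W l (p i) * cnj (avgW S p l))) * inverse ?N
      = of_real (\<rho> l) * (avgW S p l * cnj (avgW S p l))" for l
    unfolding avgW_def[of S p l] 
    by (simp add: sum_distrib_left[symmetric] sum_distrib_right[symmetric] divide_inverse mult_ac)
  moreover have "(\<Sum>i\<in>S. (\<Sum>k\<in>S. K (p i) (p k)) / ?N - 1) * inverse ?N
      = (\<Sum>i\<in>S. \<Sum>k\<in>S. K (p i) (p k)) / ?N\<^sup>2 - 1"
    using N by (simp add: sum_subtractf sum_divide_distrib[symmetric] field_simps power2_eq_square)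
  ultimately show ?thesis by simp
qed

text \<open>Off \<open>L\<close> the terms vanish, and on \<open>L\<close> both factors have modulus
  at most 1. The bound is uniform in \<open>x\<close>, which \<open>constant_one_representer\<close>
  requires.\<close>

lemma avg_kernel_close:
  assumes "finite S" "S \<noteq> {}" and L: "\<And>l. l \<in> \<Lambda> \<Longrightarrow> \<not> L l \<Longrightarrow> avgW S p l = 0"
  shows "cmod ((\<Sum>i\<in>S. K x (p i)) / of_nat (card S) - 1) \<le> infsum \<rho> {l\<in>\<Lambda>. L l}"
proof -
  have le1: "cmod (avgW S p l) \<le> 1" for l
  proof -
    have "cmod (\<Sum>i\<in>S. W l (p i)) \<le> (\<Sum>i\<in>S. 1)"
      using W_le_1 by (intro sum_norm_le) auto
    then show ?thesis using assms by (simp add: avgW_def norm_divide divide_le_eq card_gt_0_iff)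
  qed
  have "((\<lambda>l. \<rho> l * of_bool (L l)) has_sum infsum \<rho> {l\<in>\<Lambda>. L l}) \<Lambda>"
    using has_sum_infsum[OF summable_on_of_bool_mult[OF \<rho>_summable]] by (simp only: infsum_of_bool_mult)
  then show ?thesis
  proof (rule norm_infsum_le[OF avg_kernel_has_sum[OF assms(1,2)]])
    fix l assume l: "l \<in> \<Lambda>"
    have "cmod (W l x) * cmod (avgW S p l) \<le> 1"
      using le1 W_le_1 by (intro mult_le_one) auto
    then have "\<rho> l * (cmod (W l x) * cmod (avgW S p l)) \<le> \<rho> l"
      using \<rho>_nonneg[OF l] by (intro mult_left_le) auto
    then show "cmod (of_real (\<rho> l) * (W l x * cnj (avgW S p l))) \<le> \<rho> l * of_bool (L l)"
      using L[OF l] \<rho>_nonneg[OF l] by (cases "L l") (auto simp: norm_mult)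
  qed
qed

lemma avg_avg_kernel_dual:
  assumes "finite S" "S \<noteq> {}" and L: "\<And>l. l \<in> \<Lambda> \<Longrightarrow> avgW S p l = of_bool (L l)"
  shows "(\<Sum>i\<in>S. \<Sum>k\<in>S. K (p i) (p k)) / (of_nat (card S))\<^sup>2 = 1 + of_real (infsum \<rho> {l\<in>\<Lambda>. L l})"
proof -
  have "((\<lambda>l. \<rho> l * of_bool (L l)) has_sum infsum \<rho> {l\<in>\<Lambda>. L l}) \<Lambda>"
    using has_sum_infsum[OF summable_on_of_bool_mult[OF \<rho>_summable]] by (simp only: infsum_of_bool_mult)
  then have "((\<lambda>l. of_real (\<rho> l * of_bool (L l))) has_sum (of_real (infsum \<rho> {l\<in>\<Lambda>. L l}) :: complex)) \<Lambda>"
    by (rule has_sum_of_real)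
  also have "?this \<longleftrightarrow> ((\<lambda>l. of_real (\<rho> l) * (avgW S p l * cnj (avgW S p l))) has_sum
      of_real (infsum \<rho> {l\<in>\<Lambda>. L l})) \<Lambda>"
    using L by (intro has_sum_cong) simp
  finally show ?thesis
    using has_sum_unique[OF avg_avg_kernel_has_sum[OF assms(1,2), of p]] by (simp add: diff_eq_eq)
qed

text \<open>The combination of kernel values is the sum of \<rho>(l) times the squared modulus of
  W_l(x) - W_l(y), and that modulus is at most 2. Fed into \<open>norm_diff_sections\<close>, it
  bounds the oscillation of \<open>f\<close> on a cell.\<close>

lemma kernel_diff_le:
  assumes L: "\<And>l. l \<in> \<Lambda> \<Longrightarrow> \<not> L l \<Longrightarrow> W l x = W l y"
  shows "Re (K x x - K x y - K y x + K y y) \<le> 4 * infsum \<rho> {l\<in>\<Lambda>. L l}"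
proof -
  let ?g = "\<lambda>l. of_real (\<rho> l) * ((W l x - W l y) * cnj (W l x - W l y))"
  have "((\<lambda>l. of_real (\<rho> l) * (W l x * cnj (W l x)) + of_real (\<rho> l) * (W l y * cnj (W l y))
        + - (of_real (\<rho> l) * (W l x * cnj (W l y)) + of_real (\<rho> l) * (W l y * cnj (W l x))))
      has_sum ((K x x - 1) + (K y y - 1) + - ((K x y - 1) + (K y x - 1)))) \<Lambda>"
    by (intro has_sum_add has_sum_uminusI kernel_has_sum)
  moreover have "of_real (\<rho> l) * (W l x * cnj (W l x)) + of_real (\<rho> l) * (W l y * cnj (W l y))
        + - (of_real (\<rho> l) * (W l x * cnj (W l y)) + of_real (\<rho> l) * (W l y * cnj (W l x))) = ?g l" for l
    by (simp add: algebra_simps)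
  ultimately have g: "(?g has_sum (K x x - K x y - K y x + K y y)) \<Lambda>"
    by (simp add: algebra_simps)
  have "((\<lambda>l. \<rho> l * of_bool (L l)) has_sum infsum \<rho> {l\<in>\<Lambda>. L l}) \<Lambda>"
    using has_sum_infsum[OF summable_on_of_bool_mult[OF \<rho>_summable]] by (simp only: infsum_of_bool_mult)
  then have "((\<lambda>l. 4 * (\<rho> l * of_bool (L l))) has_sum 4 * infsum \<rho> {l\<in>\<Lambda>. L l}) \<Lambda>"
    by (rule has_sum_cmult_right)
  then have "cmod (K x x - K x y - K y x + K y y) \<le> 4 * infsum \<rho> {l\<in>\<Lambda>. L l}"
  proof (rule norm_infsum_le[OF g])
    fix l assume l: "l \<in> \<Lambda>"
    have "cmod (W l x - W l y) \<le> 2"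
      using norm_triangle_ineq4[of "W l x" "W l y"] W_le_1[of l x] W_le_1[of l y] by linarith
    then have "cmod (W l x - W l y) * cmod (W l x - W l y) \<le> 2 * 2"
      by (intro mult_mono) auto
    then have "\<rho> l * (cmod (W l x - W l y) * cmod (W l x - W l y)) \<le> \<rho> l * 4"
      using \<rho>_nonneg[OF l] by (intro mult_left_mono) auto
    moreover have "cmod (?g l) = \<rho> l * (cmod (W l x - W l y) * cmod (W l x - W l y))"
      using \<rho>_nonneg[OF l] by (simp only: norm_mult complex_mod_cnj norm_of_real abs_of_nonneg)
    ultimately show "cmod (?g l) \<le> 4 * (\<rho> l * of_bool (L l))"
      using L[OF l] by (cases "L l") auto
  qed
  then show ?thesis using complex_Re_le_cmod order_trans by blast
qed

text \<open>Together with \<open>norm_point_eval\<close> this bounds every element of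
  \<open>H\<close> uniformly, which supplies the dominating function for the integrals.\<close>

lemma kernel_diag_le: "Re (K x x) \<le> 1 + infsum \<rho> \<Lambda>"
proof -
  have "cmod (K x x - 1) \<le> infsum \<rho> \<Lambda>"
  proof (rule norm_infsum_le[OF kernel_has_sum has_sum_infsum[OF \<rho>_summable]])
    fix l assume l: "l \<in> \<Lambda>"
    have "cmod (W l x) * cmod (W l x) \<le> 1"
      using W_le_1 by (intro mult_le_one) auto
    then have "\<rho> l * (cmod (W l x) * cmod (W l x)) \<le> \<rho> l"
      using \<rho>_nonneg[OF l] by (intro mult_left_le) auto
    then show "cmod (of_real (\<rho> l) * (W l x * cnj (W l x))) \<le> \<rho> l"
      using \<rho>_nonneg[OF l] by (simp add: norm_mult)
  qed
  then show ?thesis using complex_Re_le_cmod[of "K x x - 1"] by simp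
qed

end

section \<open>Summability of the Walsh coefficients\<close>

lemma r_decay_nonneg: "r_decay b \<beta> h \<ge> 0"
  by (simp add: r_decay_def)

text \<open>From h < b^(psi + 1) the decay is at most b^\<beta> h^(-\<beta>), so the zeta series
  dominates.\<close>

lemma r_decay_summable:
  assumes b: "b \<ge> 2" and \<beta>: "\<beta> > 1"
  shows "r_decay b \<beta> summable_on {1..}"
proof -
  have "(\<lambda>n. real n powr - \<beta>) summable_on UNIV"
    using \<beta> by (subst summable_on_UNIV_nonneg_real_iff) (auto simp: summable_real_powr_iff)
  then have "(\<lambda>n. real n powr - \<beta>) summable_on {1..}"
    by (rule summable_on_subset_banach) simp
  then have "(\<lambda>n. real b powr \<beta> * real n powr - \<beta>) summable_on {1..}"
    by (rule summable_on_cmult_right)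
  then show ?thesis
  proof (rule summable_on_comparison_test)
    fix h :: nat assume h: "h \<in> {1..}"
    have "h < b ^ (psi b h + 1)" using psi_bounds[OF b, of h] h by simp
    then have "real h < real (b ^ (psi b h + 1))" by (simp only: of_nat_less_iff)
    then have "real h < real b powr (real (psi b h) + 1)"
      using b by (simp add: powr_add powr_realpow mult.commute)
    then have "(real b powr (real (psi b h) + 1)) powr - \<beta> \<le> real h powr - \<beta>"
      using h \<beta> by (intro powr_mono2') auto
    also have "(real b powr (real (psi b h) + 1)) powr - \<beta> = real b powr (- \<beta>) * r_decay b \<beta> h"
      by (simp add: powr_powr r_decay_def powr_add[symmetric] algebra_simps)
    finally have "real b powr \<beta> * (real b powr (- \<beta>) * r_decay b \<beta> h) \<le> real b powr \<beta> * real h powr - \<beta>"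
      by (intro mult_left_mono) auto
    moreover have "real b powr \<beta> * real b powr (- \<beta>) = 1" using b by (simp add: powr_minus)
    ultimately show "r_decay b \<beta> h \<le> real b powr \<beta> * real h powr - \<beta>"
      by (simp only: mult.assoc[symmetric] mult_1_left)
  qed (simp add: r_decay_nonneg)
qed

lemma mu_nonneg: "mu b \<beta> \<ge> 0"
  unfolding mu_def by (intro infsum_nonneg r_decay_nonneg)

text \<open>A finite set of functions lies in the box of its coordinate projections, over which the
  sum of products factorises into one-dimensional partial sums.\<close>

lemma summable_on_prod_PiE:
  fixes r :: "'b \<Rightarrow> real"
  assumes u: "finite u" and r: "r summable_on A" "\<And>x. r x \<ge> 0"
  shows "(\<lambda>h. \<Prod>j\<in>u. r (h j)) summable_on (u \<rightarrow>\<^sub>E A)"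
proof (rule nonneg_bdd_above_summable_on)
  show "bdd_above (sum (\<lambda>h. \<Prod>j\<in>u. r (h j)) ` {F. F \<subseteq> (u \<rightarrow>\<^sub>E A) \<and> finite F})"
  proof (rule bdd_aboveI2)
    fix F assume F: "F \<in> {F. F \<subseteq> (u \<rightarrow>\<^sub>E A) \<and> finite F}"
    let ?G = "PiE u (\<lambda>j. (\<lambda>h. h j) ` F)"
    have "F \<subseteq> ?G" using F by (auto simp: PiE_def Pi_def)
    then have "(\<Sum>h\<in>F. \<Prod>j\<in>u. r (h j)) \<le> (\<Sum>h\<in>?G. \<Prod>j\<in>u. r (h j))"
      using F u r by (intro sum_mono2 finite_PiE prod_nonneg) auto
    also have "\<dots> = (\<Prod>j\<in>u. \<Sum>k\<in>(\<lambda>h. h j) ` F. r k)"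
      using F u by (intro prod_sum_PiE[symmetric]) auto
    also have "\<dots> \<le> (\<Prod>j\<in>u. infsum r A)"
    proof (rule prod_mono)
      fix j assume j: "j \<in> u"
      have "(\<Sum>k\<in>(\<lambda>h. h j) ` F. r k) \<le> infsum r A"
        using F j r by (intro finite_sum_le_infsum) (auto simp: PiE_def Pi_def)
      then show "0 \<le> (\<Sum>k\<in>(\<lambda>h. h j) ` F. r k) \<and> (\<Sum>k\<in>(\<lambda>h. h j) ` F. r k) \<le> infsum r A"
        using r by (auto intro: sum_nonneg)
    qed
    finally show "(\<Sum>h\<in>F. \<Prod>j\<in>u. r (h j)) \<le> (\<Prod>j\<in>u. infsum r A)" .
  qed
qed (use r in \<open>auto intro: prod_nonneg\<close>)

lemma infsum_prod_PiE_power: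
  fixes r :: "'b \<Rightarrow> real"
  assumes u: "finite u" and r: "r summable_on A" "\<And>x. r x \<ge> 0"
  shows "infsum (\<lambda>h. \<Prod>j\<in>u. r (h j)) (u \<rightarrow>\<^sub>E A) = infsum r A ^ card u"
  using infsum_prod_PiE[OF u r(1) summable_on_prod_PiE[OF u r]] by simp

definition walsh_index :: "nat \<Rightarrow> (nat set \<times> (nat \<Rightarrow> nat)) set" where
  "walsh_index s = (SIGMA u:{u. u \<noteq> {} \<and> u \<subseteq> {1..s}}. u \<rightarrow>\<^sub>E {1..})"

definition walsh_coeff :: "nat \<Rightarrow> real \<Rightarrow> (nat set \<Rightarrow> real) \<Rightarrow> nat set \<times> (nat \<Rightarrow> nat) \<Rightarrow> real" where
  "walsh_coeff b \<alpha> \<gamma> = (\<lambda>(u, h). \<gamma> u * (\<Prod>j\<in>u. r_decay b \<alpha> (h j)))"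

definition walsh_prod :: "nat \<Rightarrow> nat set \<times> (nat \<Rightarrow> nat) \<Rightarrow> (nat \<Rightarrow> real) \<Rightarrow> complex" where
  "walsh_prod b = (\<lambda>(u, h) x. \<Prod>j\<in>u. wal b (h j) (x j))"

lemma walsh_coeff_slice_has_sum:
  assumes "b \<ge> 2" "\<alpha> > 1" "finite u"
  shows "((\<lambda>h. walsh_coeff b \<alpha> \<gamma> (u, h)) has_sum \<gamma> u * mu b \<alpha> ^ card u) (u \<rightarrow>\<^sub>E {1..})"
proof -
  note r = r_decay_summable[OF assms(1,2)] r_decay_nonneg
  have "((\<lambda>h. \<Prod>j\<in>u. r_decay b \<alpha> (h j)) has_sum mu b \<alpha> ^ card u) (u \<rightarrow>\<^sub>E {1..})"
    using has_sum_infsum[OF summable_on_prod_PiE[OF assms(3) r]] infsum_prod_PiE_power[OF assms(3) r]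
    by (simp add: mu_def)
  then show ?thesis by (simp add: walsh_coeff_def has_sum_cmult_right)
qed

lemma walsh_coeff_nonneg:
  "(\<And>u. u \<subseteq> {1..s} \<Longrightarrow> \<gamma> u \<ge> 0) \<Longrightarrow> l \<in> walsh_index s \<Longrightarrow> walsh_coeff b \<alpha> \<gamma> l \<ge> 0"
  by (auto simp: walsh_index_def walsh_coeff_def intro!: mult_nonneg_nonneg prod_nonneg r_decay_nonneg)

lemma walsh_coeff_summable:
  assumes "b \<ge> 2" "\<alpha> > 1" and \<gamma>: "\<And>u. u \<subseteq> {1..s} \<Longrightarrow> \<gamma> u \<ge> 0"
  shows "walsh_coeff b \<alpha> \<gamma> summable_on walsh_index s"
  unfolding walsh_index_def
proof (rule summable_on_SigmaI)
  show "((\<lambda>h. walsh_coeff b \<alpha> \<gamma> (u, h)) has_sum \<gamma> u * mu b \<alpha> ^ card u) (u \<rightarrow>\<^sub>E {1..})"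
    if "u \<in> {u. u \<noteq> {} \<and> u \<subseteq> {1..s}}" for u
    using that by (intro walsh_coeff_slice_has_sum assms) (auto intro: finite_subset)
  show "(\<lambda>u. \<gamma> u * mu b \<alpha> ^ card u) summable_on {u. u \<noteq> {} \<and> u \<subseteq> {1..s}}"
    by (rule summable_on_finite) simp
qed (use walsh_coeff_nonneg[of s \<gamma>, OF \<gamma>] in \<open>auto simp: walsh_index_def\<close>)

lemma expanded_walsh_kernel:
  assumes "b \<ge> 2" "\<alpha> > 1" and \<gamma>: "\<And>u. u \<subseteq> {1..s} \<Longrightarrow> \<gamma> u \<ge> 0"
  shows "expanded_kernel (walsh_kernel b s \<alpha> \<gamma>) (walsh_index s) (walsh_coeff b \<alpha> \<gamma>) (walsh_prod b)"
proof
  show "walsh_coeff b \<alpha> \<gamma> l \<ge> 0" if "l \<in> walsh_index s" for l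
    using walsh_coeff_nonneg[of s \<gamma>, OF \<gamma> that] .
  show summable: "walsh_coeff b \<alpha> \<gamma> summable_on walsh_index s"
    using walsh_coeff_summable[of b \<alpha> s \<gamma>] assms by blast
  show W1: "cmod (walsh_prod b l x) \<le> 1" for l x
    by (simp add: walsh_prod_def case_prod_beta prod_norm[symmetric] cmod_wal)
  fix x y
  let ?t = "\<lambda>l. of_real (walsh_coeff b \<alpha> \<gamma> l) * walsh_prod b l x * cnj (walsh_prod b l y)"
  \<comment> \<open>Absolute summability permits splitting the sum over pairs into an outer sum over
    \<open>u\<close> and inner sums over \<open>h\<close>.\<close>
  have "(\<lambda>l. norm (?t l)) summable_on walsh_index s"
  proof (rule Infinite_Sum.abs_summable_on_comparison_test'[OF summable])
    fix l assume l: "l \<in> walsh_index s"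
    have "cmod (walsh_prod b l x) * cmod (walsh_prod b l y) \<le> 1"
      by (intro mult_le_one W1) auto
    then show "norm (?t l) \<le> walsh_coeff b \<alpha> \<gamma> l"
      using walsh_coeff_nonneg[of s \<gamma>, OF \<gamma> l, of b \<alpha>] by (simp add: norm_mult mult.assoc mult_left_le)
  qed
  then have "?t summable_on walsh_index s" by (rule abs_summable_summable)
  then have "infsum ?t (walsh_index s)
      = (\<Sum>\<^sub>\<infinity>u\<in>{u. u \<noteq> {} \<and> u \<subseteq> {1..s}}. \<Sum>\<^sub>\<infinity>h\<in>u \<rightarrow>\<^sub>E {1..}. ?t (u, h))"
    unfolding walsh_index_def by (rule infsum_Sigma_banach[symmetric])
  also have "\<dots> = (\<Sum>u | u \<noteq> {} \<and> u \<subseteq> {1..s}. \<Sum>\<^sub>\<infinity>h\<in>u \<rightarrow>\<^sub>E {1..}. ?t (u, h))"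
    by (rule infsum_finite) simp
  also have "\<dots> = (\<Sum>u | u \<noteq> {} \<and> u \<subseteq> {1..s}. of_real (\<gamma> u) *
            (\<Sum>\<^sub>\<infinity>h\<in>(u \<rightarrow>\<^sub>E {1..}).
               of_real (\<Prod>j\<in>u. r_decay b \<alpha> (h j)) *
               (\<Prod>j\<in>u. wal b (h j) (x j)) * cnj (\<Prod>j\<in>u. wal b (h j) (y j))))"
    by (intro sum.cong refl) (simp add: walsh_coeff_def walsh_prod_def infsum_cmult_right'[symmetric] mult.assoc)
  finally show "walsh_kernel b s \<alpha> \<gamma> x y = 1 + infsum ?t (walsh_index s)"
    by (simp only: walsh_kernel_def)
qed

section \<open>Integration by averaging over grids\<close>

definition grid_index :: "nat \<Rightarrow> nat \<Rightarrow> (nat \<Rightarrow> 'p::prime_card mod_ring poly) set" where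
  "grid_index s n = {1..s} \<rightarrow>\<^sub>E {v. Polynomial.degree v < n}"

definition grid_point :: "nat \<Rightarrow> nat \<Rightarrow> (nat \<Rightarrow> 'p::prime_card mod_ring poly) \<Rightarrow> nat \<Rightarrow> real" where
  "grid_point s n V = (\<lambda>j\<in>{1..s}. nu n (V j))"

text \<open>The half-open box of side b^(-n) whose lower corner is \<open>grid_point s n V\<close>.
  For n \<ge> 1 these boxes partition the cube, by \<open>grid_cell_exists\<close> and
  \<open>grid_cell_unique\<close>.\<close>

definition grid_cell :: "nat \<Rightarrow> nat \<Rightarrow> (nat \<Rightarrow> 'p::prime_card mod_ring poly) \<Rightarrow> (nat \<Rightarrow> real) set" where
  "grid_cell s n V = (\<Pi>\<^sub>E j\<in>{1..s}. {of_int (digit_sum n (V j)) / real CARD('p) ^ n ..<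
                                        (of_int (digit_sum n (V j)) + 1) / real CARD('p) ^ n})"

lemma finite_grid_index: "finite (grid_index s n :: (nat \<Rightarrow> 'p::prime_card mod_ring poly) set)"
  unfolding grid_index_def by (intro finite_PiE finite_degree_less) auto

lemma card_grid_index:
  "n \<ge> 1 \<Longrightarrow> card (grid_index s n :: (nat \<Rightarrow> 'p::prime_card mod_ring poly) set) = (CARD('p) ^ n) ^ s"
  by (simp add: grid_index_def card_PiE card_degree_less)

lemma grid_index_nonempty: "n \<ge> 1 \<Longrightarrow> grid_index s n \<noteq> {}"
  by (auto simp: grid_index_def PiE_eq_empty_iff intro: exI[of _ 0])

lemma grid_point_in_cube: "grid_point s n V \<in> unit_cube s"
  by (simp add: grid_point_def unit_cube_def restrict_PiE_iff nu_range del: atLeastLessThan_iff)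

lemma floor_eq_cell:
  assumes "c > (0 :: real)"
  shows "x \<in> {of_int a / c ..< (of_int a + 1) / c} \<longleftrightarrow> \<lfloor>x * c\<rfloor> = a"
  using assms by (simp add: floor_eq_iff field_simps)

lemma mem_grid_cell:
  "x \<in> grid_cell s n (V :: nat \<Rightarrow> 'p::prime_card mod_ring poly) \<longleftrightarrow>
     x \<in> extensional {1..s} \<and> (\<forall>j\<in>{1..s}. \<lfloor>x j * real CARD('p) ^ n\<rfloor> = digit_sum n (V j))"
proof -
  have c: "real CARD('p) ^ n > 0" using card_gt_1[where 'p='p] by simp
  show ?thesis unfolding grid_cell_def PiE_iff floor_eq_cell[OF c] by blast
qed

lemma grid_cell_subset: "grid_cell s n (V :: nat \<Rightarrow> 'p::prime_card mod_ring poly) \<subseteq> unit_cube s"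
proof
  fix x assume x: "x \<in> grid_cell s n V"
  have c: "real CARD('p) ^ n > 0" using card_gt_1[where 'p='p] by simp
  have "x j \<in> {0..<1}" if "j \<in> {1..s}" for j
  proof -
    have f: "\<lfloor>x j * real CARD('p) ^ n\<rfloor> \<in> {0..<int CARD('p) ^ n}"
      using x that digit_sum_range[of n "V j"] by (simp add: mem_grid_cell)
    then have "0 \<le> x j * real CARD('p) ^ n" by simp
    moreover from f have "x j * real CARD('p) ^ n < of_int (int CARD('p) ^ n)"
      by (simp only: floor_less_iff atLeastLessThan_iff)
    ultimately show ?thesis using c by (auto simp: zero_le_mult_iff)
  qed
  then show "x \<in> unit_cube s" using x by (auto simp: unit_cube_def PiE_iff mem_grid_cell)
qed

lemma grid_cell_exists:
  assumes n: "n \<ge> 1" and x: "x \<in> unit_cube s"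
  shows "\<exists>V\<in>grid_index s n. x \<in> grid_cell s n (V :: nat \<Rightarrow> 'p::prime_card mod_ring poly)"
proof -
  let ?b = "real CARD('p)"
  have c: "?b ^ n > 0" using card_gt_1[where 'p='p] by simp
  have "\<exists>v :: 'p mod_ring poly. Polynomial.degree v < n \<and> \<lfloor>x j * ?b ^ n\<rfloor> = digit_sum n v"
    if "j \<in> {1..s}" for j
  proof -
    have "x j \<in> {0..<1}" using x that by (auto simp: unit_cube_def PiE_iff)
    then have "0 \<le> x j * ?b ^ n" "x j * ?b ^ n < of_int (int CARD('p) ^ n)" using c by auto
    then have "\<lfloor>x j * ?b ^ n\<rfloor> \<in> {0..<int CARD('p) ^ n}"
      by (simp only: floor_less_iff atLeastLessThan_iff zero_le_floor)
    also have "{0..<int CARD('p) ^ n} = digit_sum n ` {v :: 'p mod_ring poly. Polynomial.degree v < n}"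
      using bij_betw_digit_sum[OF n, where 'p='p] by (simp add: bij_betw_def)
    finally show ?thesis by auto
  qed
  then obtain V :: "nat \<Rightarrow> 'p mod_ring poly" where
    V: "\<And>j. j \<in> {1..s} \<Longrightarrow> Polynomial.degree (V j) < n \<and> \<lfloor>x j * ?b ^ n\<rfloor> = digit_sum n (V j)"
    by metis
  have "restrict V {1..s} \<in> grid_index s n" using V by (auto simp: grid_index_def)
  moreover have "x \<in> grid_cell s n (restrict V {1..s})"
    using V x by (auto simp: mem_grid_cell unit_cube_def PiE_iff)
  ultimately show ?thesis by blast
qed

lemma grid_cell_unique:
  assumes n: "n \<ge> 1" and "V \<in> grid_index s n" "V' \<in> grid_index s n"
    and "x \<in> grid_cell s n V" "x \<in> grid_cell s n (V' :: nat \<Rightarrow> 'p::prime_card mod_ring poly)"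
  shows "V = V'"
proof (rule PiE_ext[of V "{1..s}" _ V'])
  show "V j = V' j" if j: "j \<in> {1..s}" for j
  proof -
    have "digit_sum n (V j) = digit_sum n (V' j)"
      using assms(4,5) j by (simp add: mem_grid_cell)
    moreover have "Polynomial.degree (V j) < n" "Polynomial.degree (V' j) < n"
      using assms(2,3) j by (auto simp: grid_index_def PiE_iff)
    ultimately show ?thesis
      using bij_betw_digit_sum[OF n, where 'p='p] by (auto simp: bij_betw_def inj_on_def)
  qed
qed (use assms in \<open>auto simp: grid_index_def\<close>)

lemma measure_grid_cell:
  fixes V :: "nat \<Rightarrow> 'p::prime_card mod_ring poly"
  shows "grid_cell s n V \<in> sets (PiM {1..s} (\<lambda>_. lborel))"
    and "emeasure (PiM {1..s} (\<lambda>_. lborel)) (grid_cell s n V) = ennreal (1 / (real CARD('p) ^ n) ^ s)"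
proof -
  interpret product_sigma_finite "\<lambda>_ :: nat. lborel :: real measure"
    by standard (rule lborel.sigma_finite_countable)
  show "grid_cell s n V \<in> sets (PiM {1..s} (\<lambda>_. lborel))"
    unfolding grid_cell_def by (intro sets_PiM_I_finite) auto
  let ?c = "real CARD('p) ^ n"
  have c: "?c > 0" using card_gt_1[where 'p='p] by simp
  have "emeasure lborel {of_int (digit_sum n (V j)) / ?c ..< (of_int (digit_sum n (V j)) + 1) / ?c} = ennreal (1 / ?c)" for j
    using c by (simp add: divide_right_mono diff_divide_distrib[symmetric])
  then have "emeasure (PiM {1..s} (\<lambda>_. lborel)) (grid_cell s n V) = (\<Prod>j\<in>{1..s}. ennreal (1 / ?c))"
    unfolding grid_cell_def by (subst emeasure_PiM) auto
  also have "\<dots> = ennreal (1 / ?c ^ s)" using c by (simp add: ennreal_power power_one_over)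
  finally show "emeasure (PiM {1..s} (\<lambda>_. lborel)) (grid_cell s n V) = ennreal (1 / ?c ^ s)" .
qed

text \<open>Replaces \<open>f\<close> on each cell by its value at the lower corner; the result is
  integrable with no assumption on \<open>f\<close>. The \<open>itself\<close> argument carries the
  type \<open>'p\<close>, which cannot be inferred from the other arguments.\<close>

definition grid_step :: "nat \<Rightarrow> nat \<Rightarrow> 'p::prime_card itself \<Rightarrow> ((nat \<Rightarrow> real) \<Rightarrow> complex) \<Rightarrow> (nat \<Rightarrow> real) \<Rightarrow> complex" where
  "grid_step s n _ f x =
     (\<Sum>V\<in>(grid_index s n :: (nat \<Rightarrow> 'p mod_ring poly) set). indicator (grid_cell s n V) x *\<^sub>R f (grid_point s n V))"

lemma grid_step_cell:
  fixes V :: "nat \<Rightarrow> 'p::prime_card mod_ring poly"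
  assumes "n \<ge> 1" "V \<in> grid_index s n" "x \<in> grid_cell s n V"
  shows "grid_step s n TYPE('p) f x = f (grid_point s n V)"
proof -
  have "grid_step s n TYPE('p) f x = (\<Sum>V'\<in>grid_index s n. if V' = V then f (grid_point s n V) else 0)"
    unfolding grid_step_def
  proof (rule sum.cong[OF refl])
    fix V' :: "nat \<Rightarrow> 'p mod_ring poly" assume V': "V' \<in> grid_index s n"
    show "indicator (grid_cell s n V') x *\<^sub>R f (grid_point s n V')
        = (if V' = V then f (grid_point s n V) else 0)"
    proof (cases "V' = V")
      case False
      then have "x \<notin> grid_cell s n V'"
        using grid_cell_unique[OF assms(1) V' assms(2) _ assms(3)] by blast
      then show ?thesis using False by simp
    qed (use assms(3) in simp)
  qed
  then show ?thesis using assms(2) by (simp add: finite_grid_index)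
qed

lemma grid_step_outside:
  "x \<notin> unit_cube s \<Longrightarrow> grid_step s n TYPE('p::prime_card) f x = 0"
  unfolding grid_step_def using grid_cell_subset[where 'p='p and s=s and n=n] by (intro sum.neutral) (auto simp: indicator_def)

lemma integral_grid_step:
  assumes "n \<ge> 1"
  shows "integrable (PiM {1..s} (\<lambda>_. lborel)) (grid_step s n TYPE('p::prime_card) f)"
    and "integral\<^sup>L (PiM {1..s} (\<lambda>_. lborel)) (grid_step s n TYPE('p) f)
       = (\<Sum>V\<in>(grid_index s n :: (nat \<Rightarrow> 'p mod_ring poly) set). f (grid_point s n V)) /
           of_nat (card (grid_index s n :: (nat \<Rightarrow> 'p mod_ring poly) set))"
proof -
  let ?M = "PiM {1..s} (\<lambda>_. lborel :: real measure)"
  let ?G = "grid_index s n :: (nat \<Rightarrow> 'p mod_ring poly) set"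
  note m = measure_grid_cell[where 'p='p and s=s and n=n]
  have int: "integrable ?M (\<lambda>x. indicator (grid_cell s n V) x *\<^sub>R c)" for V :: "nat \<Rightarrow> 'p mod_ring poly" and c :: complex
    using m by (intro integrable_scaleR_left integrable_real_indicator) auto
  have val: "integral\<^sup>L ?M (\<lambda>x. indicator (grid_cell s n V) x *\<^sub>R c) = c / of_nat (card ?G)"
    for V :: "nat \<Rightarrow> 'p mod_ring poly" and c :: complex
  proof -
    have "measure ?M (grid_cell s n V) = 1 / (real CARD('p) ^ n) ^ s"
      using m(2) by (simp add: measure_def)
    then have "integral\<^sup>L ?M (\<lambda>x. indicator (grid_cell s n V) x :: real) = 1 / (real CARD('p) ^ n) ^ s"
      using m(1) by simp
    moreover have "integral\<^sup>L ?M (\<lambda>x. indicator (grid_cell s n V) x *\<^sub>R c)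
        = (integral\<^sup>L ?M (\<lambda>x. indicator (grid_cell s n V) x :: real)) *\<^sub>R c"
      by (rule integral_scaleR_left) (use m in \<open>auto intro!: integrable_real_indicator\<close>)
    ultimately show ?thesis
      by (simp add: card_grid_index[OF assms] scaleR_conv_of_real divide_inverse mult.commute)
  qed
  show "integrable ?M (grid_step s n TYPE('p) f)"
    unfolding grid_step_def[abs_def] by (intro Bochner_Integration.integrable_sum int)
  show "integral\<^sup>L ?M (grid_step s n TYPE('p) f) = (\<Sum>V\<in>?G. f (grid_point s n V)) / of_nat (card ?G)"
    unfolding grid_step_def[abs_def]
    by (subst Bochner_Integration.integral_sum) (simp_all only: int val sum_divide_distrib)
qed

text \<open>The sum over the grid factorises over the coordinates, and by \<open>sum_wal_nu\<close>
  a coordinate in \<open>u\<close> with \<open>h j\<close> not divisible by b^n contributes the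
  factor 0.\<close>

lemma avg_grid_walsh_prod:
  fixes u :: "nat set"
  assumes n: "n \<ge> 1" and l: "(u, h) \<in> walsh_index s" and nd: "\<not> (\<forall>j\<in>u. CARD('p::prime_card) ^ n dvd h j)"
  shows "(\<Sum>V\<in>(grid_index s n :: (nat \<Rightarrow> 'p mod_ring poly) set). walsh_prod CARD('p) (u, h) (grid_point s n V)) = 0"
proof -
  have u: "u \<subseteq> {1..s}" and h: "\<And>j. j \<in> u \<Longrightarrow> h j \<ge> 1" using l by (auto simp: walsh_index_def PiE_iff)
  obtain j where j: "j \<in> u" "\<not> CARD('p) ^ n dvd h j" using nd by blast
  let ?w = "\<lambda>j v. if j \<in> u then wal CARD('p) (h j) (nu n (v :: 'p mod_ring poly)) else 1"
  have "walsh_prod CARD('p) (u, h) (grid_point s n V) = (\<Prod>j\<in>{1..s}. ?w j (V j))" for V :: "nat \<Rightarrow> 'p mod_ring poly"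
  proof -
    have "(\<Prod>j\<in>{1..s}. ?w j (V j)) = (\<Prod>j\<in>{1..s} \<inter> u. wal CARD('p) (h j) (nu n (V j)))"
      by (rule prod.inter_restrict[symmetric]) simp
    also have "\<dots> = (\<Prod>j\<in>u. wal CARD('p) (h j) (grid_point s n V j))"
      using u by (intro prod.cong) (auto simp: grid_point_def)
    finally show ?thesis by (simp add: walsh_prod_def)
  qed
  then have "(\<Sum>V\<in>(grid_index s n :: (nat \<Rightarrow> 'p mod_ring poly) set). walsh_prod CARD('p) (u, h) (grid_point s n V))
      = (\<Sum>V\<in>(grid_index s n :: (nat \<Rightarrow> 'p mod_ring poly) set). \<Prod>j\<in>{1..s}. ?w j (V j))"
    by simp
  also have "\<dots> = (\<Prod>j\<in>{1..s}. \<Sum>v | Polynomial.degree v < n. ?w j v)"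
    unfolding grid_index_def by (rule prod_sum_PiE[symmetric]) (auto intro: finite_degree_less)
  also have "\<dots> = 0"
  proof (rule prod_zero)
    show "\<exists>j\<in>{1..s}. (\<Sum>v | Polynomial.degree v < n. ?w j v) = 0"
      using j u sum_wal_nu[OF h[OF j(1)] n, where 'p='p] by (intro bexI[of _ j]) auto
  qed simp
  finally show ?thesis .
qed

text \<open>The indices that a grid of level n does not resolve. Outside the tail the Walsh product
  is constant on cells (\<open>walsh_prod_eq_grid_point\<close>) and has grid average 0
  (\<open>walsh_tail_of_dvd\<close> with \<open>avg_grid_walsh_prod\<close>).\<close>

definition walsh_tail :: "nat \<Rightarrow> nat \<Rightarrow> nat set \<times> (nat \<Rightarrow> nat) \<Rightarrow> bool" where
  "walsh_tail b n l \<longleftrightarrow> (\<exists>j\<in>fst l. n \<le> psi b (snd l j))"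

lemma eventually_not_walsh_tail:
  assumes "l \<in> walsh_index s"
  shows "\<forall>\<^sub>F n in sequentially. \<not> walsh_tail b n l"
proof -
  have "fst l \<subseteq> {1..s}" using assms by (auto simp: walsh_index_def)
  then have "finite (fst l)" by (rule finite_subset) simp
  then have "\<forall>\<^sub>F n in sequentially. \<forall>j\<in>fst l. psi b (snd l j) < n"
    by (intro eventually_ball_finite ballI eventually_gt_at_top)
  then show ?thesis by eventually_elim (auto simp: walsh_tail_def not_le)
qed

lemma walsh_tail_of_dvd:
  assumes "b \<ge> 2" "(u, h) \<in> walsh_index s" "\<forall>j\<in>u. b ^ n dvd h j"
  shows "walsh_tail b n (u, h)"
proof -
  obtain j where j: "j \<in> u" "h j \<ge> 1" using assms(2) by (auto simp: walsh_index_def PiE_iff)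
  then have "b ^ n \<le> h j" using assms(3) by (auto intro: dvd_imp_le)
  then show ?thesis using psi_ge[OF assms(1) j(2)] j(1) by (auto simp: walsh_tail_def)
qed

lemma walsh_prod_eq_grid_point:
  fixes V :: "nat \<Rightarrow> 'p::prime_card mod_ring poly"
  assumes "l \<in> walsh_index s" "\<not> walsh_tail CARD('p) n l" "x \<in> grid_cell s n V"
  shows "walsh_prod CARD('p) l x = walsh_prod CARD('p) l (grid_point s n V)"
proof -
  obtain u h where l: "l = (u, h)" by (cases l)
  have "wal CARD('p) (h j) (x j) = wal CARD('p) (h j) (grid_point s n V j)" if j: "j \<in> u" for j
  proof -
    have js: "j \<in> {1..s}" using assms(1) j by (auto simp: l walsh_index_def)
    then have "\<lfloor>x j * real CARD('p) ^ n\<rfloor> = digit_sum n (V j)" using assms(3) by (simp add: mem_grid_cell)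
    moreover have "psi CARD('p) (h j) < n" using assms(2) j by (auto simp: l walsh_tail_def)
    ultimately have "wal CARD('p) (h j) (nu n (V j)) = wal CARD('p) (h j) (x j)" by (rule wal_eq_wal_nu)
    then show ?thesis using js by (simp add: grid_point_def)
  qed
  then show ?thesis by (simp add: l walsh_prod_def)
qed

text \<open>The argument \<open>p\<close> pins down the type \<open>'p\<close>: the kernel sees only
  its cardinality, but grids and nodes are built from polynomials over that field.\<close>

locale walsh_rkhs = rkhs "unit_cube s" "walsh_kernel CARD('p::prime_card) s \<alpha> \<gamma>" H ip
  for p :: "'p::prime_card itself" and s :: nat and \<alpha> :: real and \<gamma> :: "nat set \<Rightarrow> real"
    and H :: "((nat \<Rightarrow> real) \<Rightarrow> complex) set"
    and ip :: "((nat \<Rightarrow> real) \<Rightarrow> complex) \<Rightarrow> ((nat \<Rightarrow> real) \<Rightarrow> complex) \<Rightarrow> complex" +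
  assumes \<alpha>: "\<alpha> > 1" and \<gamma>: "\<And>u. u \<subseteq> {1..s} \<Longrightarrow> \<gamma> u \<ge> 0"
begin

lemma card_ge_2: "CARD('p) \<ge> 2" using card_gt_1[where 'p='p] by simp

sublocale expanded_kernel "unit_cube s" "walsh_kernel CARD('p) s \<alpha> \<gamma>" "walsh_index s" "walsh_coeff CARD('p) \<alpha> \<gamma>" "walsh_prod CARD('p)"
  using expanded_walsh_kernel[of "CARD('p)" \<alpha> s \<gamma>] card_ge_2 \<alpha> \<gamma> by blast

definition tail_sum :: "nat \<Rightarrow> real" where
  "tail_sum n = infsum (walsh_coeff CARD('p) \<alpha> \<gamma>) {l \<in> walsh_index s. walsh_tail CARD('p) n l}"

lemma tail_sum_tendsto: "tail_sum \<longlonglongrightarrow> 0"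
  unfolding tail_sum_def[abs_def]
  by (intro infsum_filter_tendsto_0 \<rho>_summable \<rho>_nonneg eventually_not_walsh_tail)

text \<open>A point and the corner of its cell are separated only by Walsh products in the tail, so
  their kernel distance is small, uniformly in \<open>x\<close>.\<close>

lemma grid_step_close:
  assumes f: "f \<in> H" and x: "x \<in> unit_cube s" and n: "n \<ge> 1"
  shows "cmod (grid_step s n TYPE('p) f x - f x) \<le> ip_norm ip f * sqrt (4 * tail_sum n)"
proof -
  obtain V :: "nat \<Rightarrow> 'p mod_ring poly" where V: "V \<in> grid_index s n" "x \<in> grid_cell s n V"
    using grid_cell_exists[OF n x] by blast
  let ?y = "grid_point s n V"
  let ?K = "walsh_kernel CARD('p) s \<alpha> \<gamma>"
  have "Re (?K ?y ?y - ?K ?y x - ?K x ?y + ?K x x) \<le> 4 * tail_sum n"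
    unfolding tail_sum_def using walsh_prod_eq_grid_point[OF _ _ V(2)]
    by (intro kernel_diff_le) auto
  then have "ip_norm ip f * sqrt (Re (?K ?y ?y - ?K ?y x - ?K x ?y + ?K x x)) \<le> ip_norm ip f * sqrt (4 * tail_sum n)"
    using ip_norm_nonneg[OF f] by (intro mult_left_mono) auto
  moreover have "cmod (f ?y - f x) \<le> ip_norm ip f * sqrt (Re (?K ?y ?y - ?K ?y x - ?K x ?y + ?K x x))"
    by (rule norm_diff_sections[OF f grid_point_in_cube x])
  ultimately show ?thesis using grid_step_cell[OF n V] by simp
qed

lemma grid_step_bounded:
  assumes f: "f \<in> H" and n: "n \<ge> 1"
  shows "cmod (grid_step s n TYPE('p) f x)
           \<le> ip_norm ip f * sqrt (1 + infsum (walsh_coeff CARD('p) \<alpha> \<gamma>) (walsh_index s)) * indicator (unit_cube s) x"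
proof (cases "x \<in> unit_cube s")
  case True
  obtain V :: "nat \<Rightarrow> 'p mod_ring poly" where V: "V \<in> grid_index s n" "x \<in> grid_cell s n V"
    using grid_cell_exists[OF n True] by blast
  have "cmod (f (grid_point s n V)) \<le> ip_norm ip f * sqrt (Re (walsh_kernel CARD('p) s \<alpha> \<gamma> (grid_point s n V) (grid_point s n V)))"
    by (rule norm_point_eval[OF f grid_point_in_cube])
  also have "\<dots> \<le> ip_norm ip f * sqrt (1 + infsum (walsh_coeff CARD('p) \<alpha> \<gamma>) (walsh_index s))"
    using ip_norm_nonneg[OF f] kernel_diag_le by (intro mult_left_mono) auto
  finally show ?thesis using grid_step_cell[OF n V] True by simp
qed (simp add: grid_step_outside)

text \<open>Measurability of \<open>f\<close> is derived here: \<open>f\<close> is the pointwise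
  limit of its step functions. The uniform bound of \<open>grid_step_bounded\<close> then allows
  dominated convergence.\<close>

lemma integral_eq_limit:
  assumes f: "f \<in> H"
  shows "(\<lambda>n. (\<Sum>V\<in>(grid_index s (Suc n) :: (nat \<Rightarrow> 'p mod_ring poly) set). f (grid_point s (Suc n) V)) /
             of_nat (card (grid_index s (Suc n) :: (nat \<Rightarrow> 'p mod_ring poly) set)))
           \<longlonglongrightarrow> (LINT x:unit_cube s|PiM {1..s} (\<lambda>_. lborel). f x)"
proof -
  let ?M = "PiM {1..s} (\<lambda>_. lborel :: real measure)"
  \<comment> \<open>Levels start at 1, because no polynomial has degree below 0 and the grid of
    level 0 would be empty for s \<ge> 1.\<close>
  let ?F = "\<lambda>n. grid_step s (Suc n) TYPE('p) f"
  interpret product_sigma_finite "\<lambda>_ :: nat. lborel :: real measure"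
    by standard (rule lborel.sigma_finite_countable)
  have cube: "unit_cube s \<in> sets ?M" "emeasure ?M (unit_cube s) < \<infinity>"
    unfolding unit_cube_def by (intro sets_PiM_I_finite) (auto simp: emeasure_PiM)
  have lim: "(\<lambda>n. ?F n x) \<longlonglongrightarrow> f x" for x
  proof (cases "x \<in> unit_cube s")
    case True
    have "(\<lambda>n. ip_norm ip f * sqrt (4 * tail_sum (Suc n))) \<longlonglongrightarrow> ip_norm ip f * sqrt (4 * 0)"
      by (intro tendsto_intros LIMSEQ_Suc tail_sum_tendsto)
    then have z: "(\<lambda>n. ip_norm ip f * sqrt (4 * tail_sum (Suc n))) \<longlonglongrightarrow> 0" by simp
    have "\<forall>n. norm (?F n x - f x) \<le> ip_norm ip f * sqrt (4 * tail_sum (Suc n))"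
      using grid_step_close[OF f True] by simp
    then have "(\<lambda>n. ?F n x - f x) \<longlonglongrightarrow> 0"
      by (rule Lim_null_comparison[OF always_eventually z])
    then show ?thesis by (rule LIM_zero_cancel)
  qed (simp add: grid_step_outside vanishes_outside[OF f])
  have meas: "?F n \<in> borel_measurable ?M" for n
    using integral_grid_step(1)[of "Suc n" s f, where 'p='p] by (simp add: borel_measurable_integrable)
  have fmeas: "f \<in> borel_measurable ?M"
    using meas lim by (rule borel_measurable_LIMSEQ_metric)
  have "(\<lambda>n. integral\<^sup>L ?M (?F n)) \<longlonglongrightarrow> integral\<^sup>L ?M f"
  proof (rule integral_dominated_convergence)
    show "integrable ?M (\<lambda>x. ip_norm ip f * sqrt (1 + infsum (walsh_coeff CARD('p) \<alpha> \<gamma>) (walsh_index s)) * indicator (unit_cube s) x)"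
      using cube by (intro integrable_mult_right integrable_real_indicator)
    show "AE x in ?M. norm (?F n x)
        \<le> ip_norm ip f * sqrt (1 + infsum (walsh_coeff CARD('p) \<alpha> \<gamma>) (walsh_index s)) * indicator (unit_cube s) x" for n
      using grid_step_bounded[OF f, of "Suc n"] by simp
  qed (use fmeas meas lim in auto)
  moreover have "integral\<^sup>L ?M f = (LINT x:unit_cube s|?M. f x)"
    unfolding set_lebesgue_integral_def using vanishes_outside[OF f]
    by (intro Bochner_Integration.integral_cong refl) (auto simp: indicator_def)
  moreover have "integral\<^sup>L ?M (?F n) = (\<Sum>V\<in>(grid_index s (Suc n) :: (nat \<Rightarrow> 'p mod_ring poly) set). f (grid_point s (Suc n) V)) /
             of_nat (card (grid_index s (Suc n) :: (nat \<Rightarrow> 'p mod_ring poly) set))" for n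
    by (rule integral_grid_step(2)) simp
  ultimately show ?thesis by simp
qed

definition cube_integral :: "((nat \<Rightarrow> real) \<Rightarrow> complex) \<Rightarrow> complex" where
  "cube_integral f = (LINT x:unit_cube s|PiM {1..s} (\<lambda>_. lborel). f x)"

lemma constant_one:
  obtains c where "c \<in> H" "\<And>x. x \<in> unit_cube s \<Longrightarrow> c x = 1" "\<And>f. f \<in> H \<Longrightarrow> ip f c = cube_integral f"
proof (rule constant_one_representer[where S="\<lambda>n. grid_index s (Suc n) :: (nat \<Rightarrow> 'p mod_ring poly) set"
      and p="\<lambda>n. grid_point s (Suc n)" and \<epsilon>="\<lambda>n. tail_sum (Suc n)" and I=cube_integral])
  show "cmod ((\<Sum>V\<in>(grid_index s (Suc n) :: (nat \<Rightarrow> 'p mod_ring poly) set). walsh_kernel CARD('p) s \<alpha> \<gamma> x (grid_point s (Suc n) V))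
        / of_nat (card (grid_index s (Suc n) :: (nat \<Rightarrow> 'p mod_ring poly) set)) - 1) \<le> tail_sum (Suc n)" for n x
    unfolding tail_sum_def
  proof (rule avg_kernel_close)
    fix l assume l: "l \<in> walsh_index s" "\<not> walsh_tail CARD('p) (Suc n) l"
    obtain u h where uh: "l = (u, h)" by (cases l)
    \<comment> \<open>Some coordinate of \<open>h\<close> is not a multiple of b^(n+1): otherwise
      every coordinate would be at least b^(n+1) and \<open>l\<close> would lie in the tail.\<close>
    have "\<not> (\<forall>j\<in>u. CARD('p) ^ Suc n dvd h j)"
      using walsh_tail_of_dvd[OF card_ge_2, of u h s "Suc n"] l uh by blast
    then show "avgW (grid_index s (Suc n) :: (nat \<Rightarrow> 'p mod_ring poly) set) (grid_point s (Suc n)) l = 0"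
      using avg_grid_walsh_prod[of "Suc n" u h s, where 'p='p] l uh by (simp add: avgW_def)
  qed (simp_all add: finite_grid_index grid_index_nonempty)
  show "(\<lambda>n. tail_sum (Suc n)) \<longlonglongrightarrow> 0" by (rule LIMSEQ_Suc[OF tail_sum_tendsto])
  show "(\<lambda>n. (\<Sum>V\<in>(grid_index s (Suc n) :: (nat \<Rightarrow> 'p mod_ring poly) set). f (grid_point s (Suc n) V)) /
             of_nat (card (grid_index s (Suc n) :: (nat \<Rightarrow> 'p mod_ring poly) set)))
           \<longlonglongrightarrow> cube_integral f" if "f \<in> H" for f
    unfolding cube_integral_def by (rule integral_eq_limit[OF that])
qed (simp_all add: finite_grid_index grid_index_nonempty grid_point_in_cube that)

end

section \<open>Averaging over the reduced search space\<close>

lemma coprime_monom_iff: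
  fixes g :: "'p::prime_card mod_ring poly"
  assumes "m \<ge> 1"
  shows "coprime g (Polynomial.monom 1 m) \<longleftrightarrow> Polynomial.coeff g 0 \<noteq> 0"
proof
  assume c: "coprime g (Polynomial.monom 1 m)"
  show "Polynomial.coeff g 0 \<noteq> 0"
  proof
    assume "Polynomial.coeff g 0 = 0"
    then have "Polynomial.monom 1 1 dvd g" by (simp add: monom_dvd_iff_coeff)
    moreover have "Polynomial.monom 1 1 dvd (Polynomial.monom 1 m :: 'p mod_ring poly)"
      using assms by (simp add: monom_dvd_iff_coeff)
    ultimately have "is_unit (Polynomial.monom 1 1 :: 'p mod_ring poly)"
      using c by (meson coprime_common_divisor)
    then have "Polynomial.degree (Polynomial.monom 1 1 :: 'p mod_ring poly) = 0"
      by (rule poly_dvd_1[THEN iffD1, THEN conjunct1])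
    then show False by (simp add: degree_monom_eq)
  qed
next
  assume g: "Polynomial.coeff g 0 \<noteq> 0"
  obtain c q where q: "g = pCons c q" by (cases g)
  have "coprime g [:0, 1:]"
  proof (rule coprimeI)
    fix d assume d: "d dvd g" "d dvd [:0, 1:]"
    have "g - [:0, 1:] * q = [:c:]" by (simp add: q)
    then have "d dvd [:c:]" using d by (metis dvd_diff dvd_mult2)
    moreover have "[:c:] dvd 1" using g by (simp add: q is_unit_const_poly_iff)
    ultimately show "is_unit d" by (rule dvd_trans)
  qed
  then show "coprime g (Polynomial.monom 1 m)"
    by (simp add: monom_altdef coprime_power_right_iff)
qed

lemma search_space_eq:
  assumes "w < m"
  shows "search_space m w = {g :: 'p::prime_card mod_ring poly. Polynomial.degree g < m - w \<and> Polynomial.coeff g 0 \<noteq> 0}"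
proof -
  have "gcd g (Polynomial.monom 1 m) = 1 \<longleftrightarrow> Polynomial.coeff g 0 \<noteq> 0" for g :: "'p mod_ring poly"
    unfolding coprime_iff_gcd_eq_1[symmetric] using coprime_monom_iff[of m g] assms by simp
  then show ?thesis using assms unfolding search_space_def by auto
qed

lemma finite_search_space: "finite (search_space m w :: 'p::prime_card mod_ring poly set)"
  by (rule finite_subset[OF _ finite.insertI[OF finite_degree_less[of m], of 1]])
     (auto simp: search_space_def split: if_splits)

lemma one_in_search_space: "1 \<in> (search_space m w :: 'p::prime_card mod_ring poly set)"
  by (auto simp: search_space_def)

lemma card_search_space_pos: "card (search_space m w :: 'p::prime_card mod_ring poly set) > 0"
  using one_in_search_space[of m w, where 'p='p] by (auto simp: card_gt_0_iff finite_search_space)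

text \<open>The origin of the factor 2 in the final constant: adding 1 maps the polynomials with
  zero constant term injectively to those with nonzero constant term, so the latter make up at least
  half.\<close>

lemma card_search_space_ge:
  assumes "w < m"
  shows "CARD('p) ^ (m - w) \<le> 2 * card (search_space m w :: 'p::prime_card mod_ring poly set)"
proof -
  let ?A = "{g :: 'p mod_ring poly. Polynomial.degree g < m - w}"
  let ?G = "{g \<in> ?A. Polynomial.coeff g 0 \<noteq> 0}" and ?N = "{g \<in> ?A. Polynomial.coeff g 0 = 0}"
  have fin: "finite ?A" by (rule finite_degree_less)
  have "card ?N \<le> card ?G"
  proof (rule card_inj_on_le)
    show "(\<lambda>g. g + 1) ` ?N \<subseteq> ?G" using assms by (auto intro: degree_add_less)
  qed (use fin in \<open>auto simp: inj_on_def\<close>)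
  moreover have "card ?A = card ?G + card ?N"
  proof -
    have "card ?A = card (?G \<union> ?N)" by (rule arg_cong[of _ _ card]) auto
    also have "\<dots> = card ?G + card ?N"
      using fin by (intro card_Un_disjoint) auto
    finally show ?thesis .
  qed
  moreover have "search_space m w = ?G" using search_space_eq[OF assms] by auto
  ultimately show ?thesis using card_degree_less[of "m - w", where 'p='p] assms by simp
qed

section \<open>Linear congruences modulo a power of x\<close>

lemma monom_mult_dvd_iff:
  "Polynomial.monom 1 (a + c) dvd Polynomial.monom 1 a * (p :: 'p::prime_card mod_ring poly)
     \<longleftrightarrow> Polynomial.monom 1 c dvd p"
proof -
  have "Polynomial.monom 1 (a + c) = Polynomial.monom 1 a * (Polynomial.monom 1 c :: 'p mod_ring poly)"
    by (simp add: mult_monom)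
  then show ?thesis by (simp add: dvd_times_left_cancel_iff)
qed

lemma monom_dvd_mult_unit_iff:
  fixes g :: "'p::prime_card mod_ring poly"
  assumes "Polynomial.coeff g 0 \<noteq> 0"
  shows "Polynomial.monom 1 j dvd p * g \<longleftrightarrow> Polynomial.monom 1 j dvd p"
proof (cases "j \<ge> 1")
  case True
  then have "coprime g (Polynomial.monom 1 j)" using coprime_monom_iff[OF True, of g] assms by simp
  then have "coprime (Polynomial.monom 1 j) g" by (rule coprime_commute[THEN iffD1])
  then show ?thesis by (rule coprime_dvd_mult_left_iff)
qed (simp add: monom_dvd_iff_coeff)

text \<open>Write t as x^k times a unit modulo x^M. Two solutions then agree modulo x^(M-k), so a
  solution is determined by its k coefficients from position M - k to M - 1.\<close>

lemma card_congruent_le: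
  fixes t C :: "'p::prime_card mod_ring poly"
  assumes t: "Polynomial.monom 1 k dvd t" "\<not> Polynomial.monom 1 (Suc k) dvd t" and k: "k < M"
  shows "card {g. Polynomial.degree g < M \<and> Polynomial.monom 1 M dvd t * g + C} \<le> CARD('p) ^ k"
proof -
  obtain t' where t': "t = Polynomial.monom 1 k * t'" using t(1) by blast
  have "Polynomial.coeff t' 0 \<noteq> 0"
  proof
    assume "Polynomial.coeff t' 0 = 0"
    then have "Polynomial.monom 1 1 dvd t'" by (simp add: monom_dvd_iff_coeff)
    then show False using t(2) monom_mult_dvd_iff[of k 1 t'] by (simp add: t')
  qed
  note unit = monom_dvd_mult_unit_iff[OF this]
  let ?S = "{g. Polynomial.degree g < M \<and> Polynomial.monom 1 M dvd t * g + C}"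
  let ?\<phi> = "\<lambda>g :: 'p mod_ring poly. restrict (Polynomial.coeff g) {M - k..<M}"
  have "card ?S \<le> card ({M - k..<M} \<rightarrow>\<^sub>E (UNIV :: 'p mod_ring set))"
  proof (rule card_inj_on_le[where f="?\<phi>"])
    show "inj_on ?\<phi> ?S"
    proof (rule inj_onI)
      fix g g' assume g: "g \<in> ?S" "g' \<in> ?S" and eq: "?\<phi> g = ?\<phi> g'"
      have "Polynomial.monom 1 M dvd (t * g + C) - (t * g' + C)" using g by (intro dvd_diff) auto
      also have "(t * g + C) - (t * g' + C) = Polynomial.monom 1 k * ((g - g') * t')"
        by (simp add: t' algebra_simps)
      finally have "Polynomial.monom 1 (k + (M - k)) dvd Polynomial.monom 1 k * ((g - g') * t')"
        using k by simp
      then have d: "Polynomial.monom 1 (M - k) dvd g - g'"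
        by (simp only: monom_mult_dvd_iff unit)
      have "Polynomial.coeff g i = Polynomial.coeff g' i" for i
      proof -
        consider "i < M - k" | "i \<in> {M - k..<M}" | "i \<ge> M" by fastforce
        then show ?thesis
        proof cases
          case 1
          then show ?thesis using d by (simp add: monom_dvd_iff_coeff)
        next
          case 2
          then show ?thesis using fun_cong[OF eq, of i] by simp
        next
          case 3
          then show ?thesis using g by (simp add: coeff_eq_0)
        qed
      qed
      then show "g = g'" by (simp add: poly_eq_iff)
    qed
    show "?\<phi> ` ?S \<subseteq> {M - k..<M} \<rightarrow>\<^sub>E UNIV" by (simp add: image_subset_iff restrict_PiE_iff)
  qed (simp add: finite_PiE)
  also have "\<dots> = CARD('p) ^ k" using k by (simp add: card_PiE)
  finally show ?thesis .
qed

text \<open>Substituting h = b^k h' raises \<open>psi\<close> by k, which takes out the factor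
  b^(-\<beta>k).\<close>

lemma r_decay_multiples_has_sum:
  assumes b: "b \<ge> 2" and \<beta>: "\<beta> > 1"
  shows "(r_decay b \<beta> has_sum (real b powr (- \<beta> * real k) * mu b \<beta>)) {h\<in>{1..}. b ^ k dvd h}"
proof -
  have "((\<lambda>h. real b powr (- \<beta> * real k) * r_decay b \<beta> h) has_sum (real b powr (- \<beta> * real k) * mu b \<beta>)) {1..}"
    unfolding mu_def by (intro has_sum_cmult_right has_sum_infsum r_decay_summable[OF b \<beta>])
  also have "?this \<longleftrightarrow> ((r_decay b \<beta> \<circ> (\<lambda>h. b ^ k * h)) has_sum (real b powr (- \<beta> * real k) * mu b \<beta>)) {1..}"
    using b by (intro has_sum_cong)
      (simp add: r_decay_def psi_power_mult powr_add[symmetric], simp add: algebra_simps)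
  also have "\<dots> \<longleftrightarrow> (r_decay b \<beta> has_sum (real b powr (- \<beta> * real k) * mu b \<beta>)) ((\<lambda>h. b ^ k * h) ` {1..})"
    using b by (intro has_sum_reindex[symmetric]) (auto simp: inj_on_def)
  also have "(\<lambda>h. b ^ k * h) ` {1..} = {h\<in>{1..}. b ^ k dvd h}"
    using b by (auto elim!: dvdE simp: image_iff)
  finally show ?thesis .
qed

text \<open>Here \<open>c h\<close> stands for the number of admissible g at frequency h. The saving
  b^(-\<beta>k) is weakened to b^(-k), which is just enough to cancel a count of size b^k.\<close>

lemma sum_multiples_le:
  assumes b: "b \<ge> 2" and \<beta>: "\<beta> > 1" and c: "\<And>h. h \<ge> 1 \<Longrightarrow> 0 \<le> c h" "\<And>h. h \<ge> 1 \<Longrightarrow> c h \<le> C"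
    and z: "\<And>h. h \<ge> 1 \<Longrightarrow> \<not> b ^ k dvd h \<Longrightarrow> c h = 0"
  shows "infsum (\<lambda>h. r_decay b \<beta> h * c h) {1..} \<le> C * mu b \<beta> / real b ^ k"
proof -
  have C: "C \<ge> 0" using c[of 1] by simp
  have s: "r_decay b \<beta> summable_on {h\<in>{1..}. b ^ k dvd h}"
    using r_decay_multiples_has_sum[OF b \<beta>] by (auto simp: summable_on_def)
  have le: "r_decay b \<beta> h * c h \<le> r_decay b \<beta> h * C" if "h \<ge> 1" for h
    using c[OF that] by (intro mult_left_mono) (auto simp: r_decay_nonneg)
  have sC: "(\<lambda>h. r_decay b \<beta> h * C) summable_on {h\<in>{1..}. b ^ k dvd h}"
    by (rule summable_on_cmult_left[OF s])
  have "infsum (\<lambda>h. r_decay b \<beta> h * c h) {1..} = infsum (\<lambda>h. r_decay b \<beta> h * c h) {h\<in>{1..}. b ^ k dvd h}"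
    using z by (intro infsum_cong_neutral) auto
  also have "\<dots> \<le> infsum (\<lambda>h. r_decay b \<beta> h * C) {h\<in>{1..}. b ^ k dvd h}"
    using sC le c(1)
    by (intro infsum_mono summable_on_comparison_test[OF sC]) (auto simp: r_decay_nonneg C)
  also have "\<dots> = infsum (r_decay b \<beta>) {h\<in>{1..}. b ^ k dvd h} * C"
    by (rule infsum_cmult_left) (use s in blast)
  also have "\<dots> = real b powr (- \<beta> * real k) * mu b \<beta> * C"
    using infsumI[OF r_decay_multiples_has_sum[OF b \<beta>, of k]] by simp
  also have "\<dots> \<le> real b powr (- real k) * mu b \<beta> * C"
    using b \<beta> C mu_nonneg by (intro mult_right_mono powr_mono) (auto simp: mult_le_cancel_right1 mu_nonneg)
  also have "\<dots> = C * mu b \<beta> / real b ^ k"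
    using b by (simp add: powr_minus powr_realpow field_simps)
  finally show ?thesis .
qed

text \<open>
  If $x^m$ does not divide $B$, all solutions $h$ share one valuation $k$, and each admits at most $b^k$
  choices of $g$; this compensates the factor $b^{-\beta k} \le b^{-k}$ gained from summing over
  multiples of $b^k$.
\<close>
lemma reduced_average_bound:
  fixes B :: "'p::prime_card mod_ring poly"
  assumes \<beta>: "\<beta> > 1"
  shows "infsum (\<lambda>h. r_decay CARD('p) \<beta> h *
           real (card {g\<in>search_space m w. Polynomial.monom 1 m dvd tr_poly m h * (Polynomial.monom 1 w * g) + B})) {1..}
         \<le> 2 * real (card (search_space m w :: 'p mod_ring poly set)) * real CARD('p) ^ w / real CARD('p) ^ m
             * mu CARD('p) \<beta>"
    (is "infsum (\<lambda>h. r_decay ?b \<beta> h * real (card (?S h))) _ \<le> _")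
proof -
  let ?G = "search_space m w :: 'p mod_ring poly set"
  have b: "?b \<ge> 2" using card_gt_1[where 'p='p] by simp
  have finG: "finite ?G" by (rule finite_search_space)
  have S_le: "card (?S h) \<le> card ?G" for h by (rule card_mono[OF finG]) auto
  have Gpos: "card ?G > 0" by (rule card_search_space_pos)
  show ?thesis
  proof (cases "w < m")
    case False
    \<comment> \<open>The search space is a single element, so nothing is gained by averaging. The
      trivial bound (k = 0) suffices because b^w/b^m \<ge> 1.\<close>
    have "infsum (\<lambda>h. r_decay ?b \<beta> h * real (card (?S h))) {1..} \<le> real (card ?G) * mu ?b \<beta> / real ?b ^ 0"
      by (rule sum_multiples_le[OF b \<beta>]) (use S_le in auto)
    also have "\<dots> \<le> real (card ?G) * mu ?b \<beta> * (2 * (real ?b ^ w / real ?b ^ m))"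
    proof -
      have "real ?b ^ m \<le> real ?b ^ w" using False b by (intro power_increasing) auto
      then have "1 \<le> real ?b ^ w / real ?b ^ m" using b by simp
      then have "1 \<le> 2 * (real ?b ^ w / real ?b ^ m)" by linarith
      then show ?thesis
        using mult_left_mono[of 1 "2 * (real ?b ^ w / real ?b ^ m)" "real (card ?G) * mu ?b \<beta>"] mu_nonneg by simp
    qed
    finally show ?thesis by (simp add: mult_ac)
  next
    case True
    define M where "M = m - w"
    have m: "m = w + M" and M: "M \<ge> 1" using True by (auto simp: M_def)
    have bM: "real ?b ^ m = real ?b ^ w * real ?b ^ M" by (simp add: m power_add)
    have G: "?G = {g. Polynomial.degree g < M \<and> Polynomial.coeff g 0 \<noteq> 0}"
      using search_space_eq[OF True] by (simp add: M_def)
    have G2: "real ?b ^ M \<le> 2 * real (card ?G)"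
      using card_search_space_ge[OF True, where 'p='p] unfolding M_def by (simp flip: of_nat_power of_nat_mult)
    have goal: "2 * real (card ?G) * real ?b ^ w / real ?b ^ m * mu ?b \<beta> = 2 * real (card ?G) / real ?b ^ M * mu ?b \<beta>"
      using b by (simp add: bM)
    have tr: "Polynomial.monom 1 j dvd tr_poly m h * g \<longleftrightarrow> ?b ^ j dvd h" if "g \<in> ?G" "j \<le> M" for g h j
    proof -
      have "Polynomial.coeff g 0 \<noteq> 0" using that(1) unfolding G by blast
      then show ?thesis using that(2) by (simp add: monom_dvd_mult_unit_iff monom_dvd_tr_poly m)
    qed
    have shift: "tr_poly m h * (Polynomial.monom 1 w * g) = Polynomial.monom 1 w * (tr_poly m h * g)" for h and g :: "'p mod_ring poly"
      by (simp add: algebra_simps)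
    \<comment> \<open>In the homogeneous condition x^w lowers the modulus to x^M and the unit g
      drops out, so all candidates g impose the same condition on h.\<close>
    have full: "Polynomial.monom 1 m dvd tr_poly m h * (Polynomial.monom 1 w * g) \<longleftrightarrow> ?b ^ M dvd h" if "g \<in> ?G" for g h
      using tr[OF that, of M h] monom_mult_dvd_iff[of w M "tr_poly m h * g"]
      unfolding shift m[symmetric] by simp
    show ?thesis
    proof (cases "Polynomial.monom 1 m dvd B")
      case B: True
      \<comment> \<open>Since x^m divides \<open>B\<close>, the condition is homogeneous. All
        candidates may count, but only for multiples of b^M.\<close>
      have "card (?S h) = 0" if "\<not> ?b ^ M dvd h" for h
      proof -
        have "?S h = {}" using full that dvd_add_left_iff[OF B] by blast
        then show ?thesis by (simp only: card.empty)
      qed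
      then have "infsum (\<lambda>h. r_decay ?b \<beta> h * real (card (?S h))) {1..} \<le> real (card ?G) * mu ?b \<beta> / real ?b ^ M"
        by (intro sum_multiples_le[OF b \<beta>]) (use S_le in auto)
      also have "\<dots> \<le> 2 * real (card ?G) / real ?b ^ M * mu ?b \<beta>"
        using mu_nonneg by (simp add: field_simps)
      finally show ?thesis by (simp only: goal)
    next
      case B: False
      show ?thesis
      proof (cases "\<exists>h0. ?S h0 \<noteq> {}")
        case False
        then have "?S h = {}" for h by blast
        then have "infsum (\<lambda>h. r_decay ?b \<beta> h * real (card (?S h))) {1..} = 0"
          by (simp only: card.empty of_nat_0 mult_zero_right infsum_0_simp)
        then show ?thesis using mu_nonneg by simp
      next
        case True
        then obtain h0 g0 where g0: "g0 \<in> ?G"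
          and d0: "Polynomial.monom 1 m dvd tr_poly m h0 * (Polynomial.monom 1 w * g0) + B" by blast
        have "\<not> ?b ^ M dvd h0" using full[OF g0, of h0] d0 B by (metis dvd_add_right_iff)
        \<comment> \<open>The exponent of b in \<open>h0\<close>. It is below \<open>M\<close>,
          since b^M dividing \<open>h0\<close> would force x^m to divide \<open>B\<close>.\<close>
        define k where "k = (LEAST k. \<not> ?b ^ Suc k dvd h0)"
        have ex: "\<not> ?b ^ Suc (M - 1) dvd h0" using \<open>\<not> ?b ^ M dvd h0\<close> M by simp
        have k1: "\<not> ?b ^ Suc k dvd h0" unfolding k_def by (rule LeastI[of "\<lambda>k. \<not> ?b ^ Suc k dvd h0", OF ex])
        have "k \<le> M - 1" unfolding k_def using ex by (intro Least_le)
        then have kM: "k < M" using M by simp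
        have k0: "?b ^ k dvd h0"
        proof (cases k)
          case (Suc k')
          then have "k' < k" by simp
          then have "\<not> \<not> ?b ^ Suc k' dvd h0" unfolding k_def by (rule not_less_Least)
          then show ?thesis by (simp only: Suc not_not)
        qed simp
        \<comment> \<open>Subtracting two solutions eliminates \<open>B\<close>, and the factors g
          and \<open>g0\<close> are units modulo powers of x. So all solvable h share their
          divisibility by b^j up to j = M.\<close>
        have val: "?b ^ j dvd h \<longleftrightarrow> ?b ^ j dvd h0" if h: "?S h \<noteq> {}" and j: "j \<le> M" for h j
        proof -
          obtain g where g: "g \<in> ?G" and d: "Polynomial.monom 1 m dvd tr_poly m h * (Polynomial.monom 1 w * g) + B"
            using h by blast
          have "Polynomial.monom 1 m dvd (tr_poly m h * (Polynomial.monom 1 w * g) + B)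
              - (tr_poly m h0 * (Polynomial.monom 1 w * g0) + B)"
            using d d0 by (rule dvd_diff)
          also have "\<dots> = Polynomial.monom 1 w * (tr_poly m h * g - tr_poly m h0 * g0)"
            by (simp add: algebra_simps)
          finally have "Polynomial.monom 1 M dvd tr_poly m h * g - tr_poly m h0 * g0"
            using monom_mult_dvd_iff[of w M "tr_poly m h * g - tr_poly m h0 * g0"] by (simp only: m[symmetric])
          moreover have "Polynomial.monom 1 j dvd (Polynomial.monom 1 M :: 'p mod_ring poly)"
            using j by (simp add: monom_dvd_iff_coeff)
          ultimately have "Polynomial.monom 1 j dvd tr_poly m h * g - tr_poly m h0 * g0"
            by (rule dvd_trans[rotated])
          then have "Polynomial.monom 1 j dvd tr_poly m h * g \<longleftrightarrow> Polynomial.monom 1 j dvd tr_poly m h0 * g0"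
            using dvd_add_right_iff[of "Polynomial.monom 1 j" "tr_poly m h * g - tr_poly m h0 * g0" "tr_poly m h0 * g0"]
            by simp
          then show ?thesis using tr[OF g j] tr[OF g0 j] by simp
        qed
        have z: "card (?S h) = 0" if "\<not> ?b ^ k dvd h" for h
        proof -
          have "?S h = {}" using val[OF _ less_imp_le[OF kM], of h] that k0 by blast
          then show ?thesis by (simp only: card.empty)
        qed
        \<comment> \<open>Solvability forces x^w to divide \<open>B\<close>. The congruence can thus
          be divided by x^w, leaving modulus x^M, which matches the degree bound on g.\<close>
        have "Polynomial.monom 1 w dvd (Polynomial.monom 1 m :: 'p mod_ring poly)"
          by (simp add: monom_dvd_iff_coeff m)
        then have "Polynomial.monom 1 w dvd Polynomial.monom 1 w * (tr_poly m h0 * g0) + B"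
          using d0 unfolding shift by (rule dvd_trans)
        then have "Polynomial.monom 1 w dvd B" by (simp add: dvd_add_right_iff)
        then obtain C where C: "B = Polynomial.monom 1 w * C" by blast
        have shifted: "Polynomial.monom 1 m dvd tr_poly m h * (Polynomial.monom 1 w * g) + B
            \<longleftrightarrow> Polynomial.monom 1 M dvd tr_poly m h * g + C" for h and g :: "'p mod_ring poly"
        proof -
          have "tr_poly m h * (Polynomial.monom 1 w * g) + B = Polynomial.monom 1 w * (tr_poly m h * g + C)"
            by (simp add: C algebra_simps)
          then show ?thesis using monom_mult_dvd_iff[of w M "tr_poly m h * g + C"] by (simp only: m[symmetric])
        qed
        have le: "card (?S h) \<le> ?b ^ k" for h
        proof (cases "?S h = {}")
          case False
          then have v: "?b ^ k dvd h" "\<not> ?b ^ Suc k dvd h"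
            using val[of h k] val[of h "Suc k"] k0 k1 kM by auto
          have "card (?S h) \<le> card {g. Polynomial.degree g < M \<and> Polynomial.monom 1 M dvd tr_poly m h * g + C}"
            using shifted by (intro card_mono finite_subset[OF _ finite_degree_less[of M]]) (auto simp: G)
          also have "\<dots> \<le> ?b ^ k"
            using v kM by (intro card_congruent_le) (simp_all add: monom_dvd_tr_poly m del: power_Suc)
          finally show ?thesis .
        next
          case True
          then show ?thesis by (simp only: card.empty)
        qed
        have "infsum (\<lambda>h. r_decay ?b \<beta> h * real (card (?S h))) {1..} \<le> real ?b ^ k * mu ?b \<beta> / real ?b ^ k"
          using z le by (intro sum_multiples_le[OF b \<beta>]) (auto simp flip: of_nat_power)
        also have "\<dots> = mu ?b \<beta>" using b by simp
        also have "\<dots> \<le> 2 * real (card ?G) / real ?b ^ M * mu ?b \<beta>"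
        proof -
          \<comment> \<open>This is \<open>G2\<close>: the candidates are at least half of all
            polynomials of degree below \<open>M\<close>.\<close>
          have "1 \<le> 2 * real (card ?G) / real ?b ^ M" using G2 b by simp
          from mult_right_mono[OF this mu_nonneg] show ?thesis by (simp only: mult_1_left)
        qed
        finally show ?thesis by (simp only: goal)
      qed
    qed
  qed
qed

section \<open>The worst-case error of polynomial lattice rules\<close>

text \<open>The Jensen inequality of the overview. After division by the total every term lies in
  [0,1], where raising to a power \<kappa> \<le> 1 can only increase it.\<close>

lemma sum_powr_le:
  fixes x :: "'i \<Rightarrow> real"
  assumes x: "\<And>i. i \<in> A \<Longrightarrow> x i \<ge> 0" and \<kappa>: "0 < \<kappa>" "\<kappa> \<le> 1"
  shows "(\<Sum>i\<in>A. x i) powr \<kappa> \<le> (\<Sum>i\<in>A. x i powr \<kappa>)"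
proof (cases "finite A \<and> (\<Sum>i\<in>A. x i) > 0")
  case True
  define S where "S = (\<Sum>i\<in>A. x i)"
  have S: "S > 0" using True by (simp add: S_def)
  have "x i / S \<le> x i powr \<kappa> / S powr \<kappa>" if i: "i \<in> A" for i
  proof (cases "x i = 0")
    case False
    have "x i \<le> S" unfolding S_def using True x i by (intro member_le_sum) auto
    then have "(x i / S) powr 1 \<le> (x i / S) powr \<kappa>"
      using S \<kappa> x[OF i] False by (intro powr_mono') auto
    then show ?thesis using S x[OF i] by (simp add: powr_divide)
  qed simp
  then have "(\<Sum>i\<in>A. x i / S) \<le> (\<Sum>i\<in>A. x i powr \<kappa> / S powr \<kappa>)" by (rule sum_mono)
  then have "1 \<le> (\<Sum>i\<in>A. x i powr \<kappa>) / S powr \<kappa>"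
    using S by (simp add: sum_divide_distrib[symmetric] S_def[symmetric])
  then show ?thesis using S by (simp add: S_def[symmetric])
next
  case False
  have "(\<Sum>i\<in>A. x i) \<ge> 0" by (rule sum_nonneg[OF x])
  \<comment> \<open>An infinite \<open>A\<close> belongs to this case as well, its
    \<open>sum\<close> being 0 by convention.\<close>
  then have "(\<Sum>i\<in>A. x i) = 0" using False by (cases "finite A") auto
  then show ?thesis using \<kappa> by (simp add: sum_nonneg)
qed

text \<open>The finite inequality bounds every partial sum by one number, the 1/\<kappa>-th power of
  the right-hand side, and so bounds the infinite sum.\<close>

lemma infsum_powr_le:
  fixes f :: "'a \<Rightarrow> real"
  assumes f: "f summable_on A" "\<And>x. x \<in> A \<Longrightarrow> f x \<ge> 0" and f\<kappa>: "(\<lambda>x. f x powr \<kappa>) summable_on A"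
    and \<kappa>: "0 < \<kappa>" "\<kappa> \<le> 1"
  shows "infsum f A powr \<kappa> \<le> infsum (\<lambda>x. f x powr \<kappa>) A"
proof -
  let ?R = "infsum (\<lambda>x. f x powr \<kappa>) A"
  have R: "?R \<ge> 0" by (intro infsum_nonneg) simp
  have "infsum f A \<le> ?R powr (1 / \<kappa>)"
  proof (rule infsum_le_finite_sums[OF f(1)])
    fix F assume F: "finite F" "F \<subseteq> A"
    have "sum f F powr \<kappa> \<le> (\<Sum>x\<in>F. f x powr \<kappa>)"
      using F f \<kappa> by (intro sum_powr_le) auto
    also have "\<dots> \<le> ?R" using F f\<kappa> by (intro finite_sum_le_infsum) auto
    finally have "(sum f F powr \<kappa>) powr (1 / \<kappa>) \<le> ?R powr (1 / \<kappa>)"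
      using \<kappa> by (intro powr_mono2) auto
    moreover have "sum f F \<ge> 0" using F f by (intro sum_nonneg) auto
    ultimately show "sum f F \<le> ?R powr (1 / \<kappa>)" using \<kappa> by (simp add: powr_powr)
  qed
  then have "infsum f A powr \<kappa> \<le> (?R powr (1 / \<kappa>)) powr \<kappa>"
    using \<kappa> f by (intro powr_mono2 infsum_nonneg) auto
  then show ?thesis using \<kappa> R by (simp add: powr_powr)
qed

definition dual :: "nat \<Rightarrow> (nat \<Rightarrow> 'p::prime_card mod_ring poly) \<Rightarrow> nat set \<times> (nat \<Rightarrow> nat) \<Rightarrow> bool" where
  "dual m a = (\<lambda>(u, h). Polynomial.monom 1 m dvd (\<Sum>j\<in>u. tr_poly m (h j) * a j))"

lemma dual_cong: "(\<And>j. j \<in> fst l \<Longrightarrow> a j = a' j) \<Longrightarrow> dual m a l = dual m a' l"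
  by (cases l) (auto simp: dual_def intro!: arg_cong[where f="(dvd) _"] sum.cong)

text \<open>Multiplicativity of the character moves the product over j into one polynomial, which
  multiplies n. Averaging over n by \<open>sum_add_char_coeff\<close> then tests whether x^m divides
  it.\<close>

lemma walsh_prod_node:
  fixes n :: "'p::prime_card mod_ring poly"
  assumes m: "m \<ge> 1" and l: "(u, h) \<in> walsh_index s"
  shows "walsh_prod CARD('p) (u, h) (node m s a n)
           = add_char (Polynomial.coeff (n * (\<Sum>j\<in>u. tr_poly m (h j) * a j)) (m - 1))"
proof -
  have u: "u \<subseteq> {1..s}" and h: "\<And>j. j \<in> u \<Longrightarrow> h j \<ge> 1" using l by (auto simp: walsh_index_def PiE_iff)
  have "walsh_prod CARD('p) (u, h) (node m s a n)
      = (\<Prod>j\<in>u. add_char (Polynomial.coeff (n * a j * tr_poly m (h j)) (m - 1)))"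
    unfolding walsh_prod_def prod.case
  proof (rule prod.cong[OF refl])
    fix j assume j: "j \<in> u"
    then have "node m s a n j = nu m (n * a j)" using u by (auto simp: node_def)
    then show "wal CARD('p) (h j) (node m s a n j)
        = add_char (Polynomial.coeff (n * a j * tr_poly m (h j)) (m - 1))"
      using wal_nu[OF h[OF j] m] by simp
  qed
  also have "\<dots> = add_char (\<Sum>j\<in>u. Polynomial.coeff (n * a j * tr_poly m (h j)) (m - 1))"
    by (rule add_char_sum[symmetric])
  also have "(\<Sum>j\<in>u. Polynomial.coeff (n * a j * tr_poly m (h j)) (m - 1))
      = Polynomial.coeff (n * (\<Sum>j\<in>u. tr_poly m (h j) * a j)) (m - 1)"
    by (simp only: coeff_sum[symmetric] sum_distrib_left mult_ac)
  finally show ?thesis .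
qed

lemma node_in_cube: "node m s a n \<in> unit_cube s"
  by (simp add: node_def unit_cube_def restrict_PiE_iff nu_range del: atLeastLessThan_iff)

lemma (in walsh_rkhs) worst_case_error_eq:
  fixes a :: "nat \<Rightarrow> 'p mod_ring poly"
  assumes m: "m \<ge> 1"
  shows "worst_case_error H ip m s a
           = sqrt (infsum (walsh_coeff CARD('p) \<alpha> \<gamma>) {l\<in>walsh_index s. dual m a l})"
proof -
  let ?S = "{n :: 'p mod_ring poly. Polynomial.degree n < m}"
  have card: "card ?S = CARD('p) ^ m" by (rule card_degree_less[OF m])
  have fin: "finite ?S" by (rule finite_degree_less)
  have ne: "?S \<noteq> {}" using m by (auto intro: exI[of _ 0])
  have avg: "avgW ?S (node m s a) l = of_bool (dual m a l)" if l: "l \<in> walsh_index s" for l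
  proof -
    obtain u h where uh: "l = (u, h)" by (cases l)
    show ?thesis
      using l sum_add_char_coeff[OF m, of "\<Sum>j\<in>u. tr_poly m (h j) * a j"] card_gt_1[where 'p='p]
      unfolding uh avgW_def card by (simp add: walsh_prod_node[OF m] dual_def)
  qed
  obtain c where c: "c \<in> H" "\<And>x. x \<in> unit_cube s \<Longrightarrow> c x = 1" "\<And>f. f \<in> H \<Longrightarrow> ip f c = cube_integral f"
    using constant_one by blast
  \<comment> \<open>The grid averages of \<open>c\<close> are all 1, as \<open>c\<close> is 1 on the
    cube; their limit is the integral.\<close>
  have Ic: "cube_integral c = 1"
  proof -
    have avg1: "(\<Sum>V\<in>(grid_index s (Suc n) :: (nat \<Rightarrow> 'p mod_ring poly) set). c (grid_point s (Suc n) V)) /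
             of_nat (card (grid_index s (Suc n) :: (nat \<Rightarrow> 'p mod_ring poly) set)) = 1" for n
      using card_gt_1[where 'p='p] by (simp add: c(2) grid_point_in_cube card_grid_index)
    have "(\<lambda>n :: nat. 1) \<longlonglongrightarrow> cube_integral c"
      using integral_eq_limit[OF c(1)] unfolding avg1 cube_integral_def[symmetric] .
    then show ?thesis using LIMSEQ_unique tendsto_const by blast
  qed
  have "(SUP f\<in>{f\<in>H. ip_norm ip f \<le> 1}. cmod (cube_integral f - (\<Sum>n\<in>?S. f (node m s a n)) / of_nat (card ?S)))
      = sqrt (infsum (walsh_coeff CARD('p) \<alpha> \<gamma>) {l\<in>walsh_index s. dual m a l})"
    by (rule worst_case_quadrature(2)[OF fin ne node_in_cube c Ic avg_avg_kernel_dual[OF fin ne avg]])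
  then show ?thesis
    unfolding worst_case_error_def integration_error_def cube_integral_def card .
qed

text \<open>Interchanges the sum over the search space with the infinite sum: summing over g becomes
  counting the admissible g at each index.\<close>

lemma has_sum_mult_card:
  fixes f :: "'a \<Rightarrow> real"
  assumes f: "f summable_on A" "\<And>x. x \<in> A \<Longrightarrow> f x \<ge> 0" and G: "finite G"
  shows "((\<lambda>x. f x * real (card {g\<in>G. P g x})) has_sum (\<Sum>g\<in>G. infsum f {x\<in>A. P g x})) A"
proof -
  have "((\<lambda>x. \<Sum>g\<in>G. f x * of_bool (P g x)) has_sum (\<Sum>g\<in>G. infsum f {x\<in>A. P g x})) A"
    using has_sum_infsum[OF summable_on_of_bool_mult[OF f(1)]]
    by (intro has_sum_finite_sum) (simp only: infsum_of_bool_mult)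
  moreover have "(\<Sum>g\<in>G. f x * of_bool (P g x)) = f x * real (card {g\<in>G. P g x})" for x
    using G by (simp add: sum_distrib_left[symmetric] sum.inter_filter[symmetric] of_bool_def)
  ultimately show ?thesis by simp
qed

lemma slice_average_bound:
  fixes a :: "nat \<Rightarrow> 'p::prime_card mod_ring poly"
  assumes \<beta>: "\<beta> > 1" and u: "finite u" "d \<in> u"
  shows "infsum (\<lambda>h. (\<Prod>j\<in>u. r_decay CARD('p) \<beta> (h j)) *
            real (card {g\<in>search_space m w. dual m (a(d := Polynomial.monom 1 w * g)) (u, h)})) (u \<rightarrow>\<^sub>E {1..})
         \<le> 2 * real (card (search_space m w :: 'p mod_ring poly set)) * real CARD('p) ^ w / real CARD('p) ^ m
             * mu CARD('p) \<beta> ^ card u"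
    (is "infsum ?F _ \<le> ?C * _")
proof -
  let ?b = "CARD('p)" and ?G = "search_space m w :: 'p mod_ring poly set"
  let ?r = "r_decay ?b \<beta>"
  have b: "?b \<ge> 2" using card_gt_1[where 'p='p] by simp
  note r = r_decay_summable[OF b \<beta>] r_decay_nonneg
  define v where "v = u - {d}"
  have v: "finite v" "d \<notin> v" "u = insert d v" using u by (auto simp: v_def)
  \<comment> \<open>Splits off coordinate d: functions on \<open>u\<close> correspond to pairs of a
    function on \<open>v\<close> and a value at d.\<close>
  let ?t = "\<lambda>(h :: nat \<Rightarrow> nat, k). h(d := k)"
  have inj: "inj_on ?t ((v \<rightarrow>\<^sub>E {1..}) \<times> {1..})"
  proof (rule inj_onI)
    fix x y assume xy: "x \<in> (v \<rightarrow>\<^sub>E {1..}) \<times> {1..}" "y \<in> (v \<rightarrow>\<^sub>E ({1..} :: nat set)) \<times> {1..}" "?t x = ?t y"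
    obtain h k h' k' where hk: "x = (h, k)" "y = (h', k')" by (cases x, cases y)
    have h: "h \<in> v \<rightarrow>\<^sub>E {1..}" "h' \<in> v \<rightarrow>\<^sub>E {1..}" and eq: "h(d := k) = h'(d := k')"
      using xy by (auto simp: hk)
    have "h i = h' i" for i
      using fun_cong[OF eq, of i] PiE_arb[OF h(1) v(2)] PiE_arb[OF h(2) v(2)] by (cases "i = d") auto
    then show "x = y" using fun_cong[OF eq, of d] by (auto simp: hk)
  qed
  have img: "?t ` ((v \<rightarrow>\<^sub>E {1..}) \<times> {1..}) = u \<rightarrow>\<^sub>E ({1..} :: nat set)"
    unfolding v(3) PiE_insert_eq by (force simp: image_iff)
  have sF: "?F summable_on (u \<rightarrow>\<^sub>E {1..})"
    using has_sum_mult_card[OF summable_on_prod_PiE[OF u(1) r], of ?G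
        "\<lambda>g h. dual m (a(d := Polynomial.monom 1 w * g)) (u, h)"]
    by (auto simp: summable_on_def finite_search_space intro: prod_nonneg r_decay_nonneg)
  have sF': "(?F \<circ> ?t) summable_on ((v \<rightarrow>\<^sub>E {1..}) \<times> {1..})"
    using sF summable_on_reindex[OF inj, of ?F] unfolding img by blast
  have inner: "infsum (\<lambda>k. (?F \<circ> ?t) (h, k)) {1..} \<le> (\<Prod>j\<in>v. ?r (h j)) * (?C * mu ?b \<beta>)" for h
  proof -
    let ?B = "\<Sum>j\<in>v. tr_poly m (h j) * a j"
    let ?S = "\<lambda>k. {g\<in>?G. Polynomial.monom 1 m dvd tr_poly m k * (Polynomial.monom 1 w * g) + ?B}"
    have "(?F \<circ> ?t) (h, k) = (\<Prod>j\<in>v. ?r (h j)) * (?r k * real (card (?S k)))" for k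
    proof -
      have "(\<Prod>j\<in>u. ?r ((h(d := k)) j)) = ?r k * (\<Prod>j\<in>v. ?r (h j))"
      proof -
        have "(\<Prod>j\<in>v. ?r ((h(d := k)) j)) = (\<Prod>j\<in>v. ?r (h j))"
          using v(2) by (intro prod.cong) auto
        then show ?thesis unfolding v(3) prod.insert[OF v(1,2)] by simp
      qed
      moreover have "(\<Sum>j\<in>u. tr_poly m ((h(d := k)) j) * (a(d := Polynomial.monom 1 w * g)) j)
          = tr_poly m k * (Polynomial.monom 1 w * g) + ?B" for g
      proof -
        have "(\<Sum>j\<in>v. tr_poly m ((h(d := k)) j) * (a(d := Polynomial.monom 1 w * g)) j) = ?B"
          using v(2) by (intro sum.cong) auto
        then show ?thesis unfolding v(3) sum.insert[OF v(1,2)] by simp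
      qed
      ultimately show ?thesis by (simp add: dual_def mult_ac)
    qed
    then have "infsum (\<lambda>k. (?F \<circ> ?t) (h, k)) {1..}
        = infsum (\<lambda>k. (\<Prod>j\<in>v. ?r (h j)) * (?r k * real (card (?S k)))) {1..}" by simp
    also have "\<dots> = (\<Prod>j\<in>v. ?r (h j)) * infsum (\<lambda>k. ?r k * real (card (?S k))) {1..}"
      by (rule infsum_cmult_right')
    also have "\<dots> \<le> (\<Prod>j\<in>v. ?r (h j)) * (?C * mu ?b \<beta>)"
      using reduced_average_bound[OF \<beta>, of m w ?B]
      by (intro mult_left_mono prod_nonneg) (auto simp: r_decay_nonneg)
    finally show ?thesis .
  qed
  have "infsum ?F (u \<rightarrow>\<^sub>E {1..}) = infsum (?F \<circ> ?t) ((v \<rightarrow>\<^sub>E {1..}) \<times> {1..})"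
    using infsum_reindex[OF inj, of ?F] unfolding img .
  also have "\<dots> = infsum (\<lambda>h. infsum (\<lambda>k. (?F \<circ> ?t) (h, k)) {1..}) (v \<rightarrow>\<^sub>E {1..})"
    by (rule infsum_Sigma_banach[symmetric, OF sF'])
  also have "\<dots> \<le> infsum (\<lambda>h. (\<Prod>j\<in>v. ?r (h j)) * (?C * mu ?b \<beta>)) (v \<rightarrow>\<^sub>E {1..})"
  proof (rule infsum_mono)
    show "(\<lambda>h. infsum (\<lambda>k. (?F \<circ> ?t) (h, k)) {1..}) summable_on (v \<rightarrow>\<^sub>E {1..})"
      by (rule summable_on_Sigma_banach) (simp only: case_prod_eta sF')
    show "(\<lambda>h. (\<Prod>j\<in>v. ?r (h j)) * (?C * mu ?b \<beta>)) summable_on (v \<rightarrow>\<^sub>E {1..})"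
      by (intro summable_on_cmult_left summable_on_prod_PiE v r)
  qed (rule inner)
  also have "\<dots> = infsum (\<lambda>h. \<Prod>j\<in>v. ?r (h j)) (v \<rightarrow>\<^sub>E {1..}) * (?C * mu ?b \<beta>)"
    by (rule infsum_cmult_left')
  also have "\<dots> = mu ?b \<beta> ^ card v * (?C * mu ?b \<beta>)"
    using infsum_prod_PiE_power[OF v(1) r] by (simp add: mu_def)
  also have "\<dots> = ?C * mu ?b \<beta> ^ card u" using v by simp
  finally show ?thesis .
qed

section \<open>The reduced successive coordinate search\<close>

lemma dual_average_bound:
  fixes a :: "nat \<Rightarrow> 'p::prime_card mod_ring poly"
  assumes \<beta>: "\<beta> > 1" and \<gamma>: "\<And>u. u \<subseteq> {1..s} \<Longrightarrow> \<gamma> u \<ge> 0"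
  shows "(\<Sum>g\<in>search_space m w. infsum (walsh_coeff CARD('p) \<beta> \<gamma>)
             {l\<in>walsh_index s. d \<in> fst l \<and> dual m (a(d := Polynomial.monom 1 w * g)) l})
         \<le> 2 * real (card (search_space m w :: 'p mod_ring poly set)) * real CARD('p) ^ w / real CARD('p) ^ m *
             (\<Sum>u | d \<in> u \<and> u \<subseteq> {1..s}. \<gamma> u * mu CARD('p) \<beta> ^ card u)"
    (is "?lhs \<le> ?C * _")
proof -
  let ?G = "search_space m w :: 'p mod_ring poly set"
  let ?b = "CARD('p)"
  have b: "?b \<ge> 2" using card_gt_1[where 'p='p] by simp
  let ?f = "walsh_coeff ?b \<beta> \<gamma>"
  let ?U = "{u. d \<in> u \<and> u \<subseteq> {1..s}}"
  let ?A = "{l\<in>walsh_index s. d \<in> fst l}"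
  let ?P = "\<lambda>g l. dual m (a(d := Polynomial.monom 1 w * g)) l"
  let ?F = "\<lambda>l. ?f l * real (card {g\<in>?G. ?P g l})"
  have A: "?A = (SIGMA u:?U. u \<rightarrow>\<^sub>E {1..})" by (auto simp: walsh_index_def)
  have f: "?f summable_on ?A"
    by (rule summable_on_subset_banach[OF walsh_coeff_summable[OF b \<beta> \<gamma>]]) auto
  have "(?F has_sum (\<Sum>g\<in>?G. infsum ?f {l\<in>?A. ?P g l})) ?A"
    using f walsh_coeff_nonneg[of s \<gamma>, OF \<gamma>] by (intro has_sum_mult_card finite_search_space) auto
  moreover have "{l\<in>?A. ?P g l} = {l\<in>walsh_index s. d \<in> fst l \<and> ?P g l}" for g by auto
  ultimately have F: "(?F has_sum ?lhs) ?A" by simp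
  then have sF: "?F summable_on (SIGMA u:?U. u \<rightarrow>\<^sub>E {1..})" unfolding A summable_on_def by blast
  have "?lhs = infsum ?F (SIGMA u:?U. u \<rightarrow>\<^sub>E {1..})" using infsumI[OF F] unfolding A by simp
  also have "\<dots> = infsum (\<lambda>u. infsum (\<lambda>h. ?F (u, h)) (u \<rightarrow>\<^sub>E {1..})) ?U"
    by (rule infsum_Sigma_banach[symmetric, OF sF])
  also have "\<dots> = (\<Sum>u\<in>?U. infsum (\<lambda>h. ?F (u, h)) (u \<rightarrow>\<^sub>E {1..}))"
    by (rule infsum_finite) simp
  also have "\<dots> \<le> (\<Sum>u\<in>?U. ?C * (\<gamma> u * mu ?b \<beta> ^ card u))"
  proof (rule sum_mono)
    fix u assume u: "u \<in> ?U"
    then have fu: "finite u" by (auto intro: finite_subset)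
    have "infsum (\<lambda>h. ?F (u, h)) (u \<rightarrow>\<^sub>E {1..})
        = infsum (\<lambda>h. \<gamma> u * ((\<Prod>j\<in>u. r_decay ?b \<beta> (h j)) * real (card {g\<in>?G. ?P g (u, h)}))) (u \<rightarrow>\<^sub>E {1..})"
      by (simp add: walsh_coeff_def mult.assoc)
    also have "\<dots> = \<gamma> u * infsum (\<lambda>h. (\<Prod>j\<in>u. r_decay ?b \<beta> (h j)) * real (card {g\<in>?G. ?P g (u, h)})) (u \<rightarrow>\<^sub>E {1..})"
      by (rule infsum_cmult_right')
    also have "\<dots> \<le> \<gamma> u * (?C * mu ?b \<beta> ^ card u)"
      using u \<gamma> by (intro mult_left_mono slice_average_bound[OF \<beta> fu]) auto
    finally show "infsum (\<lambda>h. ?F (u, h)) (u \<rightarrow>\<^sub>E {1..}) \<le> ?C * (\<gamma> u * mu ?b \<beta> ^ card u)"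
      by (simp add: mult_ac)
  qed
  finally show ?thesis by (simp only: sum_distrib_left)
qed

lemma r_decay_powr: "r_decay b \<alpha> h powr \<kappa> = r_decay b (\<alpha> * \<kappa>) h"
  by (simp add: r_decay_def powr_powr mult_ac)

text \<open>The power has the form of a Walsh coefficient again, with \<alpha>\<kappa> and powers of
  the weights, so the average bound applies to it.\<close>

lemma walsh_coeff_powr:
  assumes "\<And>u. u \<subseteq> {1..s} \<Longrightarrow> \<gamma> u \<ge> 0" "l \<in> walsh_index s"
  shows "walsh_coeff b \<alpha> \<gamma> l powr \<kappa> = walsh_coeff b (\<alpha> * \<kappa>) (\<lambda>u. \<gamma> u powr \<kappa>) l"
proof -
  obtain u h where l: "l = (u, h)" by (cases l)
  have "(\<Prod>j\<in>u. r_decay b \<alpha> (h j)) powr \<kappa> = (\<Prod>j\<in>u. r_decay b \<alpha> (h j) powr \<kappa>)"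
    by (rule prod_powr_distrib)
  then show ?thesis
    using assms by (simp add: l walsh_coeff_def walsh_index_def powr_mult prod_nonneg r_decay_nonneg r_decay_powr)
qed

context walsh_rkhs
begin

definition dual_sum :: "nat \<Rightarrow> (nat \<Rightarrow> 'p mod_ring poly) \<Rightarrow> (nat set \<Rightarrow> bool) \<Rightarrow> real" where
  "dual_sum m a Q = infsum (walsh_coeff CARD('p) \<alpha> \<gamma>) {l\<in>walsh_index s. Q (fst l) \<and> dual m a l}"

lemma dual_sum_nonneg: "dual_sum m a Q \<ge> 0"
  unfolding dual_sum_def by (intro infsum_nonneg) (auto intro: \<rho>_nonneg)

lemma walsh_coeff_summable_on: "walsh_coeff CARD('p) \<alpha> \<gamma> summable_on {l\<in>walsh_index s. P l}"
  by (rule summable_on_subset_banach[OF \<rho>_summable]) auto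

lemma worst_case_error_sqr:
  assumes "m \<ge> 1"
  shows "(worst_case_error H ip m s a)\<^sup>2 = dual_sum m a (\<lambda>_. True)"
  using dual_sum_nonneg[of m a "\<lambda>_. True"] by (simp add: worst_case_error_eq[OF assms] dual_sum_def)

lemma dual_sum_split:
  "dual_sum m a (\<lambda>_. True) = dual_sum m a (\<lambda>u. d \<in> u) + dual_sum m a (\<lambda>u. d \<notin> u)"
proof -
  have "dual_sum m a (\<lambda>u. d \<in> u) + dual_sum m a (\<lambda>u. d \<notin> u)
      = infsum (walsh_coeff CARD('p) \<alpha> \<gamma>) ({l\<in>walsh_index s. d \<in> fst l \<and> dual m a l} \<union> {l\<in>walsh_index s. d \<notin> fst l \<and> dual m a l})"
    unfolding dual_sum_def by (intro infsum_Un_disjoint[symmetric] walsh_coeff_summable_on) auto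
  also have "{l\<in>walsh_index s. d \<in> fst l \<and> dual m a l} \<union> {l\<in>walsh_index s. d \<notin> fst l \<and> dual m a l}
      = {l\<in>walsh_index s. True \<and> dual m a l}" by auto
  finally show ?thesis by (simp only: dual_sum_def)
qed

text \<open>The lower bound on \<kappa> gives \<alpha>\<kappa> > 1, which makes the powers of the
  coefficients summable.\<close>

lemma dual_sum_powr_le:
  assumes \<kappa>: "1 / \<alpha> < \<kappa>" "\<kappa> \<le> 1"
  shows "dual_sum m a Q powr \<kappa>
           \<le> infsum (walsh_coeff CARD('p) (\<alpha> * \<kappa>) (\<lambda>u. \<gamma> u powr \<kappa>)) {l\<in>walsh_index s. Q (fst l) \<and> dual m a l}"
proof -
  let ?A = "{l\<in>walsh_index s. Q (fst l) \<and> dual m a l}"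
  have "1 / \<alpha> > 0" using \<alpha> by simp
  then have \<kappa>0: "\<kappa> > 0" using \<kappa> by linarith
  have \<alpha>\<kappa>: "\<alpha> * \<kappa> > 1" using \<kappa> \<alpha> by (simp add: field_simps)
  have eq: "walsh_coeff CARD('p) \<alpha> \<gamma> l powr \<kappa> = walsh_coeff CARD('p) (\<alpha> * \<kappa>) (\<lambda>u. \<gamma> u powr \<kappa>) l" if "l \<in> walsh_index s" for l
    using walsh_coeff_powr[of s \<gamma>, OF \<gamma> that] .
  have "walsh_coeff CARD('p) (\<alpha> * \<kappa>) (\<lambda>u. \<gamma> u powr \<kappa>) summable_on ?A"
    by (rule summable_on_subset_banach[OF walsh_coeff_summable[OF card_ge_2 \<alpha>\<kappa>]]) auto
  also have "?this \<longleftrightarrow> (\<lambda>l. walsh_coeff CARD('p) \<alpha> \<gamma> l powr \<kappa>) summable_on ?A"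
    using eq by (intro summable_on_cong) auto
  finally have "dual_sum m a Q powr \<kappa> \<le> infsum (\<lambda>l. walsh_coeff CARD('p) \<alpha> \<gamma> l powr \<kappa>) ?A"
    unfolding dual_sum_def using \<kappa>0 \<kappa> by (intro infsum_powr_le walsh_coeff_summable_on) (auto intro: \<rho>_nonneg)
  also have "\<dots> = infsum (walsh_coeff CARD('p) (\<alpha> * \<kappa>) (\<lambda>u. \<gamma> u powr \<kappa>)) ?A"
    using eq by (intro infsum_cong) auto
  finally show ?thesis .
qed

lemma scs_step_bound:
  fixes g0 g :: "nat \<Rightarrow> 'p mod_ring poly"
  assumes m: "m \<ge> 1" and \<kappa>: "1 / \<alpha> < \<kappa>" "\<kappa> \<le> 1"
    and scs: "reduced_scs (worst_case_error H ip m s) m s w g0 g" and d: "d \<in> {1..s}"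
  shows "dual_sum m (scs_vector w g0 g d (g d)) (\<lambda>u. d \<in> u) powr \<kappa>
           \<le> 2 * real CARD('p) ^ w d / real CARD('p) ^ m *
               (\<Sum>u | d \<in> u \<and> u \<subseteq> {1..s}. \<gamma> u powr \<kappa> * mu CARD('p) (\<alpha> * \<kappa>) ^ card u)"
    (is "?T (g d) powr \<kappa> \<le> ?C * ?W")
proof -
  let ?G = "search_space m (w d) :: 'p mod_ring poly set"
  \<comment> \<open>The 0 is only a placeholder in slot d, which every candidate overwrites.\<close>
  define a where "a = scs_vector w g0 g d 0"
  have vec: "scs_vector w g0 g d h = a(d := Polynomial.monom 1 (w d) * h)" for h
    by (auto simp: a_def scs_vector_def)
  have "1 / \<alpha> > 0" using \<alpha> by simp
  then have \<kappa>0: "\<kappa> > 0" using \<kappa> by linarith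
  have \<alpha>\<kappa>: "\<alpha> * \<kappa> > 1" using \<kappa> \<alpha> by (simp add: field_simps)
  \<comment> \<open>For d outside \<open>u\<close> the dual condition never reads component d, so
    this part of the error cancels when two candidates are compared.\<close>
  have rest: "dual_sum m (scs_vector w g0 g d h) (\<lambda>u. d \<notin> u) = dual_sum m a (\<lambda>u. d \<notin> u)" for h
  proof -
    have "{l\<in>walsh_index s. d \<notin> fst l \<and> dual m (scs_vector w g0 g d h) l} = {l\<in>walsh_index s. d \<notin> fst l \<and> dual m a l}"
      using dual_cong[of _ "scs_vector w g0 g d h" a m] unfolding vec by fastforce
    then show ?thesis by (simp only: dual_sum_def)
  qed
  have le: "?T (g d) \<le> ?T h" if h: "h \<in> ?G" for h
  proof -
    have "(worst_case_error H ip m s (scs_vector w g0 g d (g d)))\<^sup>2 \<le> (worst_case_error H ip m s (scs_vector w g0 g d h))\<^sup>2"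
      using scs d h unfolding reduced_scs_def by blast
    then show ?thesis
      unfolding worst_case_error_sqr[OF m] dual_sum_split[of m _ d] rest by simp
  qed
  have "real (card ?G) * ?T (g d) powr \<kappa> = (\<Sum>h\<in>?G. ?T (g d) powr \<kappa>)" by simp
  also have "\<dots> \<le> (\<Sum>h\<in>?G. infsum (walsh_coeff CARD('p) (\<alpha> * \<kappa>) (\<lambda>u. \<gamma> u powr \<kappa>))
             {l\<in>walsh_index s. d \<in> fst l \<and> dual m (a(d := Polynomial.monom 1 (w d) * h)) l})"
  proof (rule sum_mono)
    fix h assume h: "h \<in> ?G"
    have "?T (g d) powr \<kappa> \<le> ?T h powr \<kappa>"
      using le[OF h] \<kappa>0 dual_sum_nonneg by (intro powr_mono2) auto
    also have "\<dots> \<le> infsum (walsh_coeff CARD('p) (\<alpha> * \<kappa>) (\<lambda>u. \<gamma> u powr \<kappa>))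
             {l\<in>walsh_index s. d \<in> fst l \<and> dual m (scs_vector w g0 g d h) l}"
      by (rule dual_sum_powr_le[OF \<kappa>])
    finally show "?T (g d) powr \<kappa> \<le> infsum (walsh_coeff CARD('p) (\<alpha> * \<kappa>) (\<lambda>u. \<gamma> u powr \<kappa>))
             {l\<in>walsh_index s. d \<in> fst l \<and> dual m (a(d := Polynomial.monom 1 (w d) * h)) l}"
      unfolding vec .
  qed
  also have "\<dots> \<le> 2 * real (card ?G) * real CARD('p) ^ w d / real CARD('p) ^ m * ?W"
    by (rule dual_average_bound[OF \<alpha>\<kappa>]) simp
  also have "\<dots> = real (card ?G) * (?C * ?W)" by simp
  finally show ?thesis
    using card_search_space_pos[of m "w d", where 'p='p] by (simp only: mult_le_cancel_left_pos of_nat_0_less_iff)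
qed

lemma reduced_dual_sum_le:
  "dual_sum m (reduced_vector w g) (\<lambda>_. True)
     \<le> (\<Sum>d=1..s. dual_sum m (scs_vector w g0 g d (g d)) (\<lambda>u. d \<in> u))"
proof -
  let ?f = "walsh_coeff CARD('p) \<alpha> \<gamma>" and ?r = "reduced_vector w g"
  let ?M = "\<lambda>d. {l\<in>walsh_index s. Max (fst l) = d \<and> dual m ?r l}"
  have ne: "fst l \<noteq> {}" "finite (fst l)" "fst l \<subseteq> {1..s}" if "l \<in> walsh_index s" for l
  proof -
    show "fst l \<noteq> {}" "fst l \<subseteq> {1..s}" using that by (auto simp: walsh_index_def)
    from this(2) show "finite (fst l)" by (rule finite_subset) simp
  qed
  have "{l\<in>walsh_index s. True \<and> dual m ?r l} = (\<Union>d\<in>{1..s}. ?M d)"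
  proof (intro equalityI subsetI)
    fix l assume "l \<in> {l\<in>walsh_index s. True \<and> dual m ?r l}"
    then have l: "l \<in> walsh_index s" "dual m ?r l" by auto
    have "Max (fst l) \<in> {1..s}"
      by (rule subsetD[OF ne(3)[OF l(1)] Max_in[OF ne(2)[OF l(1)] ne(1)[OF l(1)]]])
    then show "l \<in> (\<Union>d\<in>{1..s}. ?M d)" using l by blast
  qed auto
  then have "dual_sum m ?r (\<lambda>_. True) = infsum ?f (\<Union>d\<in>{1..s}. ?M d)" by (simp only: dual_sum_def)
  also have "\<dots> = (\<Sum>d=1..s. infsum ?f (?M d))"
    by (intro sum_infsum[symmetric] walsh_coeff_summable_on) auto
  also have "\<dots> \<le> (\<Sum>d=1..s. dual_sum m (scs_vector w g0 g d (g d)) (\<lambda>u. d \<in> u))"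
  proof (rule sum_mono)
    fix d
    let ?v = "scs_vector w g0 g d (g d)"
    \<comment> \<open>Only an inclusion: the right-hand side also counts sets \<open>u\<close> with
      elements above d, whose components are still those of \<open>g0\<close> after step d.\<close>
    have "?M d \<subseteq> {l\<in>walsh_index s. d \<in> fst l \<and> dual m ?v l}"
    proof safe
      fix u h assume l: "(u, h) \<in> walsh_index s" "dual m ?r (u, h)" "d = Max (fst (u, h))"
      show "Max (fst (u, h)) \<in> fst (u, h)" by (rule Max_in[OF ne(2)[OF l(1)] ne(1)[OF l(1)]])
      have "j \<le> d" if "j \<in> u" for j using l(3) ne[OF l(1)] that by simp
      then have "dual m ?v (u, h) = dual m ?r (u, h)"
        by (intro dual_cong) (force simp: scs_vector_def reduced_vector_def)
      then show "dual m (scs_vector w g0 g (Max (fst (u, h))) (g (Max (fst (u, h))))) (u, h)"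
        using l(2,3) by simp
    qed
    then show "infsum ?f (?M d) \<le> dual_sum m ?v (\<lambda>u. d \<in> u)"
      unfolding dual_sum_def by (intro infsum_mono2 walsh_coeff_summable_on) (auto intro: \<rho>_nonneg)
  qed
  finally show ?thesis .
qed

lemma reduced_scs_error_bound:
  fixes g0 g :: "nat \<Rightarrow> 'p mod_ring poly"
  assumes m: "m \<ge> 1" and \<delta>: "\<delta> \<in> {0<..(\<alpha> - 1) / 2}"
    and scs: "reduced_scs (worst_case_error H ip m s) m s w g0 g"
  shows "worst_case_error H ip m s (reduced_vector w g)
           \<le> C_const CARD('p) \<alpha> \<gamma> w \<delta> s * real (CARD('p) ^ m) powr (- \<alpha> / 2 + \<delta>)"
proof -
  \<comment> \<open>Chosen so that the exponent 1/(2\<kappa>) applied below, which undoes \<kappa>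
    and takes the square root of the squared error, equals \<alpha>/2 - \<delta>.\<close>
  define \<kappa> where "\<kappa> = 1 / (\<alpha> - 2 * \<delta>)"
  have \<delta>': "0 < \<delta>" "\<alpha> - 2 * \<delta> \<ge> 1" using \<delta> by auto
  have \<kappa>: "1 / \<alpha> < \<kappa>" "\<kappa> \<le> 1" "\<kappa> > 0"
    using \<delta>' \<alpha> by (auto simp: \<kappa>_def intro!: divide_strict_left_mono)
  let ?b = "CARD('p)" and ?N = "real CARD('p) ^ m"
  let ?W = "weight_sum ?b \<alpha> \<gamma> w \<delta> s" and ?e = "worst_case_error H ip m s (reduced_vector w g)"
  define E where "E = dual_sum m (reduced_vector w g) (\<lambda>_. True)"
  have E0: "E \<ge> 0" by (simp add: E_def dual_sum_nonneg)
  let ?T = "\<lambda>d. dual_sum m (scs_vector w g0 g d (g d)) (\<lambda>u. d \<in> u)"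
  have "E powr \<kappa> \<le> (\<Sum>d=1..s. ?T d) powr \<kappa>"
    using reduced_dual_sum_le[of m w g g0] \<kappa> E0 by (intro powr_mono2) (auto simp: E_def)
  \<comment> \<open>Jensen a second time, now across the search steps; this puts the sum over d
    inside the power in the constant.\<close>
  also have "\<dots> \<le> (\<Sum>d=1..s. ?T d powr \<kappa>)"
    by (rule sum_powr_le) (use \<kappa> dual_sum_nonneg in auto)
  also have "\<dots> \<le> (\<Sum>d=1..s. 2 * real ?b ^ w d / ?N *
               (\<Sum>u | d \<in> u \<and> u \<subseteq> {1..s}. \<gamma> u powr \<kappa> * mu ?b (\<alpha> * \<kappa>) ^ card u))"
    by (intro sum_mono scs_step_bound m \<kappa> scs)
  also have "\<dots> = 2 * ?W / ?N"
    by (simp add: weight_sum_def \<kappa>_def sum_distrib_left sum_divide_distrib mult_ac)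
  finally have "(E powr \<kappa>) powr (1 / (2 * \<kappa>)) \<le> (2 * ?W / ?N) powr (1 / (2 * \<kappa>))"
    using \<kappa> by (intro powr_mono2) auto
  moreover have "(E powr \<kappa>) powr (1 / (2 * \<kappa>)) = ?e"
  proof -
    have "(E powr \<kappa>) powr (1 / (2 * \<kappa>)) = E powr (1 / 2)" using \<kappa> by (simp add: powr_powr)
    also have "\<dots> = sqrt E" using E0 by (simp add: powr_half_sqrt)
    also have "\<dots> = ?e" by (simp add: E_def dual_sum_def worst_case_error_eq[OF m])
    finally show ?thesis .
  qed
  moreover have "1 / (2 * \<kappa>) = \<alpha> / 2 - \<delta>" using \<delta>' by (simp add: \<kappa>_def field_simps)
  ultimately have "?e \<le> (2 * ?W / ?N) powr (\<alpha> / 2 - \<delta>)" by simp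
  also have "\<dots> = (2 * ?W) powr (\<alpha> / 2 - \<delta>) * ?N powr (- (\<alpha> / 2 - \<delta>))"
  proof -
    have "(2 * ?W / ?N) powr (\<alpha> / 2 - \<delta>) = (2 * ?W) powr (\<alpha> / 2 - \<delta>) / ?N powr (\<alpha> / 2 - \<delta>)"
      by (rule powr_divide)
    then show ?thesis by (simp only: powr_minus_divide times_divide_eq_right mult_1_right)
  qed
  finally show ?thesis by (simp add: C_const_def)
qed

end

lemma C_sup_bound:
  assumes s: "s \<ge> 1" and fin: "C_sup b \<alpha> \<gamma> w \<delta> q < \<infinity>"
  shows "2 * weight_sum b \<alpha> \<gamma> w \<delta> s \<le> real s powr q * real_of_ereal (C_sup b \<alpha> \<gamma> w \<delta> q)"
proof -
  have le: "ereal (2 / real s powr q * weight_sum b \<alpha> \<gamma> w \<delta> s) \<le> C_sup b \<alpha> \<gamma> w \<delta> q"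
    unfolding C_sup_def using s by (intro SUP_upper) auto
  \<comment> \<open>\<open>real_of_ereal\<close> is faithful only at finite values; the term at s, a
    real number below the supremum, excludes the lower infinite one.\<close>
  then have "C_sup b \<alpha> \<gamma> w \<delta> q \<noteq> - \<infinity>" by auto
  then obtain r where r: "C_sup b \<alpha> \<gamma> w \<delta> q = ereal r"
    using fin by (cases "C_sup b \<alpha> \<gamma> w \<delta> q") auto
  have "2 / real s powr q * weight_sum b \<alpha> \<gamma> w \<delta> s \<le> r" using le r by simp
  then show ?thesis using s by (simp add: r field_simps)
qed

lemma weight_sum_nonneg: "weight_sum b \<alpha> \<gamma> w \<delta> s \<ge> 0"
  unfolding weight_sum_def by (intro sum_nonneg mult_nonneg_nonneg zero_le_power mu_nonneg) auto

theorem corollary11: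
  fixes b m s :: nat
    and \<alpha> :: real
    and \<gamma> :: "nat set \<Rightarrow> real"
    and w :: "nat \<Rightarrow> nat"
    and H :: "((nat \<Rightarrow> real) \<Rightarrow> complex) set"
    and ip :: "((nat \<Rightarrow> real) \<Rightarrow> complex) \<Rightarrow> ((nat \<Rightarrow> real) \<Rightarrow> complex) \<Rightarrow> complex"
    and g0 g :: "nat \<Rightarrow> 'p::prime_card mod_ring poly"
  assumes "b = CARD('p)"
    and "m \<ge> 1" and "s \<ge> 1" and "\<alpha> > 1"
    and "\<And>u. finite u \<Longrightarrow> u \<subseteq> {1..} \<Longrightarrow> \<gamma> u > 0" and "\<gamma> {} = 1"
    and "mono_on {1..} w"
    and "rkhs (unit_cube s) (walsh_kernel b s \<alpha> \<gamma>) H ip"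
    and "\<forall>j\<in>{1..s}. Polynomial.degree (g0 j) < m"
    and "reduced_scs (worst_case_error H ip m s) m s w g0 g"
  shows "(\<forall>\<delta>\<in>{0<..(\<alpha> - 1) / 2}.
            worst_case_error H ip m s (reduced_vector w g)
              \<le> C_const b \<alpha> \<gamma> w \<delta> s * real (b ^ m) powr (- \<alpha> / 2 + \<delta>))
       \<and> (\<forall>\<delta>\<in>{0<..(\<alpha> - 1) / 2}. \<forall>q\<ge>0. C_sup b \<alpha> \<gamma> w \<delta> q < \<infinity> \<longrightarrow>
            worst_case_error H ip m s (reduced_vector w g)
              \<le> (real s powr q * real_of_ereal (C_sup b \<alpha> \<gamma> w \<delta> q)) powr (\<alpha> / 2 - \<delta>)
                  * real (b ^ m) powr (- \<alpha> / 2 + \<delta>))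
       \<and> (\<forall>\<delta>\<in>{0<..(\<alpha> - 1) / 2}. C_sup b \<alpha> \<gamma> w \<delta> 0 < \<infinity> \<longrightarrow>
            worst_case_error H ip m s (reduced_vector w g)
              \<le> (real_of_ereal (C_sup b \<alpha> \<gamma> w \<delta> 0)) powr (\<alpha> / 2 - \<delta>)
                  * real (b ^ m) powr (- \<alpha> / 2 + \<delta>))"
proof -
  let ?e = "worst_case_error H ip m s (reduced_vector w g)"
  let ?N = "\<lambda>\<delta>. real (b ^ m) powr (- \<alpha> / 2 + \<delta>)"
  have \<gamma>: "\<gamma> u \<ge> 0" if "u \<subseteq> {1..s}" for u
  proof -
    have "finite u" using that by (rule finite_subset) simp
    then show ?thesis using assms(5)[of u] that by fastforce
  qed
  have "walsh_rkhs TYPE('p) s \<alpha> \<gamma> H ip"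
    using assms(8)[unfolded assms(1)] assms(4) \<gamma> by (intro walsh_rkhs.intro walsh_rkhs_axioms.intro) auto
  then interpret walsh_rkhs "TYPE('p)" s \<alpha> \<gamma> H ip .
  have first: "?e \<le> C_const b \<alpha> \<gamma> w \<delta> s * ?N \<delta>" if "\<delta> \<in> {0<..(\<alpha> - 1) / 2}" for \<delta>
    unfolding assms(1) by (rule reduced_scs_error_bound[OF assms(2) that assms(10)])
  have second: "?e \<le> (real s powr q * real_of_ereal (C_sup b \<alpha> \<gamma> w \<delta> q)) powr (\<alpha> / 2 - \<delta>) * ?N \<delta>"
    if \<delta>: "\<delta> \<in> {0<..(\<alpha> - 1) / 2}" and fin: "C_sup b \<alpha> \<gamma> w \<delta> q < \<infinity>" for \<delta> q
  proof -
    have "C_const b \<alpha> \<gamma> w \<delta> s \<le> (real s powr q * real_of_ereal (C_sup b \<alpha> \<gamma> w \<delta> q)) powr (\<alpha> / 2 - \<delta>)"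
      unfolding C_const_def using C_sup_bound[OF assms(3) fin] \<delta> weight_sum_nonneg
      by (intro powr_mono2) auto
    then have "C_const b \<alpha> \<gamma> w \<delta> s * ?N \<delta>
        \<le> (real s powr q * real_of_ereal (C_sup b \<alpha> \<gamma> w \<delta> q)) powr (\<alpha> / 2 - \<delta>) * ?N \<delta>"
      by (intro mult_right_mono) auto
    with first[OF \<delta>] show ?thesis by (rule order_trans)
  qed
  \<comment> \<open>At q = 0 the factor \<open>real s powr 0\<close> is 1 because s is nonzero; in
    HOL \<open>0 powr 0\<close> would be 0.\<close>
  have third: "?e \<le> real_of_ereal (C_sup b \<alpha> \<gamma> w \<delta> 0) powr (\<alpha> / 2 - \<delta>) * ?N \<delta>"
    if "\<delta> \<in> {0<..(\<alpha> - 1) / 2}" "C_sup b \<alpha> \<gamma> w \<delta> 0 < \<infinity>" for \<delta>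
    using second[OF that] assms(3) by simp
  show ?thesis using first second third by blast
qed

end
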